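(* There exists a compact connected almost Kähler manifold $(X,J,\omega)$ of real dimension $6$ such that all of the following hold: \begin{align*} \mathcal{H}^{1,1}_{\bar\partial}\cap P^{1,1}&\not\subseteq \mathcal{H}^{1,1}_{BC}\cap P^{1,1},\\ \mathcal{H}^{1,1}_{\bar\partial}\cap P^{1,1}&\not\subseteq \mathcal{H}^{1,1}_{\partial}\cap P^{1,1},\\ \mathcal{H}^{1,1}_{A}\cap P^{1,1}&\not\subseteq \mathcal{H}^{1,1}_{BC}\cap P^{1,1},\\ \mathcal{H}^{1,1}_{A}\cap P^{1,1}&\not\subseteq \mathcal{H}^{1,1}_{\partial}\cap P^{1,1},\\ \mathcal{H}^{1,1}_{\partial}\cap P^{1,1}&\not\subseteq \mathcal{H}^{1,1}_{\bar\partial}\cap P^{1,1},\\ \mathcal{H}^{1,1}_{\partial}\cap P^{1,1}&\not\subseteq \mathcal{H}^{1,1}_{BC}\cap P^{1,1},\\ \mathcal{H}^{1,1}_{\partial}\cap P^{1,1}&\not\subseteq \mathcal{H}^{1,1}_{A}\cap P^{1,1}. \end{align*}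
   Context: All manifolds are smooth, connected and without boundary. An almost Hermitian manifold $(X,J,\omega)$ of real dimension $2n$ is a manifold $X$ with an almost complex structure $J$ (an endomorphism of $TX$ with $J^2=-\mathrm{id}$, not necessarily integrable) and a Riemannian metric $g$ for which $J$ is an isometry, with fundamental form $\omega(u,v)=g(Ju,v)$. It is almost Kähler if $d\omega=0$. $A^{p,q}$ is the space of smooth complex $(p,q)$-forms with respect to $J$. The exterior differential decomposes as $d=\mu+\partial+\bar\partial+\bar\mu$, where on $A^{p,q}$ the components take values in $A^{p+2,q-1}$, $A^{p+1,q}$, $A^{p,q+1}$, $A^{p-1,q+2}$ respectively. Let $*:A^{p,q}\to A^{n-q,n-p}$ be the $\mathbb{C}$-linear Hodge star, defined by $\alpha\wedge *\bar\beta=\langle\alpha,\beta\rangle\frac{\omega^n}{n!}$, where $\langle\cdot,\cdot\rangle$ is the induced Hermitian inner product on forms. Put $\partial^*=-*\bar\partial*$ and $\bar\partial^*=-*\partial*$ (formal adjoints of $\partial$, $\bar\partial$). Define the Laplacians $$\Delta_\partial=\partial\partial^*+\partial^*\partial,\quad \Delta_{\bar\partial}=\bar\partial\bar\partial^*+\bar\partial^*\bar\partial,$$ $$\Delta_{BC}=\partial\bar\partial\bar\partial^*\partial^*+\bar\partial^*\partial^*\partial\bar\partial+\partial^*\bar\partial\bar\partial^*\partial+\bar\partial^*\partial\partial^*\bar\partial+\partial^*\partial+\bar\partial^*\bar\partial,$$ $$\Delta_{A}=\partial\bar\partial\bar\partial^*\partial^*+\bar\partial^*\partial^*\partial\bar\partial+\partial\bar\partial^*\bar\partial\partial^*+\bar\partial\partial^*\partial\bar\partial^*+\partial\partial^*+\bar\partial\bar\partial^*.$$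 $\mathcal{H}^{p,q}_{\partial}$, $\mathcal{H}^{p,q}_{\bar\partial}$, $\mathcal{H}^{p,q}_{BC}$, $\mathcal{H}^{p,q}_{A}$ denote the kernels of $\Delta_\partial$, $\Delta_{\bar\partial}$, $\Delta_{BC}$, $\Delta_A$ respectively, intersected with $A^{p,q}$. The Lefschetz operator is $L\alpha=\omega\wedge\alpha$, its dual is $\Lambda=-*L*$, and $P^{p,q}=\{\alpha\in A^{p,q}:\Lambda\alpha=0\}$ is the space of primitive $(p,q)$-forms. *)

theory Defs
  imports "HOL-Analysis.Analysis" "HOL-Library.Function_Algebras"
begin

section \<open>Smooth manifolds\<close>

primrec Ck_on :: "nat \<Rightarrow> 'v::real_normed_vector set \<Rightarrow> ('v \<Rightarrow> 'w::real_normed_vector) \<Rightarrow> bool" where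
  "Ck_on 0 S f \<longleftrightarrow> continuous_on S f"
| "Ck_on (Suc k) S f \<longleftrightarrow>
     (\<forall>x\<in>S. f differentiable (at x)) \<and> (\<forall>v. Ck_on k S (\<lambda>x. frechet_derivative f (at x) v))"

text \<open>Only meant for open \<open>S\<close> in a finite-dimensional space, where \<open>Ck_on k\<close> says that all
  iterated directional derivatives up to order \<open>k\<close> exist and are continuous.\<close>

definition smooth_on :: "'v::real_normed_vector set \<Rightarrow> ('v \<Rightarrow> 'w::real_normed_vector) \<Rightarrow> bool" where
  "smooth_on S f \<longleftrightarrow> (\<forall>k. Ck_on k S f)"

type_synonym ('a, 'n) chart = "'a set \<times> ('a \<Rightarrow> real ^ 'n)"

abbreviation chart_dom :: "('a, 'n) chart \<Rightarrow> 'a set" where "chart_dom c \<equiv> fst c"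
abbreviation chart_map :: "('a, 'n) chart \<Rightarrow> 'a \<Rightarrow> real ^ 'n" where "chart_map c \<equiv> snd c"
abbreviation chart_img :: "('a, 'n) chart \<Rightarrow> (real ^ 'n) set" where
  "chart_img c \<equiv> chart_map c ` chart_dom c"
abbreviation chart_inv :: "('a, 'n) chart \<Rightarrow> real ^ 'n \<Rightarrow> 'a" where
  "chart_inv c \<equiv> inv_into (chart_dom c) (chart_map c)"

definition smooth_manifold :: "'a topology \<Rightarrow> ('a, 'n::finite) chart set \<Rightarrow> bool" where
  "smooth_manifold X A \<longleftrightarrow>
     Hausdorff_space X \<and>
     (\<exists>B. countable B \<and> openin X = arbitrary union_of (\<lambda>U. U \<in> B)) \<and>
     (\<Union>c\<in>A. chart_dom c) = topspace X \<and>
     (\<forall>c\<in>A. openin X (chart_dom c) \<and> open (chart_img c) \<and>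
        homeomorphic_map (subtopology X (chart_dom c)) (top_of_set (chart_img c)) (chart_map c)) \<and>
     (\<forall>c\<in>A. \<forall>c'\<in>A. smooth_on (chart_map c ` (chart_dom c \<inter> chart_dom c')) (chart_map c' \<circ> chart_inv c))"

text \<open>The tangent space at \<open>p\<close> is \<open>real ^ 'n\<close>, read in a chart around \<open>p\<close> that is fixed once and
  for all; \<open>chart_change c c' p\<close> converts the components of a tangent vector at \<open>p\<close> from the chart
  \<open>c\<close> to the chart \<open>c'\<close>, so \<open>chart_change c (chart_at A p) p v\<close> is the tangent vector
  at \<open>p\<close> with components \<open>v\<close> in \<open>c\<close>.  Tensor fields are pointwise tensors on these
  spaces, and their smoothness is tested on components with respect to every chart.\<close>

definition chart_at :: "('a, 'n) chart set \<Rightarrow> 'a \<Rightarrow> ('a, 'n) chart" where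
  "chart_at A p = (SOME c. c \<in> A \<and> p \<in> chart_dom c)"

definition chart_change ::
    "('a, 'n::finite) chart \<Rightarrow> ('a, 'n) chart \<Rightarrow> 'a \<Rightarrow> real ^ 'n \<Rightarrow> real ^ 'n" where
  "chart_change c c' p v =
     frechet_derivative (chart_map c' \<circ> chart_inv c) (at (chart_map c p)) v"


section \<open>Exterior algebra of a tangent space\<close>

text \<open>A complex-valued \<open>k\<close>-form on a real vector space is a function on lists of vectors that is
  alternating and multilinear on lists of length \<open>k\<close> and zero on all other lists; a sum of forms of
  different degrees is then again a function on lists.\<close>

definition alt_form :: "nat \<Rightarrow> ('v::real_vector list \<Rightarrow> complex) \<Rightarrow> bool" where
  "alt_form k a \<longleftrightarrow>
     (\<forall>vs. length vs \<noteq> k \<longrightarrow> a vs = 0) \<and>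
     (\<forall>vs i. length vs = k \<and> i < k \<longrightarrow> linear (\<lambda>v. a (vs[i := v]))) \<and>
     (\<forall>vs i j. length vs = k \<and> i < j \<and> j < k \<and> vs ! i = vs ! j \<longrightarrow> a vs = 0)"

definition mixed_form :: "('v::real_vector list \<Rightarrow> complex) \<Rightarrow> bool" where
  "mixed_form a \<longleftrightarrow> (\<forall>k. alt_form k (\<lambda>vs. if length vs = k then a vs else 0))"

text \<open>The sum is over shuffles: \<open>I\<close> is the set of positions passed to \<open>a\<close>, and the exponent counts
  the inversions.\<close>

definition wedge :: "('v list \<Rightarrow> complex) \<Rightarrow> ('v list \<Rightarrow> complex) \<Rightarrow> 'v list \<Rightarrow> complex" where
  "wedge a b vs =
     (\<Sum>I\<in>Pow {..<length vs}.
        (- 1) ^ card {(i, j). i \<in> I \<and> j \<in> {..<length vs} - I \<and> j < i} *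
        a (nths vs I) * b (nths vs (- I)))"

definition wedge_power :: "('v list \<Rightarrow> complex) \<Rightarrow> nat \<Rightarrow> 'v list \<Rightarrow> complex" where
  "wedge_power a k = (wedge a ^^ k) (\<lambda>vs. if vs = [] then 1 else 0)"

text \<open>The Hermitian inner product for which the products
  \<open>e\<^sub>i\<^sub>1 \<and> \<dots> \<and> e\<^sub>i\<^sub>k\<close> with \<open>i\<^sub>1 < \<dots> < i\<^sub>k\<close>
  of a dual orthonormal coframe are orthonormal.\<close>

definition orthonormal_frame :: "(real ^ 'n \<Rightarrow> real ^ 'n \<Rightarrow> real) \<Rightarrow> (real ^ 'n) list" where
  "orthonormal_frame h =
     (SOME es. length es = CARD('n) \<and>
        (\<forall>i<CARD('n). \<forall>j<CARD('n). h (es ! i) (es ! j) = (if i = j then 1 else 0)))"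

definition form_inner ::
    "(real ^ 'n \<Rightarrow> real ^ 'n \<Rightarrow> real) \<Rightarrow>
     ((real ^ 'n) list \<Rightarrow> complex) \<Rightarrow> ((real ^ 'n) list \<Rightarrow> complex) \<Rightarrow> complex" where
  "form_inner h a b =
     (\<Sum>I\<in>Pow {..<CARD('n)}.
        a (nths (orthonormal_frame h) I) * cnj (b (nths (orthonormal_frame h) I)))"

text \<open>The complex-linear star: \<open>a \<and> star b = \<langle>a, conjugate of b\<rangle> vol\<close>.\<close>

definition star_pt ::
    "(real ^ 'n \<Rightarrow> real ^ 'n \<Rightarrow> real) \<Rightarrow> ((real ^ 'n) list \<Rightarrow> complex) \<Rightarrow>
     ((real ^ 'n::finite) list \<Rightarrow> complex) \<Rightarrow> (real ^ 'n) list \<Rightarrow> complex" where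
  "star_pt h vol b =
     (THE c. mixed_form c \<and>
        (\<forall>k a. alt_form k a \<longrightarrow>
           (\<forall>vs. length vs = CARD('n) \<longrightarrow> wedge a c vs = form_inner h a (\<lambda>us. cnj (b us)) * vol vs)))"

text \<open>The complex-multilinear extension of \<open>a\<close> to the complexified space; the pair \<open>(u, w)\<close>
  stands for \<open>u + \<i>w\<close>.\<close>

definition complex_ext :: "('v list \<Rightarrow> complex) \<Rightarrow> ('v \<times> 'v) list \<Rightarrow> complex" where
  "complex_ext a zs =
     (\<Sum>S\<in>Pow {..<length zs}.
        \<i> ^ card S * a (map (\<lambda>j. if j \<in> S then snd (zs ! j) else fst (zs ! j)) [0..<length zs]))"

text \<open>The components \<open>(v - \<i>Jv)/2\<close> and \<open>(v + \<i>Jv)/2\<close> of \<open>v\<close> in the \<open>\<i>\<close>- and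
  \<open>(-\<i>)\<close>-eigenspaces of \<open>J\<close>; each eigenspace consists exactly of the vectors of this shape.\<close>

definition part10 :: "('v::real_vector \<Rightarrow> 'v) \<Rightarrow> 'v \<Rightarrow> 'v \<times> 'v" where
  "part10 J v = ((1/2) *\<^sub>R v, - (1/2) *\<^sub>R J v)"

definition part01 :: "('v::real_vector \<Rightarrow> 'v) \<Rightarrow> 'v \<Rightarrow> 'v \<times> 'v" where
  "part01 J v = ((1/2) *\<^sub>R v, (1/2) *\<^sub>R J v)"


section \<open>Almost Hermitian manifolds\<close>

record ('a, 'n::finite) hermitian_data =
  pts :: "'a topology"
  atlas :: "('a, 'n) chart set"
  acs :: "'a \<Rightarrow> real ^ 'n \<Rightarrow> real ^ 'n"
  metric :: "'a \<Rightarrow> real ^ 'n \<Rightarrow> real ^ 'n \<Rightarrow> real"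

type_synonym ('a, 'n) form = "'a \<Rightarrow> (real ^ 'n) list \<Rightarrow> complex"

definition vec_at :: "('a, 'n::finite) hermitian_data \<Rightarrow> ('a, 'n) chart \<Rightarrow> 'a \<Rightarrow> real ^ 'n \<Rightarrow> real ^ 'n" where
  "vec_at M c p v = chart_change c (chart_at (atlas M) p) p v"

definition comps_at :: "('a, 'n::finite) hermitian_data \<Rightarrow> ('a, 'n) chart \<Rightarrow> 'a \<Rightarrow> real ^ 'n \<Rightarrow> real ^ 'n" where
  "comps_at M c p v = chart_change (chart_at (atlas M) p) c p v"

definition almost_complex_structure :: "('a, 'n::finite) hermitian_data \<Rightarrow> bool" where
  "almost_complex_structure M \<longleftrightarrow>
     (\<forall>p\<in>topspace (pts M). linear (acs M p) \<and> (\<forall>v. acs M p (acs M p v) = - v)) \<and>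
     (\<forall>c\<in>atlas M. \<forall>v. smooth_on (chart_img c)
        (\<lambda>x. let p = chart_inv c x in comps_at M c p (acs M p (vec_at M c p v))))"

definition riemannian_metric :: "('a, 'n::finite) hermitian_data \<Rightarrow> bool" where
  "riemannian_metric M \<longleftrightarrow>
     (\<forall>p\<in>topspace (pts M).
        bilinear (metric M p) \<and>
        (\<forall>u v. metric M p u v = metric M p v u) \<and>
        (\<forall>v. v \<noteq> 0 \<longrightarrow> metric M p v v > 0)) \<and>
     (\<forall>c\<in>atlas M. \<forall>u v. smooth_on (chart_img c)
        (\<lambda>x. let p = chart_inv c x in metric M p (vec_at M c p u) (vec_at M c p v)))"

definition almost_hermitian :: "('a, 'n::finite) hermitian_data \<Rightarrow> bool" where
  "almost_hermitian M \<longleftrightarrow>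
     smooth_manifold (pts M) (atlas M) \<and> almost_complex_structure M \<and> riemannian_metric M \<and>
     (\<forall>p\<in>topspace (pts M). \<forall>u v. metric M p (acs M p u) (acs M p v) = metric M p u v)"

definition smooth_forms :: "('a, 'n::finite) hermitian_data \<Rightarrow> nat \<Rightarrow> ('a, 'n) form set" where
  "smooth_forms M k =
     {\<alpha>. (\<forall>p\<in>topspace (pts M). alt_form k (\<alpha> p)) \<and>
         (\<forall>p. p \<notin> topspace (pts M) \<longrightarrow> \<alpha> p = 0) \<and>
         (\<forall>c\<in>atlas M. \<forall>vs. smooth_on (chart_img c)
            (\<lambda>x. let p = chart_inv c x in \<alpha> p (map (vec_at M c p) vs)))}"

definition fund_form :: "('a, 'n::finite) hermitian_data \<Rightarrow> ('a, 'n) form" where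
  "fund_form M p vs =
     (if p \<in> topspace (pts M) \<and> length vs = 2
      then complex_of_real (metric M p (acs M p (vs ! 0)) (vs ! 1)) else 0)"

text \<open>\<open>d\<alpha>(v\<^sub>0,\<dots>,v\<^sub>k) = \<Sum>\<^sub>i (-1)\<^sup>i v\<^sub>i(\<alpha>(v\<^sub>0,\<dots>,v\<^sub>i omitted,\<dots>,v\<^sub>k))\<close>, where the
  vectors at \<open>p\<close> are extended with constant components in the chart at \<open>p\<close>.\<close>

definition ext_d :: "('a, 'n::finite) hermitian_data \<Rightarrow> ('a, 'n) form \<Rightarrow> ('a, 'n) form" where
  "ext_d M \<alpha> p vs =
     (if p \<in> topspace (pts M) then
        let c = chart_at (atlas M) p in
        \<Sum>i<length vs. (- 1) ^ i *
          frechet_derivative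
            (\<lambda>x. \<alpha> (chart_inv c x) (map (vec_at M c (chart_inv c x)) (take i vs @ drop (Suc i) vs)))
            (at (chart_map c p)) (vs ! i)
      else 0)"

definition almost_kaehler :: "('a, 'n::finite) hermitian_data \<Rightarrow> bool" where
  "almost_kaehler M \<longleftrightarrow> almost_hermitian M \<and> ext_d M (fund_form M) = 0"

abbreviation cdim :: "('a, 'n::finite) hermitian_data \<Rightarrow> nat" where
  "cdim M \<equiv> CARD('n) div 2"


section \<open>Forms of type (p,q) and the operators\<close>

definition forms :: "('a, 'n::finite) hermitian_data \<Rightarrow> nat \<Rightarrow> nat \<Rightarrow> ('a, 'n) form set" where
  "forms M p q =
     {\<alpha> \<in> smooth_forms M (p + q).
        \<forall>x\<in>topspace (pts M). \<forall>us ws. length us + length ws = p + q \<and> length us \<noteq> p \<longrightarrow>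
          complex_ext (\<alpha> x) (map (part10 (acs M x)) us @ map (part01 (acs M x)) ws) = 0}"

text \<open>The \<open>(p,q)\<close>-component of a form: split every argument into its two parts, expand, and keep
  the terms with \<open>p\<close> arguments of type \<open>(1,0)\<close> and \<open>q\<close> of type \<open>(0,1)\<close>.\<close>

definition bideg :: "('a, 'n::finite) hermitian_data \<Rightarrow> nat \<Rightarrow> nat \<Rightarrow> ('a, 'n) form \<Rightarrow> ('a, 'n) form" where
  "bideg M p q \<alpha> x vs =
     (if x \<in> topspace (pts M) \<and> length vs = p + q then
        \<Sum>S\<in>{S. S \<subseteq> {..<p + q} \<and> card S = p}.
          complex_ext (\<alpha> x)
            (map (\<lambda>j. if j \<in> S then part10 (acs M x) (vs ! j) else part01 (acs M x) (vs ! j)) [0..<p + q])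
      else 0)"

definition del :: "('a, 'n::finite) hermitian_data \<Rightarrow> ('a, 'n) form \<Rightarrow> ('a, 'n) form" where
  "del M \<alpha> = (\<Sum>p\<le>cdim M. \<Sum>q\<le>cdim M. bideg M (Suc p) q (ext_d M (bideg M p q \<alpha>)))"

definition delbar :: "('a, 'n::finite) hermitian_data \<Rightarrow> ('a, 'n) form \<Rightarrow> ('a, 'n) form" where
  "delbar M \<alpha> = (\<Sum>p\<le>cdim M. \<Sum>q\<le>cdim M. bideg M p (Suc q) (ext_d M (bideg M p q \<alpha>)))"

definition vol_form :: "('a, 'n::finite) hermitian_data \<Rightarrow> ('a, 'n) form" where
  "vol_form M p vs = wedge_power (fund_form M p) (cdim M) vs / fact (cdim M)"

definition hodge :: "('a, 'n::finite) hermitian_data \<Rightarrow> ('a, 'n) form \<Rightarrow> ('a, 'n) form" where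
  "hodge M \<alpha> p = (if p \<in> topspace (pts M) then star_pt (metric M p) (vol_form M p) (\<alpha> p) else 0)"

definition del_adj :: "('a, 'n::finite) hermitian_data \<Rightarrow> ('a, 'n) form \<Rightarrow> ('a, 'n) form" where
  "del_adj M \<alpha> = - hodge M (delbar M (hodge M \<alpha>))"

definition delbar_adj :: "('a, 'n::finite) hermitian_data \<Rightarrow> ('a, 'n) form \<Rightarrow> ('a, 'n) form" where
  "delbar_adj M \<alpha> = - hodge M (del M (hodge M \<alpha>))"

definition lefschetz :: "('a, 'n::finite) hermitian_data \<Rightarrow> ('a, 'n) form \<Rightarrow> ('a, 'n) form" where
  "lefschetz M \<alpha> p = wedge (fund_form M p) (\<alpha> p)"

definition lefschetz_dual :: "('a, 'n::finite) hermitian_data \<Rightarrow> ('a, 'n) form \<Rightarrow> ('a, 'n) form" where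
  "lefschetz_dual M \<alpha> = - hodge M (lefschetz M (hodge M \<alpha>))"

definition laplace_del :: "('a, 'n::finite) hermitian_data \<Rightarrow> ('a, 'n) form \<Rightarrow> ('a, 'n) form" where
  "laplace_del M \<alpha> = del M (del_adj M \<alpha>) + del_adj M (del M \<alpha>)"

definition laplace_delbar :: "('a, 'n::finite) hermitian_data \<Rightarrow> ('a, 'n) form \<Rightarrow> ('a, 'n) form" where
  "laplace_delbar M \<alpha> = delbar M (delbar_adj M \<alpha>) + delbar_adj M (delbar M \<alpha>)"

definition laplace_BC :: "('a, 'n::finite) hermitian_data \<Rightarrow> ('a, 'n) form \<Rightarrow> ('a, 'n) form" where
  "laplace_BC M \<alpha> =
     del M (delbar M (delbar_adj M (del_adj M \<alpha>)))
   + delbar_adj M (del_adj M (del M (delbar M \<alpha>)))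
   + del_adj M (delbar M (delbar_adj M (del M \<alpha>)))
   + delbar_adj M (del M (del_adj M (delbar M \<alpha>)))
   + del_adj M (del M \<alpha>)
   + delbar_adj M (delbar M \<alpha>)"

definition laplace_A :: "('a, 'n::finite) hermitian_data \<Rightarrow> ('a, 'n) form \<Rightarrow> ('a, 'n) form" where
  "laplace_A M \<alpha> =
     del M (delbar M (delbar_adj M (del_adj M \<alpha>)))
   + delbar_adj M (del_adj M (del M (delbar M \<alpha>)))
   + del M (delbar_adj M (delbar M (del_adj M \<alpha>)))
   + delbar M (del_adj M (del M (delbar_adj M \<alpha>)))
   + del M (del_adj M \<alpha>)
   + delbar M (delbar_adj M \<alpha>)"

definition harm_del :: "('a, 'n::finite) hermitian_data \<Rightarrow> nat \<Rightarrow> nat \<Rightarrow> ('a, 'n) form set" where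
  "harm_del M p q = {\<alpha> \<in> forms M p q. laplace_del M \<alpha> = 0}"

definition harm_delbar :: "('a, 'n::finite) hermitian_data \<Rightarrow> nat \<Rightarrow> nat \<Rightarrow> ('a, 'n) form set" where
  "harm_delbar M p q = {\<alpha> \<in> forms M p q. laplace_delbar M \<alpha> = 0}"

definition harm_BC :: "('a, 'n::finite) hermitian_data \<Rightarrow> nat \<Rightarrow> nat \<Rightarrow> ('a, 'n) form set" where
  "harm_BC M p q = {\<alpha> \<in> forms M p q. laplace_BC M \<alpha> = 0}"

definition harm_A :: "('a, 'n::finite) hermitian_data \<Rightarrow> nat \<Rightarrow> nat \<Rightarrow> ('a, 'n) form set" where
  "harm_A M p q = {\<alpha> \<in> forms M p q. laplace_A M \<alpha> = 0}"

definition primitive :: "('a, 'n::finite) hermitian_data \<Rightarrow> nat \<Rightarrow> nat \<Rightarrow> ('a, 'n) form set" where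
  "primitive M p q = {\<alpha> \<in> forms M p q. lefschetz_dual M \<alpha> = 0}"

end

theory Submission
  imports Defs
begin

text \<open>On the torus of dimension six take \<open>\<omega> = dx\<^sub>1 \<and> dx\<^sub>2 + dx\<^sub>3 \<and> dx\<^sub>4 + dx\<^sub>5 \<and> dx\<^sub>6\<close>
  and the unitary coframe \<open>z\<^sub>1 = dx\<^sub>1 + \<i>dx\<^sub>2\<close>, \<open>z\<^sub>2\<close>, \<open>z\<^sub>3\<close> with conjugates \<open>w\<^sub>k\<close>, where
  \<open>dz\<^sub>2 = dx\<^sub>2 \<and> (5\<i>z\<^sub>2 + 4\<i>w\<^sub>2)\<close> and \<open>dz\<^sub>3 = dx\<^sub>2 \<and> 5\<i>z\<^sub>3\<close>; it is periodic because the eigenvalues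
  \<open>\<plusminus>3\<i>\<close> and \<open>\<plusminus>5\<i>\<close> of the system are integer multiples of \<open>\<i>\<close>.  The primitive form
  \<open>\<alpha>\<^sub>1 = w\<^sub>2 \<and> z\<^sub>3\<close> is annihilated by the delbar operator, by both adjoints, but
  not by the del operator; its image \<open>2 w\<^sub>1 \<and> z\<^sub>2 \<and> z\<^sub>3\<close> is again primitive.  So \<open>\<alpha>\<^sub>1\<close> lies in the kernels of the
  delbar and the Aeppli Laplacian, while it is an eigenvector of the two others with eigenvalues \<open>8\<close>
  and \<open>408\<close>.  Its conjugate \<open>\<alpha>\<^sub>2\<close> lies in the kernel of the del Laplacian and is an eigenvector of the delbar,
  Bott--Chern and Aeppli Laplacians with eigenvalues \<open>8\<close>, \<open>472\<close> and \<open>64\<close>.\<close>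

section \<open>Exterior algebra on list functions\<close>

text \<open>The constants are tuned. A traceless block with off-diagonal entries \<open>-b\<close>
  and \<open>a\<close> has eigenvalues plus and minus \<open>i sqrt(ab)\<close> and gives
  \<open>dz = dx \<and> (i(a+b)/2 z + i(a-b)/2 w)\<close>. With \<open>a = 9\<close>,
  \<open>b = 1\<close> both \<open>sqrt(ab) = 3\<close> and \<open>(a+b)/2 = 5\<close> are integers.
  The third pair rotates with the same coefficient 5, so that the diagonal terms of
  \<open>w2\<close> and \<open>z3\<close> cancel in the differential of \<open>\<alpha>1\<close>;
  what survives is \<open>2 (w1 - z1) \<and> z2 \<and> z3\<close>.

  Conjugation exchanges del and delbar, but the term \<open>delbar_adj del_adj del delbar\<close> of
  the two fourth-order Laplacians is not symmetric under it. On \<open>\<alpha>1\<close> it vanishes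
  with delbar. On \<open>\<alpha>2\<close> it does not: del delbar gives \<open>-4 \<sigma>2\<close>
  although del gives 0, because del and delbar do not anticommute here. This is why
  \<open>\<alpha>2\<close> fails to be Aeppli harmonic.

  All operators preserve the forms with constant coefficients in the coframe and act on them by
  finite linear algebra. Most of the work is to reduce the definitions, which go through charts, a
  chosen frame and a definite description, to that algebra.\<close>

definition ins :: "'v \<Rightarrow> ('v list \<Rightarrow> complex) \<Rightarrow> 'v list \<Rightarrow> complex" where
  "ins v a vs = a (v # vs)"

text \<open>The grading involution; it supplies the sign with which an interior product passes the
  left factor of a wedge.\<close>

definition sgnf :: "('v list \<Rightarrow> complex) \<Rightarrow> 'v list \<Rightarrow> complex" where
  "sgnf a vs = (- 1) ^ length vs * a vs"

definition smul :: "complex \<Rightarrow> ('v list \<Rightarrow> complex) \<Rightarrow> 'v list \<Rightarrow> complex" where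
  "smul c a vs = c * a vs"

definition unit_form :: "'v list \<Rightarrow> complex" where
  "unit_form vs = (if vs = [] then 1 else 0)"

definition one_form :: "('v \<Rightarrow> complex) \<Rightarrow> 'v list \<Rightarrow> complex" where
  "one_form f vs = (case vs of [v] \<Rightarrow> f v | _ \<Rightarrow> 0)"

text \<open>Subsets are split by whether they contain 0, that is, by where the head of an argument
  list goes. Sums over position sets become recursions on lists in this way.\<close>

lemma sum_Pow_lessThan_Suc:
  fixes F :: "nat set \<Rightarrow> 'b::comm_monoid_add"
  shows "(\<Sum>I\<in>Pow {..<Suc n}. F I)
    = (\<Sum>I\<in>Pow {..<n}. F (insert 0 (Suc ` I))) + (\<Sum>I\<in>Pow {..<n}. F (Suc ` I))"
proof -
  have *: "Pow {..<Suc n} = (`) Suc ` Pow {..<n} \<union> insert 0 ` (`) Suc ` Pow {..<n}"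
    by (simp add: lessThan_Suc_eq_insert_0 Pow_insert image_Pow_surj)
  have inj: "inj ((`) Suc)" by (simp add: inj_image_eq_iff inj_def)
  have inj2: "inj_on (insert 0) ((`) Suc ` Pow {..<n})"
  proof (rule inj_onI)
    fix A B assume "A \<in> (`) Suc ` Pow {..<n}" "B \<in> (`) Suc ` Pow {..<n}"
      and eq: "insert 0 A = insert 0 B"
    then have "0 \<notin> A" "0 \<notin> B" by auto
    with eq show "A = B" by (metis Diff_insert_absorb)
  qed
  have "(\<Sum>I\<in>Pow {..<Suc n}. F I)
      = sum F ((`) Suc ` Pow {..<n}) + sum F (insert 0 ` (`) Suc ` Pow {..<n})"
    unfolding * by (rule sum.union_disjoint) auto
  also have "\<dots> = (\<Sum>I\<in>Pow {..<n}. F (Suc ` I)) + (\<Sum>I\<in>Pow {..<n}. F (insert 0 (Suc ` I)))"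
    using inj by (simp add: sum.reindex[OF inj2] sum.reindex inj_on_subset)
  finally show ?thesis by (simp add: add.commute)
qed

lemma wedge_Nil [simp]: "wedge a b [] = a [] * b []"
  by (simp add: wedge_def)

text \<open>The Leibniz rule for the interior product \<open>ins v\<close>, as a recursion on the argument list;
  identities between forms follow from it by induction without any bookkeeping of shuffles.\<close>

lemma wedge_Cons: "wedge a b (v # vs) = wedge (ins v a) b vs + wedge (sgnf a) (ins v b) vs"
proof -
  define n where "n = length vs"
  define inv where "inv n I = {(i, j). i \<in> I \<and> j \<in> {..<n} - I \<and> j < i}" for n :: nat and I
  have fin: "finite (inv n I)" if "I \<subseteq> {..<n}" for I
    by (rule finite_subset[of _ "{..<n} \<times> {..<n}"]) (use that in \<open>auto simp: inv_def\<close>)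
  \<comment> \<open>Position 0, when it belongs to \<open>I\<close>, is smaller than every other
    position and takes part in no inversion.\<close>
  have inv0: "card (inv (Suc n) (insert 0 (Suc ` I))) = card (inv n I)" if "I \<subseteq> {..<n}" for I
  proof -
    have "inv (Suc n) (insert 0 (Suc ` I)) = map_prod Suc Suc ` inv n I"
    proof (intro set_eqI iffI)
      fix x assume "x \<in> inv (Suc n) (insert 0 (Suc ` I))"
      then obtain i j where x: "x = (i, j)" "i \<in> insert 0 (Suc ` I)" "j < Suc n"
        "j \<notin> insert 0 (Suc ` I)" "j < i"
        by (auto simp: inv_def)
      then obtain i' j' where "i = Suc i'" "j = Suc j'" "i' \<in> I" by (cases i; cases j) auto
      with x show "x \<in> map_prod Suc Suc ` inv n I"
        by (auto simp: inv_def intro!: image_eqI[of _ _ "(i', j')"])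
    qed (auto simp: inv_def)
    then show ?thesis by (simp add: card_image inj_on_subset[OF prod.inj_map])
  qed
  \<comment> \<open>Position 0, when it is outside \<open>I\<close>, is inverted with each element
    of \<open>I\<close>; the extra factor \<open>(- 1) ^ card I\<close> becomes
    \<open>sgnf\<close>.\<close>
  have inv1: "card (inv (Suc n) (Suc ` I)) = card (inv n I) + card I" if "I \<subseteq> {..<n}" for I
  proof -
    have "inv (Suc n) (Suc ` I) = map_prod Suc Suc ` inv n I \<union> (\<lambda>i. (Suc i, 0)) ` I"
    proof (intro set_eqI iffI)
      fix x assume "x \<in> inv (Suc n) (Suc ` I)"
      then obtain i j where x: "x = (i, j)" "i \<in> Suc ` I" "j < Suc n" "j \<notin> Suc ` I" "j < i"
        by (auto simp: inv_def)
      then obtain i' where i': "i = Suc i'" "i' \<in> I" by auto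
      show "x \<in> map_prod Suc Suc ` inv n I \<union> (\<lambda>i. (Suc i, 0)) ` I"
      proof (cases j)
        case (Suc j')
        with x i' show ?thesis
          by (auto simp: inv_def intro!: image_eqI[of _ _ "(i', j')"])
      qed (use x i' in auto)
    qed (auto simp: inv_def)
    moreover have "finite I" using that finite_subset by blast
    moreover have "card (map_prod Suc Suc ` inv n I) = card (inv n I)"
      by (simp add: card_image inj_on_subset[OF prod.inj_map])
    moreover have "card ((\<lambda>i. (Suc i, 0::nat)) ` I) = card I"
      by (simp add: card_image inj_on_def)
    moreover have "map_prod Suc Suc ` inv n I \<inter> (\<lambda>i. (Suc i, 0)) ` I = {}" by auto
    ultimately show ?thesis using fin[OF that] by (simp add: card_Un_disjoint)
  qed
  have len: "length (nths vs I) = card I" if "I \<subseteq> {..<n}" for I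
  proof -
    have "{i. i < length vs \<and> i \<in> I} = I" using that by (auto simp: n_def)
    then show ?thesis by (simp add: length_nths)
  qed
  have n0: "{j. Suc j \<in> insert 0 (Suc ` I)} = I" "{j. Suc j \<in> Suc ` I} = I"
    "{j. j \<notin> I} = - I" "{j. Suc j \<notin> Suc ` I} = - I" for I by auto
  show ?thesis
    unfolding wedge_def length_Cons sum_Pow_lessThan_Suc n_def[symmetric] inv_def[symmetric]
    by (intro arg_cong2[where f = "(+)"] sum.cong refl)
       (auto simp: inv0 inv1 nths_Cons ins_def sgnf_def n0 len power_add)
qed

lemma form_eqI:
  assumes "a [] = b []" "\<And>v. ins v a = ins v b"
  shows "a = b"
proof
  fix vs show "a vs = b vs"
    using assms by (cases vs) (auto simp: ins_def fun_eq_iff)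
qed

lemma ins_wedge: "ins v (wedge a b) = wedge (ins v a) b + wedge (sgnf a) (ins v b)"
  by (simp add: fun_eq_iff ins_def wedge_Cons)

lemma ins_linear [simp]:
  "ins v (a + b) = ins v a + ins v b" "ins v (a - b) = ins v a - ins v b" "ins v (- a) = - ins v a"
  "ins v 0 = 0" "ins v (smul c a) = smul c (ins v a)" "ins v (sgnf a) = - sgnf (ins v a)"
  "ins v unit_form = 0" "ins v (one_form f) = smul (f v) unit_form"
  by (auto simp: fun_eq_iff ins_def smul_def sgnf_def unit_form_def one_form_def split: list.splits)

lemma sgnf_linear [simp]:
  "sgnf (a + b) = sgnf a + sgnf b" "sgnf (a - b) = sgnf a - sgnf b" "sgnf (- a) = - sgnf a"
  "sgnf 0 = 0" "sgnf (smul c a) = smul c (sgnf a)" "sgnf (sgnf a) = a"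
  "sgnf unit_form = unit_form" "sgnf (one_form f) = - one_form f"
  by (auto simp: fun_eq_iff smul_def sgnf_def unit_form_def one_form_def distrib_left right_diff_distrib
      mult.left_commute left_minus_one_mult_self split: list.splits)

lemma smul_simps [simp]:
  "smul c 0 = 0" "smul 0 a = 0" "smul 1 a = a" "smul c (smul e a) = smul (c * e) a"
  "smul c (- a) = smul (- c) a"
  by (auto simp: fun_eq_iff smul_def)

lemma smul_distrib:
  "smul c (a + b) = smul c a + smul c b" "smul c (a - b) = smul c a - smul c b"
  "smul (c + e) a = smul c a + smul e a" "smul (c - e) a = smul c a - smul e a"
  "- a = smul (- 1) a"
  by (auto simp: fun_eq_iff smul_def algebra_simps)

lemma wedge_add_left: "wedge (a + a') b = wedge a b + wedge a' b"
  by (rule ext) (simp add: wedge_def algebra_simps sum.distrib)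

lemma wedge_add_right: "wedge a (b + b') = wedge a b + wedge a b'"
  by (rule ext) (simp add: wedge_def algebra_simps sum.distrib)

lemma wedge_smul_left [simp]: "wedge (smul c a) b = smul c (wedge a b)"
  by (rule ext) (simp add: wedge_def smul_def algebra_simps sum_distrib_left)

lemma wedge_smul_right [simp]: "wedge a (smul c b) = smul c (wedge a b)"
  by (rule ext) (simp add: wedge_def smul_def algebra_simps sum_distrib_left)

lemma wedge_uminus_left [simp]: "wedge (- a) b = - wedge a b"
  using wedge_smul_left[of "- 1" a b] by (simp add: smul_distrib(5)[symmetric])

lemma wedge_uminus_right [simp]: "wedge a (- b) = - wedge a b"
  using wedge_smul_right[of a "- 1" b] by (simp add: smul_distrib(5)[symmetric])

lemma wedge_diff_left: "wedge (a - a') b = wedge a b - wedge a' b"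
  using wedge_add_left[of a "- a'" b] by simp

lemma wedge_diff_right: "wedge a (b - b') = wedge a b - wedge a b'"
  using wedge_add_right[of a b "- b'"] by simp

lemma wedge_zero [simp]: "wedge 0 b = 0" "wedge a 0 = 0"
  using wedge_smul_left[of 0 0 b] wedge_smul_right[of a 0 0] by simp_all

lemmas wedge_linear = wedge_add_left wedge_add_right wedge_diff_left wedge_diff_right

lemma wedge_unit_left [simp]: "wedge unit_form b = b"
proof
  fix vs show "wedge unit_form b vs = b vs"
    by (induction vs arbitrary: b) (simp_all add: wedge_Cons, simp_all add: unit_form_def ins_def)
qed

lemma wedge_unit_right: "wedge a unit_form = a"
proof
  fix vs show "wedge a unit_form vs = a vs"
    by (induction vs arbitrary: a) (simp_all add: wedge_Cons, simp_all add: unit_form_def ins_def)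
qed

lemma sgnf_wedge: "sgnf (wedge a b) = wedge (sgnf a) (sgnf b)"
proof
  fix vs show "sgnf (wedge a b) vs = wedge (sgnf a) (sgnf b) vs"
  proof (induction vs arbitrary: a b)
    case Nil
    then show ?case by (simp add: sgnf_def)
  next
    case (Cons v vs)
    have "sgnf (wedge a b) (v # vs) = - sgnf (ins v (wedge a b)) vs"
      by (simp add: sgnf_def ins_def)
    also have "\<dots> = - (wedge (sgnf (ins v a)) (sgnf b) vs + wedge (sgnf (sgnf a)) (sgnf (ins v b)) vs)"
      by (simp add: ins_wedge Cons.IH)
    also have "\<dots> = wedge (sgnf a) (sgnf b) (v # vs)"
      by (simp add: wedge_Cons)
    finally show ?case .
  qed
qed

lemma wedge_assoc: "wedge (wedge a b) c = wedge a (wedge b c)"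
proof
  fix vs show "wedge (wedge a b) c vs = wedge a (wedge b c) vs"
    by (induction vs arbitrary: a b c)
       (simp_all add: wedge_Cons ins_wedge wedge_linear sgnf_wedge)
qed

lemma ins_one_wedge: "ins v (wedge (one_form f) a) = smul (f v) a - wedge (one_form f) (ins v a)"
  by (simp add: ins_wedge)

lemma wedge_one_Cons:
  "wedge (one_form f) a (v # vs) = f v * a vs - wedge (one_form f) (ins v a) vs"
  using ins_one_wedge[of v f a] by (simp add: fun_eq_iff ins_def smul_def)

lemma one_wedge_anticommute:
  "wedge (one_form f) (wedge (one_form g) a) = - wedge (one_form g) (wedge (one_form f) a)"
proof
  fix vs
  show "wedge (one_form f) (wedge (one_form g) a) vs = (- wedge (one_form g) (wedge (one_form f) a)) vs"
  proof (induction vs arbitrary: a)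
    case Nil
    then show ?case by (simp add: one_form_def)
  next
    case (Cons v vs)
    then show ?case
      by (simp add: wedge_one_Cons ins_one_wedge wedge_linear smul_def)
  qed
qed

lemma one_wedge_same: "wedge (one_form f) (wedge (one_form f) a) = 0"
  using one_wedge_anticommute[of f f a] by (simp add: fun_eq_iff)

lemma wedge_one_vanish:
  assumes "\<And>v. v \<in> set vs \<Longrightarrow> f v = 0"
  shows "wedge (one_form f) a vs = 0"
  using assms by (induction vs arbitrary: a) (simp_all add: wedge_one_Cons one_form_def)

section \<open>Alternating multilinear forms\<close>

text \<open>Alternating multilinear forms of all degrees at once. Conditions relative to an
  arbitrary prefix, with adjacent repetitions only, are inherited by \<open>ins v\<close>, which
  suits induction on lists; repetitions at a distance follow in
  \<open>malt_repeated\<close>.\<close>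

definition malt :: "('v::real_vector list \<Rightarrow> complex) \<Rightarrow> bool" where
  "malt a \<longleftrightarrow> (\<forall>us ws. linear (\<lambda>v. a (us @ v # ws))) \<and> (\<forall>us v ws. a (us @ v # v # ws) = 0)"

lemma malt_linear: "malt a \<Longrightarrow> linear (\<lambda>v. a (us @ v # ws))"
  by (simp add: malt_def)

lemma malt_adjacent: "malt a \<Longrightarrow> a (us @ v # v # ws) = 0"
  by (simp add: malt_def)

lemma malt_ins: "malt a \<Longrightarrow> malt (ins v a)"
  using malt_linear[of a "v # _"] malt_adjacent[of a "v # _"]
  by (simp add: malt_def ins_def)

lemma malt_zero: "malt 0"
  by (auto simp: malt_def intro: linear_zero)

lemma malt_add: "malt a \<Longrightarrow> malt b \<Longrightarrow> malt (a + b)"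
  by (auto simp: malt_def intro: linear_compose_add)

lemma malt_smul: "malt a \<Longrightarrow> malt (smul c a)"
  by (auto simp: malt_def smul_def linear_iff scaleR_conv_of_real algebra_simps)

lemma malt_uminus: "malt a \<Longrightarrow> malt (- a)"
  using malt_smul[of a "- 1"] by (simp add: smul_distrib(5)[symmetric])

lemma malt_diff: "malt a \<Longrightarrow> malt b \<Longrightarrow> malt (a - b)"
  using malt_add[of a "- b"] malt_uminus[of b] by simp

lemma malt_sgnf: "malt a \<Longrightarrow> malt (sgnf a)"
  by (auto simp: malt_def sgnf_def linear_iff scaleR_conv_of_real algebra_simps)

lemma malt_unit: "malt unit_form"
  by (auto simp: malt_def unit_form_def intro: linear_zero)

lemma malt_one_form: "linear f \<Longrightarrow> malt (one_form f)"
proof -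
  assume f: "linear f"
  have 1: "one_form f (us @ v # ws) = (if us = [] \<and> ws = [] then f v else 0)" for us v ws
    by (cases us; cases ws; cases "tl us") (auto simp: one_form_def)
  show ?thesis unfolding malt_def 1 using f by (auto simp: linear_iff)
qed

lemma ins_add_vec: "malt a \<Longrightarrow> ins (x + y) a = ins x a + ins y a"
  using linear_add[OF malt_linear[of a "[]"]] by (simp add: fun_eq_iff ins_def)

lemma ins_scaleR: "malt a \<Longrightarrow> ins (r *\<^sub>R x) a = smul (of_real r) (ins x a)"
  using linear_scale[OF malt_linear[of a "[]"]] by (simp add: fun_eq_iff ins_def smul_def scaleR_conv_of_real)

lemma ins_ins_same: "malt a \<Longrightarrow> ins v (ins v a) = 0"
  using malt_adjacent[of a "[]"] by (simp add: fun_eq_iff ins_def)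

lemma ins_swap: "malt a \<Longrightarrow> ins v (ins w a) = - ins w (ins v a)"
  using ins_ins_same[of a "v + w"] ins_ins_same[of a v] ins_ins_same[of a w]
  by (simp add: ins_add_vec malt_ins malt_add eq_neg_iff_add_eq_0 add.commute)

lemma malt_wedge:
  assumes "malt a" "malt b"
  shows "malt (wedge a b)"
proof -
  have "linear (\<lambda>v. wedge a b (us @ v # ws))" for us ws
    using assms
  proof (induction us arbitrary: a b)
    case Nil
    then show ?case
      by (simp add: linear_iff wedge_Cons ins_add_vec ins_scaleR wedge_linear malt_sgnf)
         (simp add: smul_def scaleR_conv_of_real algebra_simps)
  next
    case (Cons u us)
    then show ?case
      by (simp add: wedge_Cons linear_compose_add malt_ins malt_sgnf)
  qed
  moreover have "wedge a b (us @ v # v # ws) = 0" for us v ws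
    using assms
  proof (induction us arbitrary: a b)
    case Nil
    then show ?case
      by (simp add: wedge_Cons ins_ins_same)
  next
    case (Cons u us)
    then show ?case
      by (simp add: wedge_Cons malt_ins malt_sgnf)
  qed
  ultimately show ?thesis by (simp add: malt_def)
qed

lemmas malt_intros = malt_zero malt_add malt_smul malt_uminus malt_diff malt_sgnf malt_unit
  malt_one_form malt_wedge malt_ins

lemma malt_swap:
  assumes "malt a"
  shows "a (us @ v # w # ws) = - a (us @ w # v # ws)"
  using assms
proof (induction us arbitrary: a)
  case Nil
  then show ?case using ins_swap[of a w v] by (simp add: fun_eq_iff ins_def)
next
  case (Cons u us)
  then show ?case using malt_ins[of a u] by (fastforce simp: ins_def)
qed

lemma malt_repeated:
  assumes "malt a"
  shows "a (us @ v # ms @ v # ws) = 0"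
proof (induction ms arbitrary: us)
  case Nil
  then show ?case using malt_adjacent[OF assms] by simp
next
  case (Cons m ms)
  then show ?case using malt_swap[OF assms, of us v m "ms @ v # ws"] Cons[of "us @ [m]"] by simp
qed

lemma malt_not_distinct:
  assumes "malt a" "\<not> distinct vs"
  shows "a vs = 0"
  using not_distinct_decomp[OF assms(2)] malt_repeated[OF assms(1)] by auto

lemma alt_form_iff_malt:
  "alt_form k a \<longleftrightarrow> malt a \<and> (\<forall>vs. length vs \<noteq> k \<longrightarrow> a vs = 0)"
proof
  assume alt: "alt_form k a"
  have "linear (\<lambda>v. a (us @ v # ws))" for us ws
  proof (cases "length us + Suc (length ws) = k")
    case True
    have L: "length vs = k \<Longrightarrow> i < k \<Longrightarrow> linear (\<lambda>v. a (vs[i := v]))" for vs i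
      using alt by (simp add: alt_form_def)
    show ?thesis using L[of "us @ 0 # ws" "length us"] True by simp
  next
    case False
    then have "(\<lambda>v. a (us @ v # ws)) = (\<lambda>v. 0)" using alt by (auto simp: alt_form_def)
    then show ?thesis by (simp add: linear_zero)
  qed
  moreover have "a (us @ v # v # ws) = 0" for us v ws
  proof (cases "length us + Suc (Suc (length ws)) = k")
    case True
    have "a vs = 0" if "length vs = k" "i < j" "j < k" "vs ! i = vs ! j" for vs i j
      using alt that unfolding alt_form_def by blast
    from this[of "us @ v # v # ws" "length us" "Suc (length us)"] True show ?thesis
      by (simp add: nth_append)
  next
    case False
    then show ?thesis using alt by (simp add: alt_form_def)
  qed
  ultimately show "malt a \<and> (\<forall>vs. length vs \<noteq> k \<longrightarrow> a vs = 0)"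
    using alt by (simp add: malt_def alt_form_def)
next
  assume a: "malt a \<and> (\<forall>vs. length vs \<noteq> k \<longrightarrow> a vs = 0)"
  have "linear (\<lambda>v. a (vs[i := v]))" if "i < length vs" for vs i
    using a malt_linear[of a "take i vs" "drop (Suc i) vs"] by (simp add: upd_conv_take_nth_drop that)
  moreover have "a vs = 0" if "i < j" "j < length vs" "vs ! i = vs ! j" for vs i j
    using a malt_not_distinct[of a vs] that by (metis distinct_conv_nth less_trans nat_neq_iff)
  ultimately show "alt_form k a"
    using a by (auto simp: alt_form_def)
qed

lemma mixed_form_iff_malt: "mixed_form a \<longleftrightarrow> malt a"
proof
  assume m: "mixed_form a"
  define r where "r k vs = (if length vs = k then a vs else 0)" for k and vs :: "'a list"
  have r: "malt (r k)" for k
    using m by (simp add: mixed_form_def alt_form_iff_malt r_def[abs_def])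
  show "malt a"
    unfolding malt_def
  proof (intro conjI allI)
    fix us ws :: "'a list" and v
    show "linear (\<lambda>v. a (us @ v # ws))"
      using malt_linear[OF r, of "length us + Suc (length ws)" us ws] by (simp add: r_def)
    show "a (us @ v # v # ws) = 0"
      using malt_adjacent[OF r, of "length us + Suc (Suc (length ws))" us v ws] by (simp add: r_def)
  qed
next
  assume a: "malt a"
  have "linear (\<lambda>v. if length us + Suc (length ws) = k then a (us @ v # ws) else 0)" for us ws k
    using malt_linear[OF a] by (cases "length us + Suc (length ws) = k") (auto simp: linear_zero)
  then show "mixed_form a"
    unfolding mixed_form_def alt_form_iff_malt malt_def using malt_adjacent[OF a] by simp
qed

lemma malt_move:
  assumes "malt a"
  shows "a (us @ v # ws) = a (v # us @ ws) \<or> a (us @ v # ws) = - a (v # us @ ws)"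
proof (induction us arbitrary: ws rule: rev_induct)
  case (snoc u us)
  then show ?case using malt_swap[OF assms, of us u v ws] snoc[of "u # ws"] by (elim disjE) simp_all
qed simp

text \<open>The sign stays open, as the lemma serves to transfer vanishing from one ordering of the
  arguments to another.\<close>

lemma malt_perm:
  assumes "malt a" "mset us = mset vs"
  shows "a us = a vs \<or> a us = - a vs"
  using assms
proof (induction us arbitrary: a vs)
  case (Cons u us)
  then have "u \<in> set vs" by (metis list.set_intros(1) set_mset_mset)
  then obtain ps qs where vs: "vs = ps @ u # qs" by (meson split_list)
  then have "mset us = mset (ps @ qs)" using Cons.prems by simp
  with Cons.IH[OF malt_ins[OF Cons.prems(1)]]
  have "ins u a us = ins u a (ps @ qs) \<or> ins u a us = - ins u a (ps @ qs)"
    by blast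
  then have "a (u # us) = a (u # ps @ qs) \<or> a (u # us) = - a (u # ps @ qs)"
    by (simp add: ins_def)
  with malt_move[OF Cons.prems(1), of ps u qs] vs show ?case by auto
qed simp

lemma malt_eq_0_spanning:
  assumes "malt a" "span B = UNIV"
    and "\<And>us. length us = n \<Longrightarrow> set us \<subseteq> B \<Longrightarrow> a us = 0"
  shows "length vs = n \<Longrightarrow> a vs = 0"
proof -
  \<comment> \<open>The prefix \<open>us\<close> collects the arguments already replaced by spanning
    vectors; the induction runs over the remaining ones.\<close>
  have "a (us @ ws) = 0" if "length us + length ws = n" "set us \<subseteq> B" for us ws
    using that
  proof (induction ws arbitrary: us)
    case Nil
    then show ?case using assms(3) by simp
  next
    case (Cons w ws)
    have "linear (\<lambda>v. a (us @ v # ws))" using malt_linear[OF assms(1)] .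
    moreover have "a (us @ v # ws) = 0" if "v \<in> B" for v
      using Cons.IH[of "us @ [v]"] Cons.prems that by simp
    ultimately have "a (us @ w # ws) = 0" if "w \<in> span B"
      using linear_eq_0_on_span that by blast
    then show ?case using assms(2) by simp
  qed
  from this[of "[]" vs] show "length vs = n \<Longrightarrow> a vs = 0" by simp
qed

text \<open>The difference of the two forms vanishes on lists with a repetition, and every other
  list of basis vectors of this length is a permutation of \<open>fs\<close>.\<close>

lemma malt_top_eqI:
  assumes "malt a" "malt b" "distinct fs" "span (set fs) = UNIV" "a fs = b fs" "length vs = length fs"
  shows "a vs = b vs"
proof -
  have d: "malt (a - b)" using assms by (intro malt_intros)
  have "(a - b) us = 0" if us: "length us = length fs" "set us \<subseteq> set fs" for us
  proof (cases "distinct us")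
    case True
    then have "set us = set fs"
      using us assms(3) by (metis card_subset_eq distinct_card finite_set)
    then have "mset us = mset fs"
      using True assms(3) by (simp add: set_eq_iff_mset_eq_distinct)
    then show ?thesis using malt_perm[OF d] assms(5) by fastforce
  qed (use malt_not_distinct[OF d] in auto)
  then have "(a - b) vs = 0" using malt_eq_0_spanning[OF d assms(4)] assms(6) by blast
  then show ?thesis by simp
qed

section \<open>The Hodge star\<close>

definition pull :: "('v \<Rightarrow> 'w) \<Rightarrow> ('w list \<Rightarrow> complex) \<Rightarrow> 'v list \<Rightarrow> complex" where
  "pull E a vs = a (map E vs)"

lemma pull_simps [simp]:
  "pull E (a + b) = pull E a + pull E b" "pull E (a - b) = pull E a - pull E b"
  "pull E (- a) = - pull E a" "pull E 0 = 0" "pull E (smul c a) = smul c (pull E a)"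
  "pull E unit_form = unit_form"
  by (auto simp: fun_eq_iff pull_def smul_def unit_form_def)

lemma ins_pull: "ins v (pull E a) = pull E (ins (E v) a)"
  by (simp add: fun_eq_iff ins_def pull_def)

lemma pull_pull: "pull E (pull F a) = pull (F \<circ> E) a"
  by (simp add: fun_eq_iff pull_def)

lemma pull_wedge: "pull E (wedge a b) = wedge (pull E a) (pull E b)"
proof
  fix vs
  have "sgnf (pull E a) = pull E (sgnf a)" for a :: "'b list \<Rightarrow> complex"
    by (simp add: fun_eq_iff sgnf_def pull_def)
  then show "pull E (wedge a b) vs = wedge (pull E a) (pull E b) vs"
    by (induction vs arbitrary: a b) (simp_all add: wedge_Cons ins_pull, simp_all add: pull_def wedge_Cons)
qed

lemma malt_pull:
  assumes "linear E" "malt a"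
  shows "malt (pull E a)"
  using linear_compose[OF assms(1) malt_linear[OF assms(2)]] malt_adjacent[OF assms(2)]
  by (simp add: malt_def pull_def o_def)

section \<open>The pairing of forms along a frame, and its independence of the frame\<close>

primrec tsum :: "'v list \<Rightarrow> ('v list \<Rightarrow> complex) \<Rightarrow> ('v list \<Rightarrow> complex) \<Rightarrow> complex" where
  "tsum [] a b = a [] * b []"
| "tsum (e # es) a b = tsum es a b + tsum es (ins e a) (ins e b)"

text \<open>The degree \<open>k\<close> part of \<open>tsum\<close>; Euler's identity needs the
  degrees separated.\<close>

primrec ssum :: "'v list \<Rightarrow> nat \<Rightarrow> ('v list \<Rightarrow> complex) \<Rightarrow> ('v list \<Rightarrow> complex) \<Rightarrow> complex" where
  "ssum [] k a b = (if k = 0 then a [] * b [] else 0)"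
| "ssum (e # es) k a b =
     ssum es k a b + (case k of 0 \<Rightarrow> 0 | Suc j \<Rightarrow> ssum es j (ins e a) (ins e b))"

lemma tsum_eq_sum_Pow:
  "tsum es a b = (\<Sum>I\<in>Pow {..<length es}. a (nths es I) * b (nths es I))"
proof (induction es arbitrary: a b)
  case (Cons e es)
  have "{j. Suc j \<in> insert 0 (Suc ` I)} = I" "{j. Suc j \<in> Suc ` I} = I" for I by auto
  then show ?case
    unfolding tsum.simps length_Cons sum_Pow_lessThan_Suc Cons.IH
    by (simp add: nths_Cons ins_def add.commute)
qed simp

lemma tsum_pull: "tsum es (pull E a) (pull E b) = tsum (map E es) a b"
  by (induction es arbitrary: a b) (simp_all add: ins_pull, simp add: pull_def)

lemma ssum_eq_0: "length es < k \<Longrightarrow> ssum es k a b = 0"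
  by (induction es arbitrary: k a b) (auto split: nat.splits)

lemma tsum_eq_ssum: "tsum es a b = (\<Sum>k\<le>length es. ssum es k a b)"
proof (induction es arbitrary: a b)
  case (Cons e es)
  have "(\<Sum>k\<le>length (e # es). ssum (e # es) k a b)
      = (\<Sum>k\<le>Suc (length es). ssum es k a b)
        + (\<Sum>k\<le>Suc (length es). case k of 0 \<Rightarrow> 0 | Suc j \<Rightarrow> ssum es j (ins e a) (ins e b))"
    by (simp add: sum.distrib)
  also have "(\<Sum>k\<le>Suc (length es). ssum es k a b) = (\<Sum>k\<le>length es. ssum es k a b)"
    by (simp add: ssum_eq_0)
  also have "(\<Sum>k\<le>Suc (length es). case k of 0 \<Rightarrow> 0 | Suc j \<Rightarrow> ssum es j (ins e a) (ins e b))
      = (\<Sum>k\<le>length es. ssum es k (ins e a) (ins e b))"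
    by (subst sum.atMost_Suc_shift) simp
  finally show ?case by (simp add: Cons.IH)
qed simp

lemma ssum_uminus: "ssum es k (- a) (- b) = ssum es k a b"
  by (induction es arbitrary: k a b) (auto split: nat.splits)

lemma ssum_0: "ssum es 0 a b = a [] * b []"
  by (induction es arbitrary: a b) auto

lemma ssum_zero [simp]: "ssum es k 0 b = 0"
  by (induction es arbitrary: k b) (auto split: nat.splits)

lemma ssum_linear:
  "ssum es k (a + a') b = ssum es k a b + ssum es k a' b"
  "ssum es k a (b + b') = ssum es k a b + ssum es k a b'"
  "ssum es k (smul c a) b = c * ssum es k a b"
  "ssum es k a (smul c b) = c * ssum es k a b"
  by (induction es arbitrary: k a a' b b')
     (auto split: nat.splits simp: algebra_simps, auto simp: smul_def)

text \<open>Euler's identity for the degree \<open>k\<close>; it turns the sum over increasing index tuples into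
  iterated contractions, which visibly do not depend on the frame.\<close>

lemma ssum_Suc:
  assumes "malt a" "malt b"
  shows "of_nat (Suc k) * ssum es (Suc k) a b = (\<Sum>f\<leftarrow>es. ssum es k (ins f a) (ins f b))"
  using assms
proof (induction es arbitrary: a b k)
  case (Cons e es)
  note IH = Cons.IH[OF Cons.prems] and IH' = Cons.IH[OF malt_ins[OF Cons.prems(1)] malt_ins[OF Cons.prems(2)]]
  show ?case
  proof (cases k)
    case 0
    then show ?thesis using IH[of 0] by (simp add: ssum_0)
  next
    case (Suc j)
    \<comment> \<open>Both arguments change sign when their contractions are swapped, and the two
      signs cancel.\<close>
    have "ssum es j (ins e (ins f a)) (ins e (ins f b)) = ssum es j (ins f (ins e a)) (ins f (ins e b))" for f
      using Cons.prems by (metis ins_swap ssum_uminus)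
    then have "(\<Sum>f\<leftarrow>e # es. ssum (e # es) k (ins f a) (ins f b))
        = ssum es k (ins e a) (ins e b) + (\<Sum>f\<leftarrow>es. ssum es k (ins f a) (ins f b))
          + (\<Sum>f\<leftarrow>es. ssum es j (ins f (ins e a)) (ins f (ins e b)))"
      using Cons.prems by (simp add: Suc sum_list_addf ins_ins_same)
    also have "\<dots> = of_nat (Suc k) * ssum (e # es) (Suc k) a b"
      using IH[of k] IH'[of j e e] by (simp add: Suc algebra_simps)
    finally show ?thesis by simp
  qed
qed simp

definition onb :: "(real ^ 'n) list \<Rightarrow> bool" where
  "onb es \<longleftrightarrow> length es = CARD('n) \<and>
     (\<forall>i<CARD('n). \<forall>j<CARD('n). es ! i \<bullet> es ! j = (if i = j then 1 else 0))"

text \<open>The contraction is a trace: the matrix \<open>Q\<close> with the frame vectors as rows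
  is orthogonal from both sides, so the double sum over the axes collapses to its diagonal.\<close>

lemma onb_contraction:
  fixes B :: "real ^ 'n \<Rightarrow> real ^ 'n \<Rightarrow> complex"
  assumes "onb es" and lin: "\<And>u. linear (B u)" "\<And>v. linear (\<lambda>u. B u v)"
  shows "(\<Sum>e\<leftarrow>es. B e e) = (\<Sum>j\<in>UNIV. B (axis j 1) (axis j 1))"
proof -
  obtain g :: "'n \<Rightarrow> nat" where g: "bij_betw g UNIV {..<CARD('n)}"
    using ex_bij_betw_finite_nat[of "UNIV :: 'n set"] by (auto simp: atLeast0LessThan)
  define Q :: "real ^ 'n ^ 'n" where "Q = (\<chi> i. es ! g i)"
  have g_less: "g i < CARD('n)" for i using g by (auto simp: bij_betw_def)
  have g_inj: "g i = g j \<longleftrightarrow> i = j" for i j using g by (auto simp: bij_betw_def inj_eq)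
  have "(\<Sum>k\<in>UNIV. u $ k * v $ k) = u \<bullet> v" for u v :: "real ^ 'n"
    by (simp add: inner_vec_def)
  then have "Q ** transpose Q = mat 1"
    using assms(1) g_less
    by (simp add: vec_eq_iff matrix_matrix_mult_def transpose_def mat_def Q_def onb_def g_inj)
  then have "transpose Q ** Q = mat 1"
    by (simp add: matrix_left_right_inverse)
  then have Q: "(\<Sum>i\<in>UNIV. Q $ i $ j * Q $ i $ k) = (if j = k then 1 else 0)" for j k
    by (simp add: vec_eq_iff matrix_matrix_mult_def transpose_def mat_def)
  have expand: "B u v = (\<Sum>j\<in>UNIV. \<Sum>k\<in>UNIV. (u $ j * v $ k) *\<^sub>R B (axis j 1) (axis k 1))" for u v
  proof -
    have b: "x = (\<Sum>j\<in>UNIV. x $ j *\<^sub>R axis j 1)" for x :: "real ^ 'n"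
      using basis_expansion[of x] by (simp add: scalar_mult_eq_scaleR)
    have "B u v = (\<Sum>j\<in>UNIV. u $ j *\<^sub>R B (axis j 1) v)"
      by (subst b[of u]) (simp add: linear_sum[OF lin(2)] linear_scale[OF lin(2)])
    also have "\<dots> = (\<Sum>j\<in>UNIV. u $ j *\<^sub>R (\<Sum>k\<in>UNIV. v $ k *\<^sub>R B (axis j 1) (axis k 1)))"
      by (subst b[of v]) (simp add: linear_sum[OF lin(1)] linear_scale[OF lin(1)])
    finally show ?thesis by (simp add: scaleR_sum_right)
  qed
  have "(\<Sum>e\<leftarrow>es. B e e) = (\<Sum>i<CARD('n). B (es ! i) (es ! i))"
    using assms(1) by (simp add: onb_def sum_list_sum_nth atLeast0LessThan)
  also have "\<dots> = (\<Sum>i\<in>UNIV. B (Q $ i) (Q $ i))"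
    by (simp add: Q_def sum.reindex_bij_betw[OF g, of "\<lambda>i. B (es ! i) (es ! i)"])
  also have "\<dots> = (\<Sum>i\<in>UNIV. \<Sum>j\<in>UNIV. \<Sum>k\<in>UNIV. (Q $ i $ j * Q $ i $ k) *\<^sub>R B (axis j 1) (axis k 1))"
    by (subst expand) (rule refl)
  also have "\<dots> = (\<Sum>j\<in>UNIV. \<Sum>i\<in>UNIV. \<Sum>k\<in>UNIV. (Q $ i $ j * Q $ i $ k) *\<^sub>R B (axis j 1) (axis k 1))"
    by (rule sum.swap)
  also have "\<dots> = (\<Sum>j\<in>UNIV. \<Sum>k\<in>UNIV. (\<Sum>i\<in>UNIV. Q $ i $ j * Q $ i $ k) *\<^sub>R B (axis j 1) (axis k 1))"
    unfolding scaleR_sum_left by (rule sum.cong[OF refl], rule sum.swap)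
  also have "\<dots> = (\<Sum>j\<in>UNIV. B (axis j 1) (axis j 1))"
    by (simp add: Q if_distrib[of "\<lambda>r. r *\<^sub>R _"] cong: if_cong)
  finally show ?thesis .
qed

lemma ssum_onb:
  assumes "onb es" "onb fs" "malt a" "malt b"
  shows "ssum es k a b = ssum fs k a b"
  using assms(3,4)
proof (induction k arbitrary: a b)
  case (Suc k)
  let ?B = "\<lambda>u v. ssum fs k (ins u a) (ins v b)"
  have lin: "linear (?B u)" "linear (\<lambda>u. ?B u v)" for u v
    using Suc.prems by (auto simp: linear_iff ins_add_vec ins_scaleR ssum_linear)
       (simp_all add: scaleR_conv_of_real)
  have "of_nat (Suc k) * ssum es (Suc k) a b = (\<Sum>f\<leftarrow>es. ?B f f)"
    using Suc by (simp add: ssum_Suc malt_ins del: of_nat_Suc)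
  also have "\<dots> = (\<Sum>f\<leftarrow>fs. ?B f f)"
    using onb_contraction[OF assms(1) lin] onb_contraction[OF assms(2) lin] by simp
  also have "\<dots> = of_nat (Suc k) * ssum fs (Suc k) a b"
    using Suc.prems by (simp add: ssum_Suc del: of_nat_Suc)
  finally show ?case by (simp del: of_nat_Suc)
qed (simp add: ssum_0)

lemma tsum_onb:
  assumes "onb es" "onb fs" "malt a" "malt b"
  shows "tsum es a b = tsum fs a b"
  using assms(1,2) ssum_onb[OF assms] by (simp add: tsum_eq_ssum onb_def)

lemma onb_distinct: "onb es \<Longrightarrow> distinct es"
  unfolding distinct_conv_nth onb_def by (metis zero_neq_one)

lemma onb_inner:
  assumes "onb es" "u \<in> set es" "v \<in> set es"
  shows "u \<bullet> v = (if u = v then 1 else 0)"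
proof -
  obtain i j where ij: "i < length es" "u = es ! i" "j < length es" "v = es ! j"
    using assms by (metis in_set_conv_nth)
  then show ?thesis
    using assms(1) onb_distinct[OF assms(1)] by (simp add: onb_def nth_eq_iff_index_eq)
qed

lemma onb_span:
  fixes es :: "(real ^ 'n) list"
  assumes "onb es"
  shows "span (set es) = UNIV"
proof -
  have "pairwise orthogonal (set es)"
    using onb_inner[OF assms] by (auto simp: pairwise_def orthogonal_def)
  moreover have "0 \<notin> set es"
    using onb_inner[OF assms, of 0 0] by auto
  ultimately have "independent (set es)"
    by (rule pairwise_orthogonal_independent)
  moreover have "card (set es) = CARD('n)"
    using onb_distinct[OF assms] assms by (simp add: distinct_card onb_def)
  ultimately have "UNIV \<subseteq> span (set es)"
    by (intro card_ge_dim_independent) auto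
  then show ?thesis by auto
qed

section \<open>Nondegeneracy of the wedge pairing, and the star under a change of coframe\<close>

primrec dual_form :: "(real ^ 'n) list \<Rightarrow> (real ^ 'n) list \<Rightarrow> complex" where
  "dual_form [] = unit_form"
| "dual_form (w # ws) = wedge (one_form (\<lambda>u. complex_of_real (u \<bullet> w))) (dual_form ws)"

lemma linear_inner_of_real: "linear (\<lambda>u. complex_of_real (u \<bullet> w))"
  by (auto simp: linear_iff inner_add_left scaleR_conv_of_real)

lemma wedge_one_length:
  assumes "\<And>us. length us \<noteq> k \<Longrightarrow> a us = 0" "length vs \<noteq> Suc k"
  shows "wedge (one_form f) a vs = 0"
  using assms
proof (induction vs arbitrary: a k)
  case Nil
  then show ?case by (simp add: one_form_def)
next
  case (Cons v vs)
  have "wedge (one_form f) (ins v a) vs = 0"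
  proof (cases k)
    case 0
    then have "ins v a = 0" using Cons.prems(1) by (auto simp: ins_def fun_eq_iff)
    then show ?thesis by simp
  next
    case (Suc j)
    show ?thesis using Cons.prems Suc by (intro Cons.IH[of j]) (auto simp: ins_def)
  qed
  then show ?case using Cons.prems by (simp add: wedge_one_Cons)
qed

lemma dual_form_length: "length us \<noteq> length ws \<Longrightarrow> dual_form ws us = 0"
proof (induction ws arbitrary: us)
  case (Cons w ws)
  then show ?case by (auto intro: wedge_one_length[of "length ws"])
qed (simp add: unit_form_def)

lemma alt_dual_form: "alt_form (length ws) (dual_form ws)"
proof -
  have "malt (dual_form ws)"
    by (induction ws) (auto intro!: malt_intros linear_inner_of_real)
  then show ?thesis by (simp add: alt_form_iff_malt dual_form_length)
qed

text \<open>On an orthonormal list only the covector dual to \<open>w\<close> is nonzero on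
  \<open>w\<close>, so evaluating at \<open>ws\<close> strips the dual form factor by factor and
  leaves \<open>d\<close>.\<close>

lemma dual_form_wedge:
  assumes "\<And>u v. u \<in> set (ws @ us) \<Longrightarrow> v \<in> set (ws @ us) \<Longrightarrow> u \<bullet> v = (if u = v then 1 else 0)"
    and "distinct (ws @ us)"
  shows "wedge (dual_form ws) d (ws @ us) = d us"
  using assms
proof (induction ws)
  case (Cons w ws)
  let ?f = "\<lambda>u. complex_of_real (u \<bullet> w)"
  have "wedge (one_form ?f) (ins w (wedge (dual_form ws) d)) (ws @ us) = 0"
    by (rule wedge_one_vanish) (use Cons.prems in \<open>auto simp: inner_commute\<close>)
  moreover have "w \<bullet> w = 1" using Cons.prems(1)[of w w] by simp
  ultimately show ?case
    using Cons by (simp add: wedge_assoc wedge_one_Cons)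
qed simp

lemma wedge_nondegenerate:
  assumes "onb bs" "malt d" "\<And>k a. alt_form k a \<Longrightarrow> wedge a d bs = 0"
  shows "d = 0"
proof
  fix vs
  have "d us = 0" if us: "set us \<subseteq> set bs" for us
  proof (cases "distinct us")
    case True
    \<comment> \<open>The complementary basis vectors: wedging with their dual form isolates the
      value \<open>d us\<close>.\<close>
    define ws where "ws = filter (\<lambda>b. b \<notin> set us) bs"
    have dist: "distinct (ws @ us)" and set: "set (ws @ us) = set bs"
      using True us onb_distinct[OF assms(1)] by (auto simp: ws_def)
    then have "mset (ws @ us) = mset bs"
      using onb_distinct[OF assms(1)] set_eq_iff_mset_eq_distinct by blast
    then have "wedge (dual_form ws) d (ws @ us) = 0"
      using malt_perm[of "wedge (dual_form ws) d" "ws @ us" bs] assms(2,3) alt_dual_form[of ws]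
      by (auto simp: malt_wedge alt_form_iff_malt)
    moreover have "wedge (dual_form ws) d (ws @ us) = d us"
      using onb_inner[OF assms(1)] dist set by (intro dual_form_wedge) auto
    ultimately show ?thesis by simp
  qed (use malt_not_distinct[OF assms(2)] in auto)
  then show "d vs = 0 vs"
    using malt_eq_0_spanning[OF assms(2) onb_span[OF assms(1)]] by auto
qed

text \<open>Resolves the definite description in \<open>star_pt\<close> and the frame picked by
  \<open>SOME\<close> inside \<open>form_inner\<close>. The choice of frame is harmless by
  \<open>tsum_onb\<close>, since \<open>E\<close> maps it to an orthonormal basis. Existence holds
  because top-degree forms are determined by their value on \<open>bs\<close>; uniqueness is
  \<open>wedge_nondegenerate\<close>.\<close>

lemma star_pt_pull:
  fixes E :: "real ^ 'n \<Rightarrow> real ^ 'n"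
  assumes E: "linear E" "bij E" and bs: "onb bs"
    and malt: "malt b" "malt c" "malt vol" and vol: "vol bs = 1"
    and star: "\<And>a. wedge a c bs = tsum bs a b"
  shows "star_pt (\<lambda>u v. E u \<bullet> E v) (pull E vol) (pull E b) = pull E c"
proof -
  let ?h = "\<lambda>u v. E u \<bullet> E v"
  let ?F = "inv E"
  have F: "linear ?F" using E by (simp add: linear_linear bij_is_inj bij_is_surj
      linear_injective_left_inverse inj_linear_imp_inv_linear)
  have EF: "E (?F v) = v" "?F (E v) = v" for v
    using E(2) by (simp_all add: bij_is_surj bij_is_inj surj_f_inv_f)
  have pullEF: "pull E (pull ?F a) = a" "pull ?F (pull E a) = a" for a
    by (simp_all add: pull_pull o_def EF) (simp_all add: pull_def fun_eq_iff)
  define es where "es = orthonormal_frame ?h"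
  have "\<exists>es. length es = CARD('n) \<and>
      (\<forall>i<CARD('n). \<forall>j<CARD('n). ?h (es ! i) (es ! j) = (if i = j then 1 else 0))"
    using bs by (intro exI[of _ "map ?F bs"]) (simp add: onb_def EF)
  then have es: "length es = CARD('n)"
      "\<forall>i<CARD('n). \<forall>j<CARD('n). ?h (es ! i) (es ! j) = (if i = j then 1 else 0)"
    unfolding es_def orthonormal_frame_def by (rule someI2_ex, blast)+
  then have onb: "onb (map E es)" by (simp add: onb_def)
  have inner: "form_inner ?h (pull E a) (\<lambda>us. cnj (pull E b us)) = tsum bs a b" if "malt a" for a
  proof -
    have "form_inner ?h (pull E a) (\<lambda>us. cnj (pull E b us)) = tsum es (pull E a) (pull E b)"
      by (simp add: form_inner_def tsum_eq_sum_Pow es(1) flip: es_def)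
    then show ?thesis
      using tsum_onb[OF onb bs that malt(1)] by (simp add: tsum_pull)
  qed
  have len: "length bs = CARD('n)" using bs by (simp add: onb_def)
  show ?thesis
    unfolding star_pt_def
  proof (rule the_equality, intro conjI allI impI)
    show "mixed_form (pull E c)"
      by (simp add: mixed_form_iff_malt malt_pull E malt)
  next
    fix k and a :: "(real ^ 'n) list \<Rightarrow> complex" and vs :: "(real ^ 'n) list"
    assume "alt_form k a" and vs: "length vs = CARD('n)"
    then have a: "malt (pull ?F a)" by (simp add: alt_form_iff_malt malt_pull F)
    have "wedge (pull ?F a) c (map E vs) = smul (tsum bs (pull ?F a) b) vol (map E vs)"
    proof (rule malt_top_eqI[of _ _ bs])
      show "malt (wedge (pull ?F a) c)" "malt (smul (tsum bs (pull ?F a) b) vol)"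
        by (intro malt_intros a malt)+
      show "wedge (pull ?F a) c bs = smul (tsum bs (pull ?F a) b) vol bs"
        by (simp add: star smul_def vol)
    qed (use bs vs len in \<open>simp_all add: onb_distinct onb_span\<close>)
    then show "wedge a (pull E c) vs = form_inner ?h a (\<lambda>us. cnj (pull E b us)) * pull E vol vs"
      using inner[OF a] by (simp add: pullEF smul_def)
         (metis pullEF(1) pull_def pull_wedge)
  next
    fix c'
    assume c': "mixed_form c' \<and> (\<forall>k a. alt_form k a \<longrightarrow> (\<forall>vs. length vs = CARD('n) \<longrightarrow>
      wedge a c' vs = form_inner ?h a (\<lambda>us. cnj (pull E b us)) * pull E vol vs))"
    have "pull ?F c' - c = 0"
    proof (rule wedge_nondegenerate[OF bs])
      show "malt (pull ?F c' - c)"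
        using c' by (intro malt_intros malt_pull F malt) (simp add: mixed_form_iff_malt)
    next
      fix k and a :: "(real ^ 'n) list \<Rightarrow> complex" assume a: "alt_form k a"
      then have m: "malt a" by (simp add: alt_form_iff_malt)
      have "alt_form k (pull E a)"
        using a malt_pull[OF E(1), of a] by (simp add: alt_form_iff_malt pull_def)
      with c' have "wedge (pull E a) c' (map ?F bs)
          = form_inner ?h (pull E a) (\<lambda>us. cnj (pull E b us)) * pull E vol (map ?F bs)"
        by (simp add: len)
      moreover have "wedge (pull E a) c' (map ?F bs) = wedge a (pull ?F c') bs"
        by (metis pullEF(2) pull_def pull_wedge)
      moreover have "pull E vol (map ?F bs) = 1"
        by (simp add: pull_def vol o_def EF)
      ultimately show "wedge a (pull ?F c' - c) bs = 0"
        by (simp add: wedge_diff_right star inner[OF m])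
    qed
    then show "c' = pull E c" by (metis eq_iff_diff_eq_0 pullEF(1))
  qed
qed

section \<open>Bidegree and derivations\<close>

text \<open>Interior product with a complexified vector; it does for \<open>complex_ext\<close> what
  \<open>ins\<close> does for real arguments.\<close>

definition cins :: "'v \<times> 'v \<Rightarrow> ('v list \<Rightarrow> complex) \<Rightarrow> 'v list \<Rightarrow> complex" where
  "cins z a = ins (fst z) a + smul \<i> (ins (snd z) a)"

lemma complex_ext_Nil [simp]: "complex_ext a [] = a []"
  by (simp add: complex_ext_def)

lemma complex_ext_add: "complex_ext (a + b) zs = complex_ext a zs + complex_ext b zs"
  by (simp add: complex_ext_def algebra_simps sum.distrib)

lemma complex_ext_smul: "complex_ext (smul c a) zs = c * complex_ext a zs"
  by (simp add: complex_ext_def smul_def algebra_simps sum_distrib_left)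

lemma complex_ext_Cons: "complex_ext a (z # zs) = complex_ext (cins z a) zs"
proof -
  define n where "n = length zs"
  have upt: "[0..<Suc n] = 0 # map Suc [0..<n]" by (simp add: upt_conv_Cons map_Suc_upt del: upt_Suc)
  have card: "card (insert 0 (Suc ` I)) = Suc (card I)" "card (Suc ` I) = card I" if "I \<subseteq> {..<n}" for I
  proof -
    have "finite I" using that finite_subset by blast
    then show "card (insert 0 (Suc ` I)) = Suc (card I)" "card (Suc ` I) = card I"
      by (simp_all add: card_image)
  qed
  have mem: "0 \<notin> Suc ` I" "Suc j \<in> insert 0 (Suc ` I) \<longleftrightarrow> j \<in> I" "Suc j \<in> Suc ` I \<longleftrightarrow> j \<in> I"
    for I j by auto
  have "complex_ext a (z # zs)
      = \<i> * complex_ext (ins (snd z) a) zs + complex_ext (ins (fst z) a) zs"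
    unfolding complex_ext_def length_Cons sum_Pow_lessThan_Suc n_def[symmetric] upt sum_distrib_left
    by (intro arg_cong2[where f = "(+)"] sum.cong refl)
       (simp_all add: card mem o_def ins_def cong: if_cong)
  then show ?thesis
    by (simp add: cins_def complex_ext_add complex_ext_smul)
qed

definition bid ::
    "('v::real_vector \<Rightarrow> 'v) \<Rightarrow> nat \<Rightarrow> nat \<Rightarrow> ('v list \<Rightarrow> complex) \<Rightarrow> 'v list \<Rightarrow> complex" where
  "bid J p q a vs =
     (if length vs = p + q then
        \<Sum>S\<in>{S. S \<subseteq> {..<p + q} \<and> card S = p}.
          complex_ext a
            (map (\<lambda>j. if j \<in> S then part10 J (vs ! j) else part01 J (vs ! j)) [0..<p + q])
      else 0)"

lemma bideg_eq_bid: "bideg M p q \<alpha> x = (if x \<in> topspace (pts M) then bid (acs M x) p q (\<alpha> x) else 0)"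
  by (auto simp: fun_eq_iff bideg_def bid_def)

lemma bid_Nil: "bid J p q a [] = (if p = 0 \<and> q = 0 then a [] else 0)"
proof -
  have "{S::nat set. S = {} \<and> card S = 0} = {{}}" by auto
  then show ?thesis by (auto simp: bid_def)
qed

text \<open>The head of the list either belongs to the set of (1,0) slots or to its complement. This
  recursion replaces the sum over slot sets in all later arguments.\<close>

lemma bid_Cons:
  "bid J p q a (v # vs) =
     (case p of 0 \<Rightarrow> 0 | Suc p' \<Rightarrow> bid J p' q (cins (part10 J v) a) vs)
   + (case q of 0 \<Rightarrow> 0 | Suc q' \<Rightarrow> bid J p q' (cins (part01 J v) a) vs)"
proof (cases "Suc (length vs) = p + q")
  case False
  then show ?thesis by (auto simp: bid_def split: nat.splits)
next
  case True
  define n where "n = length vs"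
  define f where "f S = map (\<lambda>j. if j \<in> S then part10 J (vs ! j) else part01 J (vs ! j)) [0..<n]" for S
  define g where "g S = map (\<lambda>j. if j \<in> S then part10 J ((v # vs) ! j) else part01 J ((v # vs) ! j)) [0..<Suc n]" for S
  have upt: "[0..<Suc n] = 0 # map Suc [0..<n]" by (simp add: upt_conv_Cons map_Suc_upt del: upt_Suc)
  have mem: "0 \<notin> Suc ` I" "Suc j \<in> insert 0 (Suc ` I) \<longleftrightarrow> j \<in> I" "Suc j \<in> Suc ` I \<longleftrightarrow> j \<in> I"
    for I j by auto
  have g: "g (insert 0 (Suc ` I)) = part10 J v # f I" "g (Suc ` I) = part01 J v # f I" for I
    by (simp_all add: g_def f_def upt mem o_def del: upt_Suc)
  have fin: "finite I" if "I \<subseteq> {..<n}" for I using that finite_subset by blast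
  have sets: "{S. S \<subseteq> {..<m} \<and> card S = k} = {S \<in> Pow {..<m}. card S = k}" for m k :: nat by auto
  \<comment> \<open>With the cardinality condition as an indicator the sum runs over a full power
    set, to which \<open>sum_Pow_lessThan_Suc\<close> applies.\<close>
  have sum_bid: "bid J r s c vs = (\<Sum>I\<in>Pow {..<n}. if card I = r then complex_ext c (f I) else 0)"
    if "r + s = n" for r s c
    by (simp only: bid_def f_def sets that n_def[symmetric] simp_thms if_True sum.inter_filter
        finite_Pow_iff finite_lessThan)
  have "bid J p q a (v # vs) = (\<Sum>S\<in>Pow {..<Suc n}. if card S = p then complex_ext a (g S) else 0)"
    using True by (simp only: bid_def g_def sets n_def[symmetric] length_Cons True[symmetric] if_True
        sum.inter_filter finite_Pow_iff finite_lessThan)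
  also have "\<dots> = (\<Sum>I\<in>Pow {..<n}. if Suc (card I) = p then complex_ext (cins (part10 J v) a) (f I) else 0)
      + (\<Sum>I\<in>Pow {..<n}. if card I = p then complex_ext (cins (part01 J v) a) (f I) else 0)"
    unfolding sum_Pow_lessThan_Suc g complex_ext_Cons
    by (intro arg_cong2[where f = "(+)"] sum.cong refl) (auto simp: card_image fin)
  also have "(\<Sum>I\<in>Pow {..<n}. if Suc (card I) = p then complex_ext (cins (part10 J v) a) (f I) else 0)
      = (case p of 0 \<Rightarrow> 0 | Suc p' \<Rightarrow> bid J p' q (cins (part10 J v) a) vs)"
    using True by (auto simp: sum_bid n_def split: nat.splits)
  also have "(\<Sum>I\<in>Pow {..<n}. if card I = p then complex_ext (cins (part01 J v) a) (f I) else 0)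
      = (case q of 0 \<Rightarrow> 0 | Suc q' \<Rightarrow> bid J p q' (cins (part01 J v) a) vs)"
  proof (cases q)
    case 0
    \<comment> \<open>For \<open>q = 0\<close> every slot is of type (1,0), so
      \<open>p = Suc n\<close> exceeds the size of any subset of the remaining \<open>n\<close>
      slots.\<close>
    have "card I \<noteq> p" if "I \<subseteq> {..<n}" for I
      using card_mono[OF _ that] True 0 by (simp add: n_def)
    then show ?thesis using 0 by (simp add: sum.neutral)
  qed (use True in \<open>simp add: sum_bid n_def\<close>)
  finally show ?thesis .
qed

lemma cins_linear:
  "cins z (a + b) = cins z a + cins z b" "cins z (a - b) = cins z a - cins z b"
  "cins z (smul c a) = smul c (cins z a)" "cins z 0 = 0" "cins z (- a) = - cins z a"
  by (auto simp: cins_def fun_eq_iff smul_def algebra_simps)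

lemma bid_add: "bid J p q (a + b) = bid J p q a + bid J p q b"
  by (rule ext) (simp add: bid_def complex_ext_add sum.distrib)

lemma bid_smul: "bid J p q (smul c a) = smul c (bid J p q a)"
  by (rule ext) (simp add: smul_def[of c "bid J p q a"] bid_def complex_ext_smul sum_distrib_left)

lemma bid_uminus: "bid J p q (- a) = - bid J p q a"
  using bid_smul[of J p q "- 1" a] by (simp add: smul_distrib(5)[symmetric])

lemma bid_diff: "bid J p q (a - b) = bid J p q a - bid J p q b"
  using bid_add[of J p q a "- b"] by (simp add: bid_uminus)

lemma bid_zero [simp]: "bid J p q 0 = 0"
  using bid_smul[of J p q 0 0] by simp

lemmas bid_linear = bid_add bid_diff bid_uminus bid_smul

lemma bid_unit: "bid J p q unit_form = (if p = 0 \<and> q = 0 then unit_form else 0)"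
proof
  fix vs :: "'a list"
  have "cins z unit_form = 0" for z :: "'a \<times> 'a" by (simp add: cins_def)
  then show "bid J p q unit_form vs = (if p = 0 \<and> q = 0 then unit_form else 0) vs"
    by (cases vs) (auto simp: bid_Nil bid_Cons unit_form_def split: nat.splits)
qed

lemma cins_one_wedge:
  "cins z (wedge (one_form f) a)
    = smul (f (fst z) + \<i> * f (snd z)) a - wedge (one_form f) (cins z a)"
  by (simp add: cins_def ins_one_wedge wedge_linear fun_eq_iff smul_def algebra_simps)

lemma bid_pull:
  assumes "linear E" "\<And>v. E (J v) = J' (E v)"
  shows "bid J p q (pull E a) = pull E (bid J' p q a)"
proof
  fix vs
  have "cins (part10 J v) (pull E a) = pull E (cins (part10 J' (E v)) a)"
    "cins (part01 J v) (pull E a) = pull E (cins (part01 J' (E v)) a)" for v a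
    using assms by (simp_all add: cins_def part10_def part01_def ins_pull linear_scale linear_neg)
  then show "bid J p q (pull E a) vs = pull E (bid J' p q a) vs"
    by (induction vs arbitrary: p q a)
       (simp_all add: bid_Nil bid_Cons pull_def split: nat.splits)
qed

definition type10 :: "('v::real_vector \<Rightarrow> 'v) \<Rightarrow> ('v \<Rightarrow> complex) \<Rightarrow> bool" where
  "type10 J f \<longleftrightarrow> linear f \<and> (\<forall>v. f (J v) = \<i> * f v)"

definition type01 :: "('v::real_vector \<Rightarrow> 'v) \<Rightarrow> ('v \<Rightarrow> complex) \<Rightarrow> bool" where
  "type01 J f \<longleftrightarrow> linear f \<and> (\<forall>v. f (J v) = - \<i> * f v)"

text \<open>A covector with \<open>f (J v) = i f v\<close> takes the value \<open>f v\<close> on the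
  (1,0) part of \<open>v\<close> and vanishes on the (0,1) part.\<close>

lemma cins_type10:
  assumes "type10 J f"
  shows "cins (part10 J v) (wedge (one_form f) a)
      = smul (f v) a - wedge (one_form f) (cins (part10 J v) a)"
    "cins (part01 J v) (wedge (one_form f) a) = - wedge (one_form f) (cins (part01 J v) a)"
  using assms unfolding type10_def
  by (auto simp: cins_one_wedge part10_def part01_def linear_scale linear_neg scaleR_conv_of_real field_simps)

lemma cins_type01:
  assumes "type01 J f"
  shows "cins (part01 J v) (wedge (one_form f) a)
      = smul (f v) a - wedge (one_form f) (cins (part01 J v) a)"
    "cins (part10 J v) (wedge (one_form f) a) = - wedge (one_form f) (cins (part10 J v) a)"
  using assms unfolding type01_def
  by (auto simp: cins_one_wedge part10_def part01_def linear_scale linear_neg scaleR_conv_of_real field_simps)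

lemma bid_type10:
  assumes f: "type10 J f"
  shows "bid J (Suc p) q (wedge (one_form f) a) = wedge (one_form f) (bid J p q a)"
    and "bid J 0 q (wedge (one_form f) a) = 0"
proof -
  \<comment> \<open>The two claims are proved jointly because for \<open>p = 0\<close> the induction
    step of the first one uses the second.\<close>
  have "bid J (Suc p) q (wedge (one_form f) a) vs = wedge (one_form f) (bid J p q a) vs
      \<and> bid J 0 q (wedge (one_form f) a) vs = 0" for vs
  proof (induction vs arbitrary: p q a)
    case Nil
    then show ?case by (simp add: bid_Nil one_form_def)
  next
    case (Cons v vs)
    have ins: "ins v (bid J p q a) = (case p of 0 \<Rightarrow> 0 | Suc p' \<Rightarrow> bid J p' q (cins (part10 J v) a))
        + (case q of 0 \<Rightarrow> 0 | Suc q' \<Rightarrow> bid J p q' (cins (part01 J v) a))"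
      by (auto simp: fun_eq_iff ins_def bid_Cons split: nat.splits)
    show ?case
      by (auto simp: bid_Cons wedge_one_Cons ins wedge_linear cins_type10[OF f] bid_linear Cons.IH
          smul_def split: nat.splits)
  qed
  then show "bid J (Suc p) q (wedge (one_form f) a) = wedge (one_form f) (bid J p q a)"
    "bid J 0 q (wedge (one_form f) a) = 0" by auto
qed

lemma bid_type01:
  assumes f: "type01 J f"
  shows "bid J p (Suc q) (wedge (one_form f) a) = wedge (one_form f) (bid J p q a)"
    and "bid J p 0 (wedge (one_form f) a) = 0"
proof -
  have "bid J p (Suc q) (wedge (one_form f) a) vs = wedge (one_form f) (bid J p q a) vs
      \<and> bid J p 0 (wedge (one_form f) a) vs = 0" for vs
  proof (induction vs arbitrary: p q a)
    case Nil
    then show ?case by (simp add: bid_Nil one_form_def)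
  next
    case (Cons v vs)
    have ins: "ins v (bid J p q a) = (case p of 0 \<Rightarrow> 0 | Suc p' \<Rightarrow> bid J p' q (cins (part10 J v) a))
        + (case q of 0 \<Rightarrow> 0 | Suc q' \<Rightarrow> bid J p q' (cins (part01 J v) a))"
      by (auto simp: fun_eq_iff ins_def bid_Cons split: nat.splits)
    show ?case
      by (auto simp: bid_Cons wedge_one_Cons ins wedge_linear cins_type01[OF f] bid_linear Cons.IH
          smul_def split: nat.splits)
  qed
  then show "bid J p (Suc q) (wedge (one_form f) a) = wedge (one_form f) (bid J p q a)"
    "bid J p 0 (wedge (one_form f) a) = 0" by auto
qed

text \<open>Expressed through all projections, so that the double sums in \<open>del\<close> and
  \<open>delbar\<close> collapse to a single term.\<close>

definition pure_type ::
    "('v::real_vector \<Rightarrow> 'v) \<Rightarrow> nat \<Rightarrow> nat \<Rightarrow> ('v list \<Rightarrow> complex) \<Rightarrow> bool" where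
  "pure_type J p q a \<longleftrightarrow> (\<forall>r s. bid J r s a = (if r = p \<and> s = q then a else 0))"

lemma pure_type_unit: "pure_type J 0 0 unit_form"
  by (simp add: pure_type_def bid_unit)

lemma pure_type_zero: "pure_type J p q 0"
  by (simp add: pure_type_def)

lemma pure_type_add: "pure_type J p q a \<Longrightarrow> pure_type J p q b \<Longrightarrow> pure_type J p q (a + b)"
  by (simp add: pure_type_def bid_linear)

lemma pure_type_smul: "pure_type J p q a \<Longrightarrow> pure_type J p q (smul c a)"
  by (simp add: pure_type_def bid_linear)

lemma pure_type_wedge10:
  assumes "type10 J f" "pure_type J p q a"
  shows "pure_type J (Suc p) q (wedge (one_form f) a)"
  unfolding pure_type_def
proof (intro allI)
  fix r s show "bid J r s (wedge (one_form f) a) = (if r = Suc p \<and> s = q then wedge (one_form f) a else 0)"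
    using assms(2) by (cases r) (auto simp: bid_type10[OF assms(1)] pure_type_def)
qed

lemma pure_type_wedge01:
  assumes "type01 J f" "pure_type J p q a"
  shows "pure_type J p (Suc q) (wedge (one_form f) a)"
  unfolding pure_type_def
proof (intro allI)
  fix r s show "bid J r s (wedge (one_form f) a) = (if r = p \<and> s = Suc q then wedge (one_form f) a else 0)"
    using assms(2) by (cases s) (auto simp: bid_type01[OF assms(1)] pure_type_def)
qed

section \<open>The derivation of forms induced by an endomorphism\<close>

primrec derivation :: "('v \<Rightarrow> 'v) \<Rightarrow> 'v list \<Rightarrow> ('v list \<Rightarrow> complex) \<Rightarrow> complex" where
  "derivation A [] a = 0"
| "derivation A (v # vs) a = a (A v # vs) + derivation A vs (ins v a)"

text \<open>The derivative at \<open>t = 0\<close> of the pull-back along \<open>exp (t A)\<close>,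
  for multilinear \<open>a\<close> and linear \<open>A\<close>.\<close>

definition deriv_form :: "('v \<Rightarrow> 'v) \<Rightarrow> ('v list \<Rightarrow> complex) \<Rightarrow> 'v list \<Rightarrow> complex" where
  "deriv_form A a vs = derivation A vs a"

lemma deriv_form_Nil [simp]: "deriv_form A a [] = 0"
  and deriv_form_Cons: "deriv_form A a (v # vs) = ins (A v) a vs + deriv_form A (ins v a) vs"
  and ins_deriv_form: "ins v (deriv_form A a) = ins (A v) a + deriv_form A (ins v a)"
  by (simp_all add: deriv_form_def ins_def fun_eq_iff)

lemma deriv_form_linear:
  "deriv_form A (a + b) = deriv_form A a + deriv_form A b"
  "deriv_form A (smul c a) = smul c (deriv_form A a)"
proof -
  have "deriv_form A (a + b) vs = (deriv_form A a + deriv_form A b) vs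
    \<and> deriv_form A (smul c a) vs = smul c (deriv_form A a) vs" for vs
    by (induction vs arbitrary: a b)
       (simp_all add: deriv_form_Cons smul_def[of c], simp_all add: smul_def algebra_simps)
  then show "deriv_form A (a + b) = deriv_form A a + deriv_form A b"
    "deriv_form A (smul c a) = smul c (deriv_form A a)" by auto
qed

lemma deriv_form_unit [simp]: "deriv_form A unit_form = 0"
  and deriv_form_zero [simp]: "deriv_form A 0 = 0"
proof -
  show z: "deriv_form A 0 = 0" using deriv_form_linear(2)[of A 0 0] by simp
  show "deriv_form A unit_form = 0"
    by (rule form_eqI) (simp_all add: ins_deriv_form z)
qed

lemma deriv_form_one: "deriv_form A (one_form f) = one_form (f \<circ> A)"
proof (rule form_eqI)
  fix v
  have "deriv_form A (smul (f v) unit_form) = 0" by (simp add: deriv_form_linear)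
  then show "ins v (deriv_form A (one_form f)) = ins v (one_form (f \<circ> A))"
    by (simp add: ins_deriv_form)
qed (simp add: one_form_def)

lemma deriv_form_wedge:
  "deriv_form A (wedge a b) = wedge (deriv_form A a) b + wedge a (deriv_form A b)"
proof
  fix vs
  have sgn: "deriv_form A (sgnf a) = sgnf (deriv_form A a)" for a
  proof
    fix vs show "deriv_form A (sgnf a) vs = sgnf (deriv_form A a) vs"
    proof (induction vs arbitrary: a)
      case (Cons v vs)
      have "deriv_form A (sgnf (- ins v a)) vs = sgnf (deriv_form A (- ins v a)) vs"
        by (rule Cons)
      moreover have "deriv_form A (- ins v a) = - deriv_form A (ins v a)"
        using deriv_form_linear(2)[of A "- 1" "ins v a"] by (simp add: smul_distrib(5)[symmetric])
      moreover have "sgnf (deriv_form A a) (v # vs) = - sgnf (ins v (deriv_form A a)) vs"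
        by (simp add: sgnf_def ins_def)
      moreover have "ins (A v) (sgnf a) vs = - sgnf (ins (A v) a) vs" by simp
      ultimately show ?case by (simp add: deriv_form_Cons ins_deriv_form)
    qed (simp add: sgnf_def)
  qed
  show "deriv_form A (wedge a b) vs = (wedge (deriv_form A a) b + wedge a (deriv_form A b)) vs"
    by (induction vs arbitrary: a b)
       (simp_all add: deriv_form_Cons wedge_Cons ins_wedge ins_deriv_form wedge_linear deriv_form_linear sgn)
qed

lemma malt_deriv_form:
  assumes "linear A" "malt a"
  shows "malt (deriv_form A a)"
proof -
  have "linear (\<lambda>v. deriv_form A a (us @ v # ws))" for us ws
    using assms(2)
  proof (induction us arbitrary: a)
    case Nil
    have "deriv_form A (ins (x + y) a) ws = deriv_form A (ins x a) ws + deriv_form A (ins y a) ws"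
      "deriv_form A (ins (c *\<^sub>R x) a) ws = c *\<^sub>R deriv_form A (ins x a) ws" for x y c
      using Nil by (simp_all add: ins_add_vec ins_scaleR deriv_form_linear)
                   (simp add: smul_def scaleR_conv_of_real)
    then show ?case using assms(1) Nil
      by (simp add: linear_iff deriv_form_Cons ins_add_vec ins_scaleR)
         (simp add: smul_def scaleR_conv_of_real algebra_simps)
  next
    case (Cons u us)
    have "linear (\<lambda>v. ins (A u) a (us @ v # ws))" using malt_linear[OF malt_ins] Cons.prems by blast
    then show ?case using Cons by (simp add: deriv_form_Cons linear_compose_add malt_ins)
  qed
  moreover have "deriv_form A a (us @ v # v # ws) = 0" for us v ws
    using assms(2)
  proof (induction us arbitrary: a)
    case Nil
    then show ?case
      using ins_swap[of a v "A v"] by (simp add: deriv_form_Cons ins_ins_same) (simp add: ins_def fun_eq_iff)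
  next
    case (Cons u us)
    then show ?case using malt_adjacent[OF malt_ins, of a "A u"] by (simp add: deriv_form_Cons malt_ins)
  qed
  ultimately show ?thesis by (simp add: malt_def)
qed

section \<open>The model on real 6-space\<close>

lemma exhaust_6:
  fixes x :: 6
  shows "x = 1 \<or> x = 2 \<or> x = 3 \<or> x = 4 \<or> x = 5 \<or> x = 6"
proof (induct x)
  case (of_int z)
  then have "0 \<le> z" and "z < 6" by simp_all
  then have "z = 0 \<or> z = 1 \<or> z = 2 \<or> z = 3 \<or> z = 4 \<or> z = 5" by arith
  then show ?case by auto
qed

lemma forall_6: "(\<forall>i::6. P i) \<longleftrightarrow> P 1 \<and> P 2 \<and> P 3 \<and> P 4 \<and> P 5 \<and> P 6"
  by (metis exhaust_6)

lemma UNIV_6: "(UNIV :: 6 set) = {1, 2, 3, 4, 5, 6}"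
  unfolding set_eq_iff forall_6 by (simp only: UNIV_I insert_iff simp_thms)

lemma sum_6: "sum f (UNIV :: 6 set) = f 1 + f 2 + f 3 + f 4 + f 5 + f 6"
  unfolding UNIV_6 by (simp add: ac_simps)

definition vec6 :: "real \<Rightarrow> real \<Rightarrow> real \<Rightarrow> real \<Rightarrow> real \<Rightarrow> real \<Rightarrow> real ^ 6" where
  "vec6 a b c d e f = (\<chi> i. if i = 1 then a else if i = 2 then b else if i = 3 then c
     else if i = 4 then d else if i = 5 then e else f)"

lemma vec6_nth [simp]:
  "vec6 a b c d e f $ 1 = a" "vec6 a b c d e f $ 2 = b" "vec6 a b c d e f $ 3 = c"
  "vec6 a b c d e f $ 4 = d" "vec6 a b c d e f $ 5 = e" "vec6 a b c d e f $ 6 = f"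
  by (simp_all add: vec6_def)

lemma vec6_eq_iff: "(u :: real ^ 6) = v \<longleftrightarrow> u $ 1 = v $ 1 \<and> u $ 2 = v $ 2 \<and> u $ 3 = v $ 3
    \<and> u $ 4 = v $ 4 \<and> u $ 5 = v $ 5 \<and> u $ 6 = v $ 6"
  by (simp add: vec_eq_iff forall_6)

lemma inner_6: "(u :: real ^ 6) \<bullet> v = u $ 1 * v $ 1 + u $ 2 * v $ 2 + u $ 3 * v $ 3
    + u $ 4 * v $ 4 + u $ 5 * v $ 5 + u $ 6 * v $ 6"
  by (simp add: inner_vec_def sum_6)

definition J0 :: "real ^ 6 \<Rightarrow> real ^ 6" where
  "J0 v = vec6 (- v $ 2) (v $ 1) (- v $ 4) (v $ 3) (- v $ 6) (v $ 5)"

text \<open>The structure equations \<open>de\<^sub>3 = - e\<^sub>2 \<and> e\<^sub>4\<close>, \<open>de\<^sub>4 = 9 e\<^sub>2 \<and> e\<^sub>3\<close>, \<open>de\<^sub>5 = - 5 e\<^sub>2 \<and> e\<^sub>6\<close>,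
  \<open>de\<^sub>6 = 5 e\<^sub>2 \<and> e\<^sub>5\<close> of the coframe.\<close>

definition rot :: "real ^ 6 \<Rightarrow> real ^ 6" where
  "rot v = vec6 0 0 (- v $ 4) (9 * v $ 3) (- 5 * v $ 6) (5 * v $ 5)"

lemma linear_J0: "linear J0" and linear_rot: "linear rot"
  by (simp_all add: linear_iff J0_def rot_def vec6_eq_iff)

lemma J0_J0: "J0 (J0 v) = - v"
  by (simp add: J0_def vec6_eq_iff)

lemma J0_isometry: "J0 u \<bullet> J0 v = u \<bullet> v"
  by (simp add: J0_def inner_6)

definition cz :: "6 \<Rightarrow> 6 \<Rightarrow> real ^ 6 \<Rightarrow> complex" where "cz i j v = Complex (v $ i) (v $ j)"
definition cw :: "6 \<Rightarrow> 6 \<Rightarrow> real ^ 6 \<Rightarrow> complex" where "cw i j v = Complex (v $ i) (- v $ j)"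

lemma linear_cz: "linear (cz i j)" and linear_cw: "linear (cw i j)"
  by (simp_all add: linear_iff cz_def cw_def complex_eq_iff)

lemma type10_cz: "type10 J0 (cz 1 2)" "type10 J0 (cz 3 4)" "type10 J0 (cz 5 6)"
  by (simp_all add: type10_def linear_cz) (simp_all add: cz_def J0_def complex_eq_iff)

lemma type01_cw: "type01 J0 (cw 1 2)" "type01 J0 (cw 3 4)" "type01 J0 (cw 5 6)"
  by (simp_all add: type01_def linear_cw) (simp_all add: cw_def J0_def complex_eq_iff)

type_synonym cform = "(real ^ 6) list \<Rightarrow> complex"

definition z1 :: cform where "z1 = one_form (cz 1 2)"
definition z2 :: cform where "z2 = one_form (cz 3 4)"
definition z3 :: cform where "z3 = one_form (cz 5 6)"
definition w1 :: cform where "w1 = one_form (cw 1 2)"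
definition w2 :: cform where "w2 = one_form (cw 3 4)"
definition w3 :: cform where "w3 = one_form (cw 5 6)"

lemmas zw_def = z1_def z2_def z3_def w1_def w2_def w3_def

lemma malt_zw: "malt z1" "malt z2" "malt z3" "malt w1" "malt w2" "malt w3"
  by (simp_all add: zw_def malt_one_form linear_cz linear_cw)

text \<open>Rewrite rules that sort a product into the order \<open>z1, w1, z2, w2, z3, w3\<close>.
  The trailing \<open>a\<close> lets them act inside right-nested products, which is why the
  products below end in \<open>unit_form\<close>.\<close>

lemma zw_order:
  "wedge w1 (wedge z1 a) = - wedge z1 (wedge w1 a)"
  "wedge z2 (wedge z1 a) = - wedge z1 (wedge z2 a)" "wedge z2 (wedge w1 a) = - wedge w1 (wedge z2 a)"
  "wedge w2 (wedge z1 a) = - wedge z1 (wedge w2 a)" "wedge w2 (wedge w1 a) = - wedge w1 (wedge w2 a)"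
  "wedge w2 (wedge z2 a) = - wedge z2 (wedge w2 a)"
  "wedge z3 (wedge z1 a) = - wedge z1 (wedge z3 a)" "wedge z3 (wedge w1 a) = - wedge w1 (wedge z3 a)"
  "wedge z3 (wedge z2 a) = - wedge z2 (wedge z3 a)" "wedge z3 (wedge w2 a) = - wedge w2 (wedge z3 a)"
  "wedge w3 (wedge z1 a) = - wedge z1 (wedge w3 a)" "wedge w3 (wedge w1 a) = - wedge w1 (wedge w3 a)"
  "wedge w3 (wedge z2 a) = - wedge z2 (wedge w3 a)" "wedge w3 (wedge w2 a) = - wedge w2 (wedge w3 a)"
  "wedge w3 (wedge z3 a) = - wedge z3 (wedge w3 a)"
  unfolding zw_def by (rule one_wedge_anticommute)+

lemma zw_square:
  "wedge z1 (wedge z1 a) = 0" "wedge z2 (wedge z2 a) = 0" "wedge z3 (wedge z3 a) = 0"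
  "wedge w1 (wedge w1 a) = 0" "wedge w2 (wedge w2 a) = 0" "wedge w3 (wedge w3 a) = 0"
  unfolding zw_def by (rule one_wedge_same)+

lemma bid_z:
  "bid J0 (Suc p) q (wedge z1 a) = wedge z1 (bid J0 p q a)" "bid J0 0 q (wedge z1 a) = 0"
  "bid J0 (Suc p) q (wedge z2 a) = wedge z2 (bid J0 p q a)" "bid J0 0 q (wedge z2 a) = 0"
  "bid J0 (Suc p) q (wedge z3 a) = wedge z3 (bid J0 p q a)" "bid J0 0 q (wedge z3 a) = 0"
  unfolding zw_def by (rule bid_type10 type10_cz)+

lemma bid_w:
  "bid J0 p (Suc q) (wedge w1 a) = wedge w1 (bid J0 p q a)" "bid J0 p 0 (wedge w1 a) = 0"
  "bid J0 p (Suc q) (wedge w2 a) = wedge w2 (bid J0 p q a)" "bid J0 p 0 (wedge w2 a) = 0"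
  "bid J0 p (Suc q) (wedge w3 a) = wedge w3 (bid J0 p q a)" "bid J0 p 0 (wedge w3 a) = 0"
  unfolding zw_def by (rule bid_type01 type01_cw)+

lemma pure_type_z:
  assumes "pure_type J0 p q a"
  shows "pure_type J0 (Suc p) q (wedge z1 a)" "pure_type J0 (Suc p) q (wedge z2 a)"
    "pure_type J0 (Suc p) q (wedge z3 a)" "pure_type J0 p (Suc q) (wedge w1 a)"
    "pure_type J0 p (Suc q) (wedge w2 a)" "pure_type J0 p (Suc q) (wedge w3 a)"
  unfolding zw_def
  by (rule pure_type_wedge10 pure_type_wedge01 type10_cz type01_cw assms)+

text \<open>The exterior derivative of a form with constant coefficients in a coframe that depends on
  \<open>x\<^sub>2\<close> alone, through \<open>rot\<close>.\<close>

definition d0 :: "cform \<Rightarrow> cform" where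
  "d0 a = wedge (one_form (\<lambda>v. complex_of_real (v $ 2))) (deriv_form rot a)"

text \<open>Writing \<open>dx_2\<close> as \<open>(z1 - w1) / (2i)\<close> exhibits the bidegrees,
  since \<open>z1\<close> and \<open>w1\<close> have pure types.\<close>

lemma d0_eq: "d0 a = smul (- \<i> / 2) (wedge z1 (deriv_form rot a) - wedge w1 (deriv_form rot a))"
proof -
  have "one_form (\<lambda>v. complex_of_real (v $ 2)) = smul (- \<i> / 2) (z1 - w1)"
    by (auto simp: fun_eq_iff smul_def z1_def w1_def one_form_def cz_def cw_def complex_eq_iff
        split: list.splits)
  then show ?thesis by (simp add: d0_def wedge_linear)
qed

lemma deriv_zw:
  "deriv_form rot z1 = 0" "deriv_form rot w1 = 0"
  "deriv_form rot z2 = smul (5 * \<i>) z2 + smul (4 * \<i>) w2"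
  "deriv_form rot w2 = smul (- 5 * \<i>) w2 + smul (- 4 * \<i>) z2"
  "deriv_form rot z3 = smul (5 * \<i>) z3" "deriv_form rot w3 = smul (- 5 * \<i>) w3"
  unfolding zw_def deriv_form_one
  by (auto simp: fun_eq_iff smul_def one_form_def cz_def cw_def rot_def complex_eq_iff split: list.splits)

lemmas form_calc = d0_eq deriv_form_wedge deriv_form_linear deriv_form_unit deriv_zw wedge_linear
  wedge_smul_left wedge_smul_right wedge_uminus_left wedge_uminus_right wedge_zero
  zw_order zw_square bid_z bid_w bid_linear bid_zero bid_unit smul_distrib(1,2) smul_simps
  numeral_2_eq_2 numeral_3_eq_3 One_nat_def add_0_left add_0_right diff_0 diff_0_right minus_zero
  minus_minus wedge_assoc nat.distinct simp_thms if_True if_False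

text \<open>Up to a scalar, \<open>\<beta>1\<close> is the image of \<open>\<alpha>1\<close> under
  del and \<open>\<beta>2\<close> that of \<open>\<alpha>2\<close> under delbar; the forms
  \<open>\<gamma>1\<close>, \<open>\<gamma>2\<close> arise as by-products in the fourth-order terms.
  Here index 2 marks the conjugate.\<close>

abbreviation \<alpha>1 :: cform where "\<alpha>1 \<equiv> wedge w2 (wedge z3 unit_form)"
abbreviation \<alpha>2 :: cform where "\<alpha>2 \<equiv> wedge z2 (wedge w3 unit_form)"
abbreviation \<beta>1 :: cform where "\<beta>1 \<equiv> wedge w1 (wedge z2 (wedge z3 unit_form))"
abbreviation \<beta>2 :: cform where "\<beta>2 \<equiv> wedge z1 (wedge w2 (wedge w3 unit_form))"
abbreviation \<gamma>1 :: cform where "\<gamma>1 \<equiv> wedge z1 (wedge w2 (wedge z3 unit_form))"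
abbreviation \<gamma>2 :: cform where "\<gamma>2 \<equiv> wedge w1 (wedge z2 (wedge w3 unit_form))"

definition bs6 :: "(real ^ 6) list" where
  "bs6 = [axis 1 1, axis 2 1, axis 3 1, axis 4 1, axis 5 1, axis 6 1]"

lemma axis_6_nth:
  "axis 1 (1::real) = vec6 1 0 0 0 0 0" "axis 2 (1::real) = vec6 0 1 0 0 0 0"
  "axis 3 (1::real) = vec6 0 0 1 0 0 0" "axis 4 (1::real) = vec6 0 0 0 1 0 0"
  "axis 5 (1::real) = vec6 0 0 0 0 1 0" "axis 6 (1::real) = vec6 0 0 0 0 0 1"
  by (simp_all add: vec6_eq_iff axis_def)

lemma onb_bs6: "onb bs6"
proof -
  have "\<forall>i<6. \<forall>j<6. bs6 ! i \<bullet> bs6 ! j = (if i = j then 1 else 0)"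
    unfolding bs6_def axis_6_nth by (simp add: numeral_eq_Suc inner_6 less_Suc_eq All_less_Suc2)
  then show ?thesis by (simp add: onb_def bs6_def)
qed

text \<open>The characterization of the star on a single orthonormal basis.  For concrete \<open>b\<close> and
  \<open>c\<close> both sides are the same combination of the 64 values of \<open>a\<close> on increasing sublists, so
  that \<open>a\<close> need not be alternating.\<close>

definition star_rel :: "cform \<Rightarrow> cform \<Rightarrow> bool" where
  "star_rel b c \<longleftrightarrow> (\<forall>a. wedge a c bs6 = tsum bs6 a b)"

lemma Complex_simps: "Complex 0 0 = 0" "Complex 1 0 = 1" "Complex 0 1 = \<i>" "Complex 0 (- 1) = - \<i>"
  by (simp_all add: complex_eq_iff)

lemma ins_zw_wedge:
  "ins v (wedge z1 a) = smul (cz 1 2 v) a - wedge z1 (ins v a)"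
  "ins v (wedge z2 a) = smul (cz 3 4 v) a - wedge z2 (ins v a)"
  "ins v (wedge z3 a) = smul (cz 5 6 v) a - wedge z3 (ins v a)"
  "ins v (wedge w1 a) = smul (cw 1 2 v) a - wedge w1 (ins v a)"
  "ins v (wedge w2 a) = smul (cw 3 4 v) a - wedge w2 (ins v a)"
  "ins v (wedge w3 a) = smul (cw 5 6 v) a - wedge w3 (ins v a)"
  unfolding zw_def by (rule ins_one_wedge)+

lemma zw_wedge_Cons:
  "wedge z1 a (v # vs) = cz 1 2 v * a vs - wedge z1 (ins v a) vs"
  "wedge z2 a (v # vs) = cz 3 4 v * a vs - wedge z2 (ins v a) vs"
  "wedge z3 a (v # vs) = cz 5 6 v * a vs - wedge z3 (ins v a) vs"
  "wedge w1 a (v # vs) = cw 1 2 v * a vs - wedge w1 (ins v a) vs"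
  "wedge w2 a (v # vs) = cw 3 4 v * a vs - wedge w2 (ins v a) vs"
  "wedge w3 a (v # vs) = cw 5 6 v * a vs - wedge w3 (ins v a) vs"
  unfolding zw_def by (rule wedge_one_Cons)+

lemma zw_Nil: "z1 [] = 0" "z2 [] = 0" "z3 [] = 0" "w1 [] = 0" "w2 [] = 0" "w3 [] = 0"
  by (simp_all add: zw_def one_form_def)

lemma form_Nil: "smul c a [] = c * a []" "sgnf a [] = a []" "unit_form [] = 1"
  by (simp_all add: smul_def sgnf_def unit_form_def)

lemma cz_cw_bs:
  "cz 1 2 (axis 1 1) = 1" "cz 1 2 (axis 2 1) = \<i>" "cz 1 2 (axis 3 1) = 0" "cz 1 2 (axis 4 1) = 0"
  "cz 1 2 (axis 5 1) = 0" "cz 1 2 (axis 6 1) = 0"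
  "cz 3 4 (axis 1 1) = 0" "cz 3 4 (axis 2 1) = 0" "cz 3 4 (axis 3 1) = 1" "cz 3 4 (axis 4 1) = \<i>"
  "cz 3 4 (axis 5 1) = 0" "cz 3 4 (axis 6 1) = 0"
  "cz 5 6 (axis 1 1) = 0" "cz 5 6 (axis 2 1) = 0" "cz 5 6 (axis 3 1) = 0" "cz 5 6 (axis 4 1) = 0"
  "cz 5 6 (axis 5 1) = 1" "cz 5 6 (axis 6 1) = \<i>"
  "cw 1 2 (axis 1 1) = 1" "cw 1 2 (axis 2 1) = - \<i>" "cw 1 2 (axis 3 1) = 0" "cw 1 2 (axis 4 1) = 0"
  "cw 1 2 (axis 5 1) = 0" "cw 1 2 (axis 6 1) = 0"
  "cw 3 4 (axis 1 1) = 0" "cw 3 4 (axis 2 1) = 0" "cw 3 4 (axis 3 1) = 1" "cw 3 4 (axis 4 1) = - \<i>"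
  "cw 3 4 (axis 5 1) = 0" "cw 3 4 (axis 6 1) = 0"
  "cw 5 6 (axis 1 1) = 0" "cw 5 6 (axis 2 1) = 0" "cw 5 6 (axis 3 1) = 0" "cw 5 6 (axis 4 1) = 0"
  "cw 5 6 (axis 5 1) = 1" "cw 5 6 (axis 6 1) = - \<i>"
  unfolding axis_6_nth by (simp_all add: cz_def cw_def Complex_simps)

lemmas star_calc = star_rel_def bs6_def wedge_Cons ins_zw_wedge cz_cw_bs wedge_linear zw_Nil form_Nil
  smul_def

text \<open>Each \<open>\<sigma>\<close> is up to a scalar the star of the \<open>\<alpha>\<close>
  with its index, each \<open>\<tau>\<close> the star of the \<open>\<rho>\<close>; the latter come
  from \<open>\<beta>1\<close> under del and \<open>\<beta>2\<close> under delbar. Conjugation maps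
  \<open>\<sigma>1\<close> to \<open>-\<sigma>2\<close> and \<open>\<rho>1\<close> to
  \<open>-\<rho>2\<close>, whence the differing signs in the two families.\<close>

abbreviation \<sigma>1 :: cform where "\<sigma>1 \<equiv> wedge z1 (wedge w1 \<alpha>1)"
abbreviation \<sigma>2 :: cform where "\<sigma>2 \<equiv> wedge z1 (wedge w1 \<alpha>2)"
abbreviation \<tau>1 :: cform where "\<tau>1 \<equiv> wedge z2 (wedge z3 unit_form)"
abbreviation \<tau>2 :: cform where "\<tau>2 \<equiv> wedge w2 (wedge w3 unit_form)"
abbreviation \<rho>1 :: cform where "\<rho>1 \<equiv> wedge z1 (wedge w1 \<tau>1)"
abbreviation \<rho>2 :: cform where "\<rho>2 \<equiv> wedge z1 (wedge w1 \<tau>2)"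

lemma star_rel_smul: "star_rel b c \<Longrightarrow> star_rel (smul k b) (smul k c)"
proof -
  have "tsum es a (smul k b) = k * tsum es a b" for es a
    by (induction es arbitrary: a b) (simp_all add: algebra_simps, simp add: smul_def)
  then show "star_rel b c \<Longrightarrow> star_rel (smul k b) (smul k c)"
    by (simp add: star_rel_def) (simp add: smul_def)
qed

lemma star_rel_add: "star_rel b c \<Longrightarrow> star_rel b' c' \<Longrightarrow> star_rel (b + b') (c + c')"
proof -
  have "tsum es a (b + b') = tsum es a b + tsum es a b'" for es a
    by (induction es arbitrary: a b b') (simp_all add: algebra_simps)
  then show "star_rel b c \<Longrightarrow> star_rel b' c' \<Longrightarrow> star_rel (b + b') (c + c')"
    by (simp add: star_rel_def wedge_add_right)
qed

text \<open>The constants agree with the classical formula for the star on primitive forms: on type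
  (1,1) it is minus the product with \<open>\<omega>0\<close>, and on types (2,1) and (1,2) it is
  multiplication by \<open>i\<close> and \<open>-i\<close>. In even degree the star is an
  involution, which fixes the values on \<open>\<sigma>1\<close> and \<open>\<sigma>2\<close>. The
  check expands both sides on \<open>bs6\<close>.\<close>

lemma star_\<alpha>: "star_rel \<alpha>1 (smul (- \<i> / 2) \<sigma>1)" "star_rel \<alpha>2 (smul (- \<i> / 2) \<sigma>2)"
  by (simp_all add: star_calc field_simps)

lemma star_\<sigma>: "star_rel \<sigma>1 (smul (2 * \<i>) \<alpha>1)" "star_rel \<sigma>2 (smul (2 * \<i>) \<alpha>2)"
  by (simp_all add: star_calc field_simps)

lemma star_\<beta>: "star_rel \<beta>1 (smul \<i> \<beta>1)" "star_rel \<beta>2 (smul (- \<i>) \<beta>2)"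
  by (simp_all add: star_calc field_simps)

lemma star_\<gamma>: "star_rel \<gamma>1 (smul \<i> \<gamma>1)" "star_rel \<gamma>2 (smul (- \<i>) \<gamma>2)"
  by (simp_all add: star_calc field_simps)

lemma star_\<rho>: "star_rel \<rho>1 (smul (- 2 * \<i>) \<tau>1)" "star_rel \<rho>2 (smul (- 2 * \<i>) \<tau>2)"
  by (simp_all add: star_calc field_simps)

lemma d0_linear: "d0 (a + b) = d0 a + d0 b" "d0 (smul c a) = smul c (d0 a)"
  by (simp_all add: d0_def deriv_form_linear wedge_linear)

text \<open>The other component of \<open>d0 \<alpha>1\<close>, a multiple of
  \<open>z1 \<and> z2 \<and> z3\<close>, has type (3,0) and is seen by neither del nor delbar;
  likewise the (0,3) component of \<open>d0 \<alpha>2\<close>.\<close>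

lemma bid_d0_\<alpha>:
  "bid J0 2 1 (d0 \<alpha>1) = smul 2 \<beta>1" "bid J0 1 2 (d0 \<alpha>1) = 0"
  "bid J0 2 1 (d0 \<alpha>2) = 0" "bid J0 1 2 (d0 \<alpha>2) = smul 2 \<beta>2"
  by (simp_all only: form_calc, simp_all add: fun_eq_iff smul_def algebra_simps)

text \<open>Each term of \<open>d0\<close> begins with \<open>z1\<close> or \<open>w1\<close>, and
  both are already factors.\<close>

lemma d0_\<sigma>: "d0 \<sigma>1 = 0" "d0 \<sigma>2 = 0"
  by (simp_all only: form_calc)

lemma bid_d0_\<beta>:
  "bid J0 3 1 (d0 \<beta>1) = smul 5 \<rho>1" "bid J0 2 2 (d0 \<beta>1) = smul 2 \<sigma>1"
  "bid J0 2 2 (d0 \<beta>2) = smul (- 2) \<sigma>2" "bid J0 1 3 (d0 \<beta>2) = smul (- 5) \<rho>2"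
  by (simp_all only: form_calc, simp_all add: fun_eq_iff smul_def algebra_simps)

lemma bid_d0_\<tau>:
  "bid J0 2 1 (d0 \<tau>1) = smul (- 5) \<beta>1 + smul 2 \<gamma>1"
  "bid J0 1 2 (d0 \<tau>2) = smul (- 5) \<beta>2 + smul 2 \<gamma>2"
  by (simp_all only: form_calc, simp_all add: fun_eq_iff smul_def algebra_simps)

text \<open>As \<open>\<gamma>1 = z1 \<and> \<alpha>1\<close>, its differential is a multiple of
  \<open>z1 \<and> w1 \<and> z2 \<and> z3\<close>, of type (3,1); that of \<open>\<gamma>2\<close>
  has type (1,3).\<close>

lemma bid_d0_\<gamma>: "bid J0 2 2 (d0 \<gamma>1) = 0" "bid J0 2 2 (d0 \<gamma>2) = 0"
  by (simp_all only: form_calc, simp_all add: fun_eq_iff smul_def algebra_simps)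

definition \<omega>0 :: cform where
  "\<omega>0 = smul (\<i> / 2) (wedge z1 (wedge w1 unit_form) + wedge z2 (wedge w2 unit_form)
     + wedge z3 (wedge w3 unit_form))"

lemma \<omega>0_apply: "\<omega>0 vs = (if length vs = 2 then complex_of_real (J0 (vs ! 0) \<bullet> vs ! 1) else 0)"
proof (cases "length vs = 2")
  case True
  then obtain u v where "vs = [u, v]" by (auto simp: length_Suc_conv numeral_2_eq_2)
  then show ?thesis
    by (simp add: \<omega>0_def zw_wedge_Cons ins_zw_wedge zw_Nil form_Nil smul_def)
       (simp add: cz_def cw_def J0_def inner_6 complex_eq_iff algebra_simps)
next
  case False
  have "wedge (one_form f) (wedge (one_form g) unit_form) vs = 0" for f g
    using False by (intro wedge_one_length[of 1] wedge_one_length[of 0]) (auto simp: unit_form_def)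
  then show ?thesis using False by (simp add: \<omega>0_def zw_def smul_def)
qed

lemma deriv_\<omega>0: "deriv_form rot \<omega>0 = 0"
  unfolding \<omega>0_def
  by (simp only: form_calc, simp add: fun_eq_iff smul_def algebra_simps)

text \<open>Every summand of \<open>\<omega>0\<close> repeats a factor of \<open>\<sigma>1\<close>
  and of \<open>\<sigma>2\<close>. Since these are multiples of the stars, primitivity
  follows.\<close>

lemma \<omega>0_wedge_\<sigma>: "wedge \<omega>0 \<sigma>1 = 0" "wedge \<omega>0 \<sigma>2 = 0"
  unfolding \<omega>0_def by (simp_all only: form_calc wedge_unit_left)

lemma malt_\<omega>0: "malt \<omega>0"
  unfolding \<omega>0_def by (intro malt_intros malt_zw)

definition vol0 :: cform where "vol0 vs = wedge_power \<omega>0 3 vs / fact 3"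

lemma vol0_eq: "vol0 = smul (1 / 6) (wedge \<omega>0 (wedge \<omega>0 \<omega>0))"
  by (simp add: vol0_def fun_eq_iff smul_def wedge_power_def numeral_3_eq_3 fact_numeral
      unit_form_def[abs_def, symmetric] wedge_unit_right)

lemma malt_vol0: "malt vol0"
  unfolding vol0_eq by (intro malt_intros malt_\<omega>0)

lemma vol0_bs6: "vol0 bs6 = 1"
proof -
  \<comment> \<open>The six orderings of the three commuting two-forms cancel the factor
    \<open>1 / 6\<close>.\<close>
  have eq: "vol0 = smul ((\<i> / 2) ^ 3) (wedge z1 (wedge w1 (wedge z2 (wedge w2 (wedge z3 (wedge w3 unit_form))))))"
    unfolding vol0_eq \<omega>0_def
    by (simp only: form_calc wedge_unit_left, simp add: fun_eq_iff smul_def power3_eq_cube algebra_simps)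
  show ?thesis unfolding eq
    by (simp add: bs6_def zw_wedge_Cons ins_zw_wedge cz_cw_bs wedge_linear zw_Nil form_Nil smul_def
        power3_eq_cube)
qed

section \<open>A rotating coframe\<close>

lemma frechet_eq_local:
  assumes "open S" "x \<in> S" "\<And>y. y \<in> S \<Longrightarrow> f y = g y"
  shows "f differentiable (at x) \<longleftrightarrow> g differentiable (at x)"
    and "frechet_derivative f (at x) = frechet_derivative g (at x)"
proof -
  have "(f has_derivative D) (at x) \<longleftrightarrow> (g has_derivative D) (at x)" for D
    using has_derivative_transform_within_open[of f D x UNIV S g]
      has_derivative_transform_within_open[of g D x UNIV S f] assms by auto
  then show "f differentiable (at x) \<longleftrightarrow> g differentiable (at x)"
    "frechet_derivative f (at x) = frechet_derivative g (at x)"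
    by (simp_all add: differentiable_def frechet_derivative_def)
qed

lemma Ck_on_cong:
  assumes "open S" "\<And>x. x \<in> S \<Longrightarrow> f x = g x"
  shows "Ck_on k S f \<longleftrightarrow> Ck_on k S g"
  using assms(2)
proof (induction k arbitrary: f g)
  case 0
  then show ?case by (simp cong: continuous_on_cong)
next
  case (Suc k)
  have eq: "f differentiable (at x) \<longleftrightarrow> g differentiable (at x)"
    "frechet_derivative f (at x) = frechet_derivative g (at x)" if "x \<in> S" for x
    using frechet_eq_local[OF assms(1) that, of f g] Suc.prems by auto
  have "Ck_on k S (\<lambda>x. frechet_derivative f (at x) v) = Ck_on k S (\<lambda>x. frechet_derivative g (at x) v)" for v
    by (rule Suc.IH) (simp add: eq)
  then show ?case by (simp add: eq)
qed

lemma Ck_on_SucI: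
  assumes "open S" "\<And>x. x \<in> S \<Longrightarrow> (f has_derivative D x) (at x)" "\<And>v. Ck_on k S (\<lambda>x. D x v)"
  shows "Ck_on (Suc k) S f"
proof -
  have "Ck_on k S (\<lambda>x. frechet_derivative f (at x) v)" for v
    using assms(3)[of v] frechet_derivative_at[OF assms(2)]
    by (subst Ck_on_cong[OF assms(1), of _ "\<lambda>x. D x v"]) auto
  then show ?thesis using assms(2) by (auto simp: differentiable_def)
qed

lemma Ck_on_const: "open S \<Longrightarrow> Ck_on k S (\<lambda>x. c)"
proof (induction k arbitrary: c)
  case (Suc k)
  show ?case by (rule Ck_on_SucI[where D = "\<lambda>x v. 0"]) (use Suc in auto)
qed simp

lemma Ck_on_scaleR: "open S \<Longrightarrow> Ck_on k S f \<Longrightarrow> Ck_on k S (\<lambda>x. c *\<^sub>R f x)"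
proof (induction k arbitrary: f)
  case (Suc k)
  then have "(f has_derivative frechet_derivative f (at x)) (at x)" if "x \<in> S" for x
    using that by (simp flip: frechet_derivative_works)
  then have "((\<lambda>x. c *\<^sub>R f x) has_derivative (\<lambda>v. c *\<^sub>R frechet_derivative f (at x) v)) (at x)" if "x \<in> S" for x
    using that by (intro has_derivative_scaleR_right)
  then show ?case using Suc
    by (intro Ck_on_SucI[where D = "\<lambda>x v. c *\<^sub>R frechet_derivative f (at x) v"]) auto
qed (auto intro: continuous_intros)

text \<open>Meant for the transition maps of the torus, where the translation may differ between the
  components of an overlap.\<close>

lemma Ck_on_locally_translation:
  assumes "open S" "\<And>x. x \<in> S \<Longrightarrow> \<exists>U c. open U \<and> x \<in> U \<and> (\<forall>y\<in>U. f y = y + c)"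
  shows "Ck_on k S f"
proof -
  have D: "(f has_derivative (\<lambda>v. v)) (at x)" if x: "x \<in> S" for x
  proof -
    obtain U c where U: "open U" "x \<in> U" "\<forall>y\<in>U. f y = y + c" using assms(2)[OF x] by blast
    have "((\<lambda>y. y + c) has_derivative (\<lambda>v. v)) (at x)" by (auto intro!: derivative_eq_intros)
    then show ?thesis
      by (rule has_derivative_transform_within_open[OF _ U(1,2)]) (use U(3) in auto)
  qed
  show ?thesis
  proof (cases k)
    case 0
    then show ?thesis using D
      by (auto intro!: continuous_at_imp_continuous_on has_derivative_continuous)
  next
    case (Suc j)
    then show ?thesis using D assms(1)
      by (auto intro!: Ck_on_SucI[where D = "\<lambda>x v. v"] Ck_on_const simp del: Ck_on.simps)
  qed
qed

text \<open>The exponential of \<open>x_2 rot\<close>. The block with entries \<open>-1\<close> and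
  \<open>9\<close> yields a rotation by \<open>3 x_2\<close> conjugated by a scaling of the axes,
  hence the factors \<open>3\<close> and \<open>1/3\<close>.\<close>

definition coframe :: "real ^ 6 \<Rightarrow> real ^ 6 \<Rightarrow> real ^ 6" where
  "coframe x v = vec6 (v $ 1) (v $ 2)
     (cos (3 * x $ 2) * v $ 3 - sin (3 * x $ 2) / 3 * v $ 4)
     (3 * sin (3 * x $ 2) * v $ 3 + cos (3 * x $ 2) * v $ 4)
     (cos (5 * x $ 2) * v $ 5 - sin (5 * x $ 2) * v $ 6)
     (sin (5 * x $ 2) * v $ 5 + cos (5 * x $ 2) * v $ 6)"

definition coframe_inv :: "real ^ 6 \<Rightarrow> real ^ 6 \<Rightarrow> real ^ 6" where
  "coframe_inv x v = vec6 (v $ 1) (v $ 2)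
     (cos (3 * x $ 2) * v $ 3 + sin (3 * x $ 2) / 3 * v $ 4)
     (- 3 * sin (3 * x $ 2) * v $ 3 + cos (3 * x $ 2) * v $ 4)
     (cos (5 * x $ 2) * v $ 5 + sin (5 * x $ 2) * v $ 6)
     (- sin (5 * x $ 2) * v $ 5 + cos (5 * x $ 2) * v $ 6)"

lemma linear_coframe: "linear (coframe x)" and linear_coframe_inv: "linear (coframe_inv x)"
  by (simp_all add: linear_iff coframe_def coframe_inv_def vec6_eq_iff algebra_simps)

lemma cos_sin_square: "cos a * (cos a * b) + sin a * (sin a * b) = (b::real)"
proof -
  have "(cos a)\<^sup>2 + (sin a)\<^sup>2 = 1" by simp
  then show ?thesis by algebra
qed

lemma coframe_coframe_inv [simp]: "coframe x (coframe_inv x v) = v" "coframe_inv x (coframe x v) = v"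
  using cos_sin_square[of "3 * x $ 2"] cos_sin_square[of "5 * x $ 2"]
  by (simp_all add: coframe_def coframe_inv_def vec6_eq_iff algebra_simps)

lemma bij_coframe: "bij (coframe x)"
  by (rule bijI') (metis coframe_coframe_inv)+

lemma coframe_2 [simp]: "coframe x v $ 2 = v $ 2"
  by (simp add: coframe_def)

lemma coframe_periodic:
  assumes "x $ 2 = y $ 2 + 2 * pi * of_int k"
  shows "coframe x = coframe y"
proof -
  have "3 * x $ 2 = 3 * y $ 2 + 2 * pi * of_int (3 * k)" "5 * x $ 2 = 5 * y $ 2 + 2 * pi * of_int (5 * k)"
    using assms by simp_all
  then have "cos (3 * x $ 2) = cos (3 * y $ 2)" "sin (3 * x $ 2) = sin (3 * y $ 2)"
    "cos (5 * x $ 2) = cos (5 * y $ 2)" "sin (5 * x $ 2) = sin (5 * y $ 2)"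
    by (simp_all only: sin_add cos_add sin_int_2pin cos_int_2pin mult_1_right mult_zero_right add_0_right diff_zero)
  then show ?thesis by (simp add: coframe_def fun_eq_iff)
qed

lemma vec6_sum: "vec6 a b c d e f = a *\<^sub>R axis 1 1 + b *\<^sub>R axis 2 1 + c *\<^sub>R axis 3 1
    + d *\<^sub>R axis 4 1 + e *\<^sub>R axis 5 1 + f *\<^sub>R axis 6 1"
  unfolding axis_6_nth by (simp add: vec6_eq_iff)

lemma has_derivative_coframe:
  "((\<lambda>x. coframe x v) has_derivative (\<lambda>u. u $ 2 *\<^sub>R rot (coframe x v))) (at x)"
  unfolding coframe_def vec6_sum
  by (auto intro!: derivative_eq_intros bounded_linear.has_derivative[OF bounded_linear_vec_nth]
      simp: fun_eq_iff)
     (simp add: axis_6_nth vec6_eq_iff rot_def algebra_simps)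

lemma has_derivative_coframe_inv:
  "((\<lambda>x. coframe_inv x v) has_derivative (\<lambda>u. - u $ 2 *\<^sub>R coframe_inv x (rot v))) (at x)"
  unfolding coframe_inv_def vec6_sum
  by (auto intro!: derivative_eq_intros bounded_linear.has_derivative[OF bounded_linear_vec_nth]
      simp: fun_eq_iff)
     (simp add: axis_6_nth vec6_eq_iff rot_def algebra_simps)

lemma linear_expand_axis:
  fixes g :: "real ^ 'n \<Rightarrow> 'w::real_vector"
  assumes "linear g"
  shows "g y = (\<Sum>i\<in>UNIV. y $ i *\<^sub>R g (axis i 1))"
proof -
  have "y = (\<Sum>i\<in>UNIV. y $ i *\<^sub>R axis i 1)"
    using basis_expansion[of y] by (simp add: scalar_mult_eq_scaleR)
  then have "g y = g (\<Sum>i\<in>UNIV. y $ i *\<^sub>R axis i 1)" by simp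
  then show ?thesis by (simp add: linear_sum[OF assms] linear_scale[OF assms])
qed

text \<open>Expanding the first argument over the axes leaves scalars times the same kind of
  function on a shorter list; the product rule then reproduces the recursion of
  \<open>deriv_form\<close>.\<close>

lemma has_derivative_pull_coframe:
  assumes "malt a"
  shows "((\<lambda>x. a (map (coframe x) vs)) has_derivative
    (\<lambda>u. u $ 2 *\<^sub>R deriv_form rot a (map (coframe x) vs))) (at x)"
  using assms
proof (induction vs arbitrary: a)
  case (Cons v vs)
  let ?A = "\<lambda>i. ins (axis i 1) a"
  have lin: "linear (\<lambda>y. a (y # ws))" for ws using malt_linear[OF Cons.prems, of "[]"] by simp
  have lin': "linear (\<lambda>y. deriv_form rot (ins y a) ws)" for ws
    using Cons.prems by (auto simp: linear_iff ins_add_vec ins_scaleR deriv_form_linear)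
       (simp add: smul_def scaleR_conv_of_real)
  have comp: "((\<lambda>x. coframe x v $ i) has_derivative (\<lambda>u. u $ 2 *\<^sub>R rot (coframe x v) $ i)) (at x)" for i
    using bounded_linear.has_derivative[OF bounded_linear_vec_nth[of i] has_derivative_coframe] by simp
  have "((\<lambda>x. \<Sum>i\<in>UNIV. coframe x v $ i *\<^sub>R ?A i (map (coframe x) vs)) has_derivative
    (\<lambda>u. \<Sum>i\<in>UNIV. coframe x v $ i *\<^sub>R (u $ 2 *\<^sub>R deriv_form rot (?A i) (map (coframe x) vs))
       + (u $ 2 *\<^sub>R rot (coframe x v) $ i) *\<^sub>R ?A i (map (coframe x) vs))) (at x)"
    by (rule has_derivative_sum, rule has_derivative_scaleR[OF comp Cons.IH[OF malt_ins[OF Cons.prems]]])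
  moreover have "(\<Sum>i\<in>UNIV. coframe x v $ i *\<^sub>R ?A i (map (coframe x) vs)) = a (map (coframe x) (v # vs))" for x
    by (simp add: ins_def linear_expand_axis[OF lin, of "coframe x v"])
  moreover have "(\<Sum>i\<in>UNIV. coframe x v $ i *\<^sub>R (u $ 2 *\<^sub>R deriv_form rot (?A i) (map (coframe x) vs))
       + (u $ 2 *\<^sub>R rot (coframe x v) $ i) *\<^sub>R ?A i (map (coframe x) vs))
     = u $ 2 *\<^sub>R deriv_form rot a (map (coframe x) (v # vs))" for u :: "real ^ 6"
    using linear_expand_axis[OF lin, of "rot (coframe x v)"] linear_expand_axis[OF lin', of "coframe x v"]
    by (simp add: sum.distrib deriv_form_Cons scaleR_add_right scaleR_sum_right ins_def mult.commute)
  ultimately show ?case by simp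
qed simp

text \<open>A directional derivative merely replaces \<open>a\<close> by a constant multiple of
  \<open>deriv_form rot a\<close>, so induction on the order works for all \<open>a\<close> at
  once.\<close>

lemma smooth_pull_coframe:
  assumes "open S" "malt a"
  shows "smooth_on S (\<lambda>x. a (map (coframe x) vs))"
proof -
  have "Ck_on k S (\<lambda>x. a (map (coframe x) vs))" for k
    using assms(2)
  proof (induction k arbitrary: a)
    case 0
    then show ?case
      by (simp add: continuous_at_imp_continuous_on has_derivative_continuous[OF has_derivative_pull_coframe])
  next
    case (Suc k)
    show ?case
      by (rule Ck_on_SucI[OF assms(1) has_derivative_pull_coframe[OF Suc.prems]])
         (intro Ck_on_scaleR assms(1) Suc.IH malt_deriv_form linear_rot Suc.prems)
  qed
  then show ?thesis by (simp add: smooth_on_def)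
qed

lemma bilinear_has_derivative:
  fixes b :: "real ^ 6 \<Rightarrow> real ^ 6 \<Rightarrow> real"
  assumes "bilinear b"
  shows "((\<lambda>x. b (coframe x u) (coframe x v)) has_derivative
    (\<lambda>h. h $ 2 *\<^sub>R (b (coframe x u) (rot (coframe x v)) + b (rot (coframe x u)) (coframe x v)))) (at x)"
proof -
  interpret bounded_bilinear b using assms by (simp add: bilinear_conv_bounded_bilinear)
  show ?thesis
    using FDERIV[OF has_derivative_coframe[of u x] has_derivative_coframe[of v x]]
    by (simp add: scaleR_left scaleR_right algebra_simps)
qed

lemma smooth_bilinear_coframe:
  fixes b :: "real ^ 6 \<Rightarrow> real ^ 6 \<Rightarrow> real"
  assumes "open S" "bilinear b"
  shows "smooth_on S (\<lambda>x. b (coframe x u) (coframe x v))"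
proof -
  have "Ck_on k S (\<lambda>x. b (coframe x u) (coframe x v))" for k
    using assms(2)
  proof (induction k arbitrary: b)
    case 0
    then show ?case
      by (simp add: continuous_at_imp_continuous_on has_derivative_continuous[OF bilinear_has_derivative])
  next
    case (Suc k)
    have "bilinear (\<lambda>y z. b y (rot z) + b (rot y) z)"
      using Suc.prems linear_rot by (auto simp: bilinear_def linear_iff algebra_simps)
    then show ?case
      by (intro Ck_on_SucI[OF assms(1) bilinear_has_derivative[OF Suc.prems]] Ck_on_scaleR assms(1))
         (rule Suc.IH)
  qed
  then show ?thesis by (simp add: smooth_on_def)
qed

lemma conj_has_derivative:
  fixes A :: "real ^ 6 \<Rightarrow> real ^ 6"
  assumes "linear A"
  shows "((\<lambda>x. coframe_inv x (A (coframe x v))) has_derivative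
    (\<lambda>u. u $ 2 *\<^sub>R coframe_inv x (A (rot (coframe x v)) - rot (A (coframe x v))))) (at x)"
proof -
  have AF: "((\<lambda>x. A (coframe x v)) has_derivative (\<lambda>u. u $ 2 *\<^sub>R A (rot (coframe x v)))) (at x)"
    using bounded_linear.has_derivative[OF assms[unfolded linear_conv_bounded_linear] has_derivative_coframe]
    by (simp add: linear_scale[OF assms])
  have comp: "((\<lambda>x. A (coframe x v) $ i) has_derivative (\<lambda>u. u $ 2 *\<^sub>R A (rot (coframe x v)) $ i)) (at x)" for i
    using bounded_linear.has_derivative[OF bounded_linear_vec_nth[of i] AF] by simp
  have "((\<lambda>x. \<Sum>i\<in>UNIV. A (coframe x v) $ i *\<^sub>R coframe_inv x (axis i 1)) has_derivative
    (\<lambda>u. \<Sum>i\<in>UNIV. A (coframe x v) $ i *\<^sub>R (- u $ 2 *\<^sub>R coframe_inv x (rot (axis i 1)))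
       + (u $ 2 *\<^sub>R A (rot (coframe x v)) $ i) *\<^sub>R coframe_inv x (axis i 1))) (at x)"
    by (rule has_derivative_sum, rule has_derivative_scaleR[OF comp has_derivative_coframe_inv])
  moreover have "(\<Sum>i\<in>UNIV. A (coframe x v) $ i *\<^sub>R coframe_inv x (axis i 1)) = coframe_inv x (A (coframe x v))" for x
    by (rule linear_expand_axis[OF linear_coframe_inv, symmetric])
  moreover have "(\<Sum>i\<in>UNIV. A (coframe x v) $ i *\<^sub>R (- u $ 2 *\<^sub>R coframe_inv x (rot (axis i 1)))
       + (u $ 2 *\<^sub>R A (rot (coframe x v)) $ i) *\<^sub>R coframe_inv x (axis i 1))
     = u $ 2 *\<^sub>R coframe_inv x (A (rot (coframe x v)) - rot (A (coframe x v)))" for u :: "real ^ 6"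
    using linear_expand_axis[OF linear_coframe_inv, of x "A (rot (coframe x v))"]
      linear_expand_axis[OF linear_compose[OF linear_rot linear_coframe_inv], of x "A (coframe x v)"]
    by (simp add: sum.distrib linear_diff[OF linear_coframe_inv] scaleR_diff_right scaleR_sum_right
        sum_negf sum_subtractf mult.commute)
  ultimately show ?thesis by simp
qed

text \<open>The same closure argument: differentiation replaces \<open>A\<close> by its commutator
  with \<open>rot\<close>.\<close>

lemma smooth_conj_coframe:
  fixes A :: "real ^ 6 \<Rightarrow> real ^ 6"
  assumes "open S" "linear A"
  shows "smooth_on S (\<lambda>x. coframe_inv x (A (coframe x v)))"
proof -
  have "Ck_on k S (\<lambda>x. coframe_inv x (A (coframe x v)))" for k
    using assms(2)
  proof (induction k arbitrary: A)
    case 0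
    then show ?case
      by (simp add: continuous_at_imp_continuous_on has_derivative_continuous[OF conj_has_derivative])
  next
    case (Suc k)
    have "linear (\<lambda>y. A (rot y) - rot (A y))"
      using Suc.prems linear_rot by (auto simp: linear_iff algebra_simps)
    then show ?case
      by (intro Ck_on_SucI[OF assms(1) conj_has_derivative[OF Suc.prems]] Ck_on_scaleR assms(1))
         (rule Suc.IH)
  qed
  then show ?thesis by (simp add: smooth_on_def)
qed

lemma wedge_one_sum:
  "wedge (one_form f) a vs
    = (\<Sum>i<length vs. (- 1) ^ i * (f (vs ! i) * a (take i vs @ drop (Suc i) vs)))"
proof (induction vs arbitrary: a)
  case Nil
  then show ?case by (simp add: one_form_def)
next
  case (Cons v vs)
  then show ?case
    by (simp add: wedge_one_Cons ins_def sum.lessThan_Suc_shift sum_negf del: sum.lessThan_Suc)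
qed

text \<open>Along \<open>v_i\<close> the derivative is the second component of \<open>v_i\<close>
  times \<open>deriv_form rot a\<close>, so the alternating sum is the wedge with
  \<open>dx_2\<close>, a covector that the coframe leaves unchanged.\<close>

lemma ext_derivative_pull_coframe:
  assumes "malt a"
  shows "(\<Sum>i<length vs. (- 1) ^ i * frechet_derivative
      (\<lambda>y. a (map (coframe y) (take i vs @ drop (Suc i) vs))) (at x) (vs ! i))
    = pull (coframe x) (d0 a) vs"
proof -
  have "pull (coframe x) (one_form (\<lambda>v. complex_of_real (v $ 2))) = one_form (\<lambda>v. complex_of_real (v $ 2))"
    by (auto simp: fun_eq_iff pull_def one_form_def split: list.splits)
  then have "pull (coframe x) (d0 a) vs
      = wedge (one_form (\<lambda>v. complex_of_real (v $ 2))) (pull (coframe x) (deriv_form rot a)) vs"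
    by (simp add: d0_def pull_wedge)
  then show ?thesis
    unfolding wedge_one_sum frechet_derivative_at[OF has_derivative_pull_coframe[OF assms], symmetric]
    by (simp add: pull_def scaleR_conv_of_real)
qed

section \<open>The torus as a manifold\<close>

definition lat :: "real ^ 6 \<Rightarrow> real ^ 6 \<Rightarrow> bool" where
  "lat x y \<longleftrightarrow> (\<forall>i. \<exists>k::int. x $ i = y $ i + 2 * pi * of_int k)"

text \<open>A point of the torus is a whole congruence class; sets of vectors that are not classes
  lie outside the space.\<close>

definition proj :: "real ^ 6 \<Rightarrow> (real ^ 6) set" where
  "proj x = {y. lat y x}"

lemma lat_refl [simp]: "lat x x"
  unfolding lat_def by (auto intro: exI[of _ 0])

lemma lat_sym: "lat x y \<Longrightarrow> lat y x"
  unfolding lat_def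
proof
  fix i assume "\<forall>i. \<exists>k::int. x $ i = y $ i + 2 * pi * of_int k"
  then obtain k :: int where "x $ i = y $ i + 2 * pi * of_int k" by blast
  then show "\<exists>k::int. y $ i = x $ i + 2 * pi * of_int k" by (intro exI[of _ "- k"]) simp
qed

lemma lat_trans: "lat x y \<Longrightarrow> lat y z \<Longrightarrow> lat x z"
  unfolding lat_def
proof
  fix i assume "\<forall>i. \<exists>k::int. x $ i = y $ i + 2 * pi * of_int k" "\<forall>i. \<exists>k::int. y $ i = z $ i + 2 * pi * of_int k"
  then obtain k l :: int where "x $ i = y $ i + 2 * pi * of_int k" "y $ i = z $ i + 2 * pi * of_int l" by meson
  then show "\<exists>k::int. x $ i = z $ i + 2 * pi * of_int k"
    by (intro exI[of _ "k + l"]) (simp add: algebra_simps)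
qed

lemma lat_add: "lat x y \<Longrightarrow> lat (x + c) (y + c)"
  by (simp add: lat_def)

lemma proj_eq_iff: "proj x = proj y \<longleftrightarrow> lat x y"
  unfolding proj_def using lat_refl lat_sym lat_trans by blast

text \<open>Distinct congruent points differ in some component by at least \<open>2 pi\<close>, more
  than the diameter of a unit ball. This justifies the radius of the charts.\<close>

lemma lat_near_eq:
  assumes "lat x y" "dist x p < 1" "dist y p < 1"
  shows "x = y"
proof -
  have "x $ i = y $ i" for i
  proof -
    obtain k :: int where k: "x $ i = y $ i + 2 * pi * of_int k" using assms(1) by (auto simp: lat_def)
    have "\<bar>x $ i - y $ i\<bar> \<le> dist x y"
      using component_le_norm_cart[of "x - y" i] by (simp add: dist_norm)
    also have "\<dots> < 2" using dist_triangle2[of x y p] assms(2,3) by simp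
    finally have "2 * pi * \<bar>of_int k\<bar> < 2" using k by (simp add: abs_mult)
    moreover have "2 < 2 * pi" using pi_gt3 by simp
    ultimately have "\<bar>of_int k :: real\<bar> < 1"
      by (smt (verit, best) mult_less_cancel_left2 pi_gt_zero mult_le_cancel_left1)
    then have "k = 0" by linarith
    then show ?thesis using k by simp
  qed
  then show ?thesis by (simp add: vec_eq_iff)
qed

definition torus_top :: "(real ^ 6) set topology" where
  "torus_top = topology (\<lambda>U. U \<subseteq> range proj \<and> open (proj -` U))"

lemma openin_torus: "openin torus_top U \<longleftrightarrow> U \<subseteq> range proj \<and> open (proj -` U)"
proof -
  have "istopology (\<lambda>U. U \<subseteq> range proj \<and> open (proj -` U))"
    unfolding istopology_def by (auto simp: vimage_Union open_Int)
  then show ?thesis by (simp add: torus_top_def)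
qed

lemma topspace_torus: "topspace torus_top = range proj"
proof
  show "range proj \<subseteq> topspace torus_top"
  proof (rule openin_subset)
    have "proj -` range proj = UNIV" by auto
    then show "openin torus_top (range proj)" by (simp add: openin_torus)
  qed
  show "topspace torus_top \<subseteq> range proj"
    using openin_topspace[of torus_top, unfolded openin_torus] by blast
qed

lemma open_proj:
  assumes "open W"
  shows "openin torus_top (proj ` W)"
proof -
  \<comment> \<open>The saturation of \<open>W\<close> is the union of its lattice
    translates.\<close>
  have "proj -` proj ` W = (\<Union>c\<in>{c. lat c 0}. (+) c ` W)"
  proof (intro set_eqI iffI)
    fix x assume "x \<in> proj -` proj ` W"
    then obtain y where y: "y \<in> W" "lat x y" by (auto simp: proj_eq_iff)
    then have "lat (x - y) 0" using lat_add[of x y "- y"] by simp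
    then show "x \<in> (\<Union>c\<in>{c. lat c 0}. (+) c ` W)" using y(1)
      by (auto intro!: bexI[of _ "x - y"] image_eqI[of _ _ y])
  next
    fix x assume "x \<in> (\<Union>c\<in>{c. lat c 0}. (+) c ` W)"
    then obtain c y where "lat c 0" "y \<in> W" "x = c + y" by auto
    then show "x \<in> proj -` proj ` W" using lat_add[of c 0 y] by (auto simp: proj_eq_iff)
  qed
  then show ?thesis using assms by (auto simp: openin_torus intro: open_translation)
qed

lemma continuous_proj: "continuous_map euclidean torus_top proj"
  by (auto simp: continuous_map_def openin_torus topspace_torus vimage_def)

lemma Hausdorff_torus: "Hausdorff_space torus_top"
  unfolding Hausdorff_space_def topspace_torus
proof (intro allI impI, elim conjE rangeE)
  fix X Y x y assume "X \<noteq> Y" and XY: "X = proj x" "Y = proj y"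
  then have "\<not> lat x y" by (simp add: proj_eq_iff)
  then obtain i where i: "x $ i \<noteq> y $ i + 2 * pi * of_int k" for k :: int by (auto simp: lat_def)
  \<comment> \<open>Pairs whose components at \<open>i\<close> are incongruent modulo
    \<open>2 pi\<close>; this set is open because the integers are closed in the reals.\<close>
  define S where "S = (\<lambda>z :: (real ^ 6) \<times> (real ^ 6). (fst z $ i - snd z $ i) / (2 * pi)) -` (- \<int>)"
  have "open (- (\<int> :: real set))" using closed_Ints by (simp add: closed_def)
  then have "open S" unfolding S_def by (intro open_vimage continuous_intros) auto
  moreover have "(x, y) \<in> S"
    using i by (auto simp: S_def Ints_def field_simps)
  ultimately obtain A B where AB: "open A" "open B" "x \<in> A" "y \<in> B" "A \<times> B \<subseteq> S"
    by (auto elim: open_prod_elim)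
  have "proj a \<noteq> proj b" if "a \<in> A" "b \<in> B" for a b
  proof
    assume "proj a = proj b"
    then obtain k :: int where "a $ i = b $ i + 2 * pi * of_int k" by (auto simp: proj_eq_iff lat_def)
    then have "(a $ i - b $ i) / (2 * pi) = of_int k" by simp
    moreover have "(a $ i - b $ i) / (2 * pi) \<notin> \<int>" using AB(5) that by (auto simp: S_def)
    ultimately show False by simp
  qed
  then have "disjnt (proj ` A) (proj ` B)" by (auto simp: disjnt_def)
  then show "\<exists>U V. openin torus_top U \<and> openin torus_top V \<and> X \<in> U \<and> Y \<in> V \<and> disjnt U V"
    using AB open_proj XY by blast
qed

lemma second_countable_torus:
  "\<exists>B. countable B \<and> openin torus_top = arbitrary union_of (\<lambda>U. U \<in> B)"
proof -
  obtain B :: "(real ^ 6) set set" where B: "countable B" "topological_basis B"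
    using ex_countable_basis by blast
  have "openin torus_top U \<longleftrightarrow> (arbitrary union_of (\<lambda>U. U \<in> (`) proj ` B)) U" for U
  proof
    assume U: "openin torus_top U"
    then obtain B' where B': "B' \<subseteq> B" "\<Union>B' = proj -` U"
      using B(2) unfolding topological_basis_def openin_torus by metis
    have "\<Union>((`) proj ` B') = proj ` (proj -` U)" using B'(2) by (metis image_Union)
    also have "\<dots> = U" using U by (auto simp: openin_torus)
    finally show "(arbitrary union_of (\<lambda>U. U \<in> (`) proj ` B)) U"
      unfolding union_of_def arbitrary_def using B'(1) by (intro exI[of _ "(`) proj ` B'"]) auto
  next
    assume "(arbitrary union_of (\<lambda>U. U \<in> (`) proj ` B)) U"
    then obtain \<U> where "\<U> \<subseteq> (`) proj ` B" "\<Union>\<U> = U"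
      by (auto simp: union_of_def)
    moreover have "openin torus_top (proj ` b)" if "b \<in> B" for b
      using topological_basis_open[OF B(2) that] by (rule open_proj)
    ultimately show "openin torus_top U" by (auto intro!: openin_Union)
  qed
  then show ?thesis using B(1) by (intro exI[of _ "(`) proj ` B"]) auto
qed

lemma compact_torus: "compact_space torus_top"
proof -
  have "range proj \<subseteq> proj ` cbox 0 (\<chi> i. 2 * pi)"
  proof (intro image_subsetI)
    fix x :: "real ^ 6"
    define y :: "real ^ 6" where "y = (\<chi> i. x $ i - 2 * pi * of_int \<lfloor>x $ i / (2 * pi)\<rfloor>)"
    have "lat x y" by (auto simp: lat_def y_def)
    moreover have "0 \<le> y $ i \<and> y $ i \<le> 2 * pi" for i
    proof -
      define q where "q = x $ i / (2 * pi)"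
      have "x $ i = 2 * pi * q" by (simp add: q_def)
      then have "y $ i = 2 * pi * (q - of_int \<lfloor>q\<rfloor>)"
        by (simp add: y_def q_def algebra_simps)
      moreover have "0 \<le> q - of_int \<lfloor>q\<rfloor>" "q - of_int \<lfloor>q\<rfloor> \<le> 1" by linarith+
      ultimately show ?thesis by (simp add: mult_left_le)
    qed
    ultimately show "proj x \<in> proj ` cbox 0 (\<chi> i. 2 * pi)"
      by (auto simp: proj_eq_iff mem_box_cart intro!: image_eqI[of _ _ y])
  qed
  then have "topspace torus_top = proj ` cbox 0 (\<chi> i. 2 * pi)"
    by (auto simp: topspace_torus)
  moreover have "compactin torus_top (proj ` cbox 0 (\<chi> i. 2 * pi))"
    by (rule image_compactin[OF _ continuous_proj]) simp
  ultimately show ?thesis by (simp add: compact_space_def)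
qed

lemma connected_torus: "connected_space torus_top"
proof -
  have "connectedin torus_top (proj ` UNIV)"
    by (rule connectedin_continuous_map_image[OF continuous_proj]) (simp add: connected_UNIV)
  then show ?thesis by (simp add: connectedin_topspace flip: topspace_torus)
qed

section \<open>Charts as local inverses of the projection\<close>

definition torus_chart :: "real ^ 6 \<Rightarrow> ((real ^ 6) set, 6) chart" where
  "torus_chart p = (proj ` ball p 1, inv_into (ball p 1) proj)"

definition torus_atlas :: "((real ^ 6) set, 6) chart set" where
  "torus_atlas = range torus_chart"

lemma inj_on_proj: "inj_on proj (ball p 1)"
  by (rule inj_onI) (auto simp: proj_eq_iff dist_commute intro: lat_near_eq[of _ _ p])

lemma torus_chart_facts:
  assumes "c \<in> torus_atlas"
  shows open_chart_img: "open (chart_img c)"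
    and openin_chart_dom: "openin torus_top (chart_dom c)"
    and chart_inv_eq: "x \<in> chart_img c \<Longrightarrow> chart_inv c x = proj x"
    and proj_in_dom: "x \<in> chart_img c \<Longrightarrow> proj x \<in> chart_dom c"
    and chart_map_proj: "x \<in> chart_img c \<Longrightarrow> chart_map c (proj x) = x"
    and proj_chart_map: "P \<in> chart_dom c \<Longrightarrow> proj (chart_map c P) = P"
proof -
  obtain p where c: "c = torus_chart p" using assms by (auto simp: torus_atlas_def)
  have map: "chart_map c (proj x) = x" if "x \<in> ball p 1" for x
    using that inj_on_proj by (simp add: c torus_chart_def inv_into_f_f)
  have dom: "chart_dom c = proj ` ball p 1" by (simp add: c torus_chart_def)
  have img: "chart_img c = ball p 1"
    unfolding dom image_image using map by (auto simp: image_iff)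
  have ball: "x \<in> ball p 1" if "x \<in> chart_img c" for x
    using that unfolding img .
  show "open (chart_img c)" unfolding img by simp
  show "openin torus_top (chart_dom c)" unfolding dom by (rule open_proj) simp
  show "proj x \<in> chart_dom c" if "x \<in> chart_img c"
    unfolding dom by (rule imageI[OF ball[OF that]])
  show "chart_map c (proj x) = x" if "x \<in> chart_img c" by (rule map[OF ball[OF that]])
  have pm: "P \<in> chart_dom c \<Longrightarrow> proj (chart_map c P) = P" for P
    unfolding dom using map by force
  then show "P \<in> chart_dom c \<Longrightarrow> proj (chart_map c P) = P" .
  have "inj_on (chart_map c) (chart_dom c)" using pm by (rule inj_on_inverseI)
  then show "chart_inv c x = proj x" if "x \<in> chart_img c"
    using map ball[OF that] by (intro inv_into_f_eq) (auto simp: dom)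
qed

text \<open>Two chart values of the same point differ by a lattice vector \<open>d\<close>, and
  translation by \<open>d\<close> does not change the class.\<close>

lemma transition_translation:
  assumes "c \<in> torus_atlas" "c' \<in> torus_atlas" "P \<in> chart_dom c" "P \<in> chart_dom c'"
  shows "\<exists>U d. open U \<and> chart_map c P \<in> U \<and> (\<forall>y\<in>U. (chart_map c' \<circ> chart_inv c) y = y + d)"
proof -
  define d where "d = chart_map c' P - chart_map c P"
  have "lat (chart_map c' P) (chart_map c P)"
    using proj_chart_map assms by (simp flip: proj_eq_iff)
  then have d: "proj (y + d) = proj y" for y
    unfolding proj_eq_iff using lat_add[of "chart_map c' P" "chart_map c P" "y - chart_map c P"]
    by (simp add: d_def algebra_simps)
  define U where "U = chart_img c \<inter> (\<lambda>y. y + d) -` chart_img c'"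
  have "open U" unfolding U_def using open_chart_img assms(1,2)
    by (intro open_Int open_vimage continuous_intros) auto
  moreover have "chart_map c P \<in> U" using assms by (auto simp: U_def d_def)
  moreover have "(chart_map c' \<circ> chart_inv c) y = y + d" if "y \<in> U" for y
    using that chart_map_proj[OF assms(2), of "y + d"] chart_inv_eq[OF assms(1), of y]
    by (simp add: U_def d)
  ultimately show ?thesis by blast
qed

text \<open>Translations have identity derivative, so tangent vectors have the same components in
  all charts and the chart-based definitions become formulas on \<open>real ^ 6\<close>.\<close>

lemma chart_change_torus:
  assumes "c \<in> torus_atlas" "c' \<in> torus_atlas" "P \<in> chart_dom c" "P \<in> chart_dom c'"
  shows "chart_change c c' P v = v"
proof -
  obtain U d where U: "open U" "chart_map c P \<in> U"
    "\<And>y. y \<in> U \<Longrightarrow> (chart_map c' \<circ> chart_inv c) y = y + d"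
    using transition_translation[OF assms] by blast
  have "((\<lambda>y. y + d) has_derivative (\<lambda>v. v)) (at (chart_map c P))"
    by (auto intro!: derivative_eq_intros)
  then have "frechet_derivative (\<lambda>y. y + d) (at (chart_map c P)) = (\<lambda>v. v)"
    by (rule frechet_derivative_at[symmetric])
  then show ?thesis
    using frechet_eq_local(2)[OF U(1,2), of "chart_map c' \<circ> chart_inv c" "\<lambda>y. y + d"] U(3)
    by (simp add: chart_change_def)
qed

lemma smooth_transition:
  assumes "c \<in> torus_atlas" "c' \<in> torus_atlas"
  shows "smooth_on (chart_map c ` (chart_dom c \<inter> chart_dom c')) (chart_map c' \<circ> chart_inv c)"
proof -
  have "chart_map c ` (chart_dom c \<inter> chart_dom c') = chart_img c \<inter> proj -` chart_dom c'"
  proof (intro set_eqI iffI)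
    fix x assume "x \<in> chart_img c \<inter> proj -` chart_dom c'"
    then show "x \<in> chart_map c ` (chart_dom c \<inter> chart_dom c')"
      using proj_in_dom[OF assms(1)] chart_map_proj[OF assms(1)]
      by (intro image_eqI[of _ _ "proj x"]) auto
  qed (use proj_chart_map[OF assms(1)] in auto)
  moreover have "open (chart_img c \<inter> proj -` chart_dom c')"
    using open_chart_img[OF assms(1)] openin_chart_dom[OF assms(2)] by (auto simp: openin_torus)
  ultimately have "open (chart_map c ` (chart_dom c \<inter> chart_dom c'))" by simp
  then have "Ck_on k (chart_map c ` (chart_dom c \<inter> chart_dom c')) (chart_map c' \<circ> chart_inv c)" for k
  proof (rule Ck_on_locally_translation)
    fix x assume "x \<in> chart_map c ` (chart_dom c \<inter> chart_dom c')"
    then obtain P where "x = chart_map c P" "P \<in> chart_dom c" "P \<in> chart_dom c'" by blast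
    then show "\<exists>U d. open U \<and> x \<in> U \<and> (\<forall>y\<in>U. (chart_map c' \<circ> chart_inv c) y = y + d)"
      using transition_translation[OF assms] by blast
  qed
  then show ?thesis by (simp add: smooth_on_def)
qed

lemma homeomorphic_chart:
  assumes "c \<in> torus_atlas"
  shows "homeomorphic_map (subtopology torus_top (chart_dom c)) (top_of_set (chart_img c)) (chart_map c)"
proof -
  note facts = torus_chart_facts[OF assms]
  have top: "topspace (subtopology torus_top (chart_dom c)) = chart_dom c"
    using openin_subset[OF facts(2)] by auto
  have "continuous_map (subtopology torus_top (chart_dom c)) (top_of_set (chart_img c)) (chart_map c)"
    unfolding continuous_map_def top
  proof (intro conjI allI impI)
    fix U assume "openin (top_of_set (chart_img c)) U"
    then have U: "open U" "U \<subseteq> chart_img c"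
      using facts(1) by (auto simp: openin_open_eq)
    have "{P \<in> chart_dom c. chart_map c P \<in> U} = proj ` U"
      using facts(4-6) U(2) by (force simp: image_iff)
    then show "openin (subtopology torus_top (chart_dom c)) {P \<in> chart_dom c. chart_map c P \<in> U}"
      using open_proj[OF U(1)] facts(2) by (auto simp: openin_open_subtopology)
  qed auto
  moreover have "continuous_map (top_of_set (chart_img c)) (subtopology torus_top (chart_dom c)) proj"
    using continuous_map_from_subtopology[OF continuous_proj] facts(4)
    by (auto simp: continuous_map_in_subtopology)
  ultimately have "homeomorphic_maps (subtopology torus_top (chart_dom c)) (top_of_set (chart_img c)) (chart_map c) proj"
    using facts(5,6) unfolding homeomorphic_maps_def top by auto
  then show ?thesis by (auto simp: homeomorphic_map_maps)
qed

lemma smooth_manifold_torus: "smooth_manifold torus_top torus_atlas"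
proof -
  have "(\<Union>c\<in>torus_atlas. chart_dom c) = topspace torus_top"
    by (force simp: topspace_torus torus_atlas_def torus_chart_def)
  then show ?thesis
    unfolding smooth_manifold_def
    by (intro conjI ballI Hausdorff_torus second_countable_torus openin_chart_dom open_chart_img
        homeomorphic_chart smooth_transition)
qed

section \<open>Invariant forms and the operators on the torus\<close>

text \<open>The choice of representative is immaterial, because \<open>coframe\<close> is
  periodic.\<close>

definition rep :: "(real ^ 6) set \<Rightarrow> real ^ 6" where
  "rep P = (SOME x. proj x = P)"

definition torus :: "((real ^ 6) set, 6) hermitian_data" where
  "torus = \<lparr>pts = torus_top, atlas = torus_atlas,
     acs = (\<lambda>P v. coframe_inv (rep P) (J0 (coframe (rep P) v))),
     metric = (\<lambda>P u v. coframe (rep P) u \<bullet> coframe (rep P) v)\<rparr>"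

lemma torus_simps [simp]:
  "pts torus = torus_top" "atlas torus = torus_atlas"
  "acs torus P = (\<lambda>v. coframe_inv (rep P) (J0 (coframe (rep P) v)))"
  "metric torus P = (\<lambda>u v. coframe (rep P) u \<bullet> coframe (rep P) v)"
  by (simp_all add: torus_def)

lemma proj_rep: "P \<in> range proj \<Longrightarrow> proj (rep P) = P"
  unfolding rep_def by (rule someI_ex) auto

lemma coframe_rep: "coframe (rep (proj x)) = coframe x"
proof -
  have "lat (rep (proj x)) x" by (simp add: proj_rep flip: proj_eq_iff)
  then obtain k :: int where "rep (proj x) $ 2 = x $ 2 + 2 * pi * of_int k" by (auto simp: lat_def)
  then show ?thesis by (rule coframe_periodic)
qed

lemma coframe_inv_rep: "coframe_inv (rep (proj x)) = coframe_inv x"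
  by (metis coframe_coframe_inv coframe_rep ext)

lemma chart_at_torus:
  assumes "P \<in> range proj"
  shows "chart_at torus_atlas P \<in> torus_atlas" "P \<in> chart_dom (chart_at torus_atlas P)"
proof -
  obtain x where "P = proj x" using assms by auto
  then have "torus_chart x \<in> torus_atlas \<and> P \<in> chart_dom (torus_chart x)"
    by (simp add: torus_atlas_def torus_chart_def)
  then have "chart_at torus_atlas P \<in> torus_atlas \<and> P \<in> chart_dom (chart_at torus_atlas P)"
    unfolding chart_at_def by (rule someI)
  then show "chart_at torus_atlas P \<in> torus_atlas" "P \<in> chart_dom (chart_at torus_atlas P)" by auto
qed

lemma vec_at_torus:
  assumes "c \<in> torus_atlas" "P \<in> chart_dom c"
  shows "vec_at torus c P = (\<lambda>v. v)" "comps_at torus c P = (\<lambda>v. v)"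
proof -
  have "P \<in> range proj"
    using openin_subset[OF openin_chart_dom[OF assms(1)]] assms(2) topspace_torus by auto
  then show "vec_at torus c P = (\<lambda>v. v)" "comps_at torus c P = (\<lambda>v. v)"
    using chart_at_torus[of P] assms
    by (simp_all add: fun_eq_iff vec_at_def comps_at_def chart_change_torus)
qed

lemma smooth_on_chart:
  assumes "c \<in> torus_atlas" "smooth_on (chart_img c) g" "\<And>x. x \<in> chart_img c \<Longrightarrow> f x = g x"
  shows "smooth_on (chart_img c) f"
  using Ck_on_cong[OF open_chart_img[OF assms(1)] assms(3)] assms(2) by (simp add: smooth_on_def)

lemma almost_complex_torus: "almost_complex_structure torus"
  unfolding almost_complex_structure_def torus_simps
proof (intro conjI ballI allI)
  fix P v
  show "linear (\<lambda>v. coframe_inv (rep P) (J0 (coframe (rep P) v)))"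
    using linear_compose[OF linear_compose[OF linear_coframe linear_J0] linear_coframe_inv] by (simp add: o_def)
  show "coframe_inv (rep P) (J0 (coframe (rep P) (coframe_inv (rep P) (J0 (coframe (rep P) v))))) = - v"
    by (simp add: J0_J0 linear_neg[OF linear_coframe_inv])
next
  fix c v assume c: "c \<in> torus_atlas"
  show "smooth_on (chart_img c) (\<lambda>x. let p = chart_inv c x in
      comps_at torus c p (coframe_inv (rep p) (J0 (coframe (rep p) (vec_at torus c p v)))))"
    by (rule smooth_on_chart[OF c smooth_conj_coframe[OF open_chart_img[OF c] linear_J0, of v]])
       (simp add: Let_def chart_inv_eq[OF c] vec_at_torus[OF c] proj_in_dom[OF c] coframe_rep coframe_inv_rep)
qed

lemma bilinear_inner: "bilinear (\<lambda>u v :: 'a::real_inner. u \<bullet> v)"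
  by (simp add: bilinear_def linear_iff inner_add_left inner_add_right)

lemma riemannian_torus: "riemannian_metric torus"
  unfolding riemannian_metric_def torus_simps
proof (intro conjI ballI allI impI)
  fix P u v
  show "bilinear (\<lambda>u v. coframe (rep P) u \<bullet> coframe (rep P) v)"
    using linear_coframe[of "rep P"]
    by (simp add: bilinear_def linear_iff inner_add_left inner_add_right)
  show "coframe (rep P) u \<bullet> coframe (rep P) v = coframe (rep P) v \<bullet> coframe (rep P) u"
    by (rule inner_commute)
next
  fix P v assume "v \<noteq> (0 :: real ^ 6)"
  then have "coframe (rep P) v \<noteq> 0"
    by (metis coframe_coframe_inv(2) linear_0 linear_coframe_inv)
  then show "0 < coframe (rep P) v \<bullet> coframe (rep P) v" by simp
next
  fix c u v assume c: "c \<in> torus_atlas"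
  show "smooth_on (chart_img c) (\<lambda>x. let p = chart_inv c x in
      coframe (rep p) (vec_at torus c p u) \<bullet> coframe (rep p) (vec_at torus c p v))"
    by (rule smooth_on_chart[OF c smooth_bilinear_coframe[OF open_chart_img[OF c] bilinear_inner, of u v]])
       (simp add: Let_def chart_inv_eq[OF c] vec_at_torus[OF c] proj_in_dom[OF c] coframe_rep)
qed

lemma almost_hermitian_torus: "almost_hermitian torus"
  unfolding almost_hermitian_def
  using smooth_manifold_torus almost_complex_torus riemannian_torus by (simp add: J0_isometry)

text \<open>Forms with constant coefficients in the rotating coframe; each operator below acts on
  the coefficient form \<open>a\<close> alone.\<close>

definition inv_form :: "cform \<Rightarrow> ((real ^ 6) set, 6) form" where
  "inv_form a P = (if P \<in> range proj then pull (coframe (rep P)) a else 0)"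

lemma inv_form_simps:
  "inv_form (a + b) = inv_form a + inv_form b" "inv_form (- a) = - inv_form a" "inv_form 0 = 0"
  by (auto simp: fun_eq_iff inv_form_def)

lemma inv_form_proj: "inv_form a (proj x) = pull (coframe x) a"
  by (simp add: inv_form_def coframe_rep)

lemma inv_form_eq_0_iff: "inv_form a = 0 \<longleftrightarrow> a = 0"
proof
  assume "inv_form a = 0"
  then have "pull (coframe 0) a = 0" by (metis inv_form_proj zero_fun_apply)
  then have "a (map (coframe 0) (map (coframe_inv 0) vs)) = 0" for vs
    by (simp add: fun_eq_iff pull_def del: map_map)
  then show "a = 0" by (simp add: fun_eq_iff o_def)
qed (simp add: inv_form_simps)

lemma fund_form_torus: "fund_form torus = inv_form \<omega>0"
  by (auto simp: fun_eq_iff fund_form_def inv_form_def pull_def \<omega>0_apply topspace_torus)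

lemma vol_form_torus: "P \<in> range proj \<Longrightarrow> vol_form torus P = pull (coframe (rep P)) vol0"
  by (simp add: fun_eq_iff vol_form_def vol0_eq fund_form_torus inv_form_def wedge_power_def
      numeral_3_eq_3 fact_numeral unit_form_def[abs_def, symmetric] wedge_unit_right pull_wedge)
     (simp add: smul_def)

lemma lefschetz_torus: "lefschetz torus (inv_form a) = inv_form (wedge \<omega>0 a)"
  by (auto simp: fun_eq_iff lefschetz_def fund_form_torus inv_form_def pull_wedge)

lemma bideg_torus: "bideg torus p q (inv_form a) = inv_form (bid J0 p q a)"
  unfolding bideg_eq_bid inv_form_def torus_simps topspace_torus
  by (auto simp: fun_eq_iff bid_pull[OF linear_coframe, of _ _ J0])

lemma ext_d_torus:
  assumes "malt a"
  shows "ext_d torus (inv_form a) = inv_form (d0 a)"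
proof (intro ext)
  fix P vs
  show "ext_d torus (inv_form a) P vs = inv_form (d0 a) P vs"
  proof (cases "P \<in> range proj")
    case True
    define c where "c = chart_at torus_atlas P"
    have c: "c \<in> torus_atlas" "P \<in> chart_dom c" using chart_at_torus[OF True] by (simp_all add: c_def)
    define x where "x = chart_map c P"
    have x: "x \<in> chart_img c" "proj x = P" using c proj_chart_map by (auto simp: x_def)
    \<comment> \<open>In the chart the form agrees with the explicit function on an open
      neighbourhood of \<open>x\<close>, which determines the derivative.\<close>
    have "frechet_derivative (\<lambda>y. inv_form a (chart_inv c y) (map (vec_at torus c (chart_inv c y)) ws)) (at x)
        = frechet_derivative (\<lambda>y. a (map (coframe y) ws)) (at x)" for ws
      by (rule frechet_eq_local(2)[OF open_chart_img[OF c(1)] x(1)])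
         (simp add: chart_inv_eq[OF c(1)] vec_at_torus[OF c(1)] proj_in_dom[OF c(1)] inv_form_proj pull_def)
    then have "ext_d torus (inv_form a) P vs = pull (coframe x) (d0 a) vs"
      using True ext_derivative_pull_coframe[OF assms, of vs x]
      by (simp add: ext_d_def Let_def topspace_torus x_def c_def del: map_append)
    then show ?thesis using inv_form_proj[of "d0 a" x] x(2) by simp
  qed (simp add: ext_d_def inv_form_def topspace_torus)
qed

lemma hodge_torus:
  assumes "star_rel b c" "malt b" "malt c"
  shows "hodge torus (inv_form b) = inv_form c"
proof
  fix P show "hodge torus (inv_form b) P = inv_form c P"
  proof (cases "P \<in> range proj")
    case True
    have "star_pt (\<lambda>u v. coframe (rep P) u \<bullet> coframe (rep P) v) (pull (coframe (rep P)) vol0) (pull (coframe (rep P)) b)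
        = pull (coframe (rep P)) c"
      by (rule star_pt_pull[OF linear_coframe bij_coframe onb_bs6 assms(2,3) malt_vol0 vol0_bs6])
         (use assms(1) in \<open>simp add: star_rel_def\<close>)
    then show ?thesis
      using True by (simp add: hodge_def topspace_torus vol_form_torus inv_form_def)
  qed (simp add: hodge_def inv_form_def topspace_torus)
qed

lemma del_torus:
  assumes "malt a" "pure_type J0 p q a" "p \<le> 3" "q \<le> 3"
  shows "del torus (inv_form a) = inv_form (bid J0 (Suc p) q (d0 a))"
    and "delbar torus (inv_form a) = inv_form (bid J0 p (Suc q) (d0 a))"
proof -
  \<comment> \<open>Of the sixteen projections summed in \<open>del\<close> and
    \<open>delbar\<close> only one is nonzero.\<close>
  have d: "ext_d torus (bideg torus r s (inv_form a)) = (if r = p \<and> s = q then inv_form (d0 a) else 0)" for r s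
  proof -
    have "ext_d torus 0 = 0"
      using ext_d_torus[OF malt_zero] by (simp add: inv_form_simps d0_def)
    then show ?thesis
      using assms(2) by (simp add: bideg_torus pure_type_def ext_d_torus[OF assms(1)] inv_form_simps)
  qed
  have b: "bideg torus r s 0 = 0" for r s
    using bideg_torus[of r s 0] by (simp add: inv_form_simps)
  have "bideg torus (Suc r) s (ext_d torus (bideg torus r s (inv_form a)))
      = (if r = p then if s = q then inv_form (bid J0 (Suc p) q (d0 a)) else 0 else 0)"
    "bideg torus r (Suc s) (ext_d torus (bideg torus r s (inv_form a)))
      = (if r = p then if s = q then inv_form (bid J0 p (Suc q) (d0 a)) else 0 else 0)" for r s
    unfolding d by (simp_all add: b bideg_torus)
  moreover have "(\<Sum>r\<le>3. \<Sum>s\<le>3. if r = p then if s = q then X else 0 else 0) = X"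
    for X :: "((real ^ 6) set, 6) form"
  proof -
    have "(\<Sum>s\<le>3. if r = p then if s = q then X else 0 else 0) = (if r = p then X else 0)" for r
      using assms(4) by (cases "r = p") simp_all
    then show ?thesis using assms(3) by simp
  qed
  ultimately show "del torus (inv_form a) = inv_form (bid J0 (Suc p) q (d0 a))"
    "delbar torus (inv_form a) = inv_form (bid J0 p (Suc q) (d0 a))"
    by (simp_all add: del_def delbar_def)
qed

lemma inv_form_smooth:
  assumes "alt_form k a"
  shows "inv_form a \<in> smooth_forms torus k"
proof -
  have a: "malt a" using assms by (simp add: alt_form_iff_malt)
  have "alt_form k (pull E a)" if "linear E" for E :: "real ^ 6 \<Rightarrow> real ^ 6"
    using assms malt_pull[OF that] by (simp add: alt_form_iff_malt pull_def)
  moreover have "smooth_on (chart_img c) (\<lambda>x. let p = chart_inv c x in inv_form a p (map (vec_at torus c p) vs))"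
    if c: "c \<in> torus_atlas" for c vs
    by (rule smooth_on_chart[OF c smooth_pull_coframe[OF open_chart_img[OF c] a, of vs]])
       (simp add: Let_def chart_inv_eq[OF c] vec_at_torus[OF c] proj_in_dom[OF c] inv_form_proj pull_def)
  ultimately show ?thesis
    by (auto simp: smooth_forms_def topspace_torus inv_form_def linear_coframe)
qed

section \<open>Tables of the operators on the finitely many forms involved\<close>

lemma malt_forms:
  "malt \<alpha>1" "malt \<alpha>2" "malt \<beta>1" "malt \<beta>2" "malt \<gamma>1" "malt \<gamma>2" "malt \<tau>1" "malt \<tau>2"
  "malt \<sigma>1" "malt \<sigma>2" "malt \<rho>1" "malt \<rho>2"
  by (intro malt_intros malt_zw)+

lemma pure_forms:
  "pure_type J0 (Suc 0) (Suc 0) \<alpha>1" "pure_type J0 (Suc 0) (Suc 0) \<alpha>2"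
  "pure_type J0 (Suc (Suc 0)) (Suc 0) \<beta>1" "pure_type J0 (Suc 0) (Suc (Suc 0)) \<beta>2"
  "pure_type J0 (Suc (Suc 0)) (Suc 0) \<gamma>1" "pure_type J0 (Suc 0) (Suc (Suc 0)) \<gamma>2"
  "pure_type J0 (Suc (Suc 0)) 0 \<tau>1" "pure_type J0 0 (Suc (Suc 0)) \<tau>2"
  "pure_type J0 (Suc (Suc 0)) (Suc (Suc 0)) \<sigma>1" "pure_type J0 (Suc (Suc 0)) (Suc (Suc 0)) \<sigma>2"
  by (intro pure_type_z pure_type_unit)+

lemma del_torusI:
  assumes "malt a" "pure_type J0 p q a" "p \<le> 3" "q \<le> 3"
  shows "bid J0 (Suc p) q (d0 a) = b \<Longrightarrow> del torus (inv_form a) = inv_form b"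
    and "bid J0 p (Suc q) (d0 a) = b \<Longrightarrow> delbar torus (inv_form a) = inv_form b"
  using del_torus[OF assms] by auto

lemmas bid_d0_forms = bid_d0_\<alpha> bid_d0_\<beta> bid_d0_\<tau> bid_d0_\<gamma>

lemmas del_calc = malt_forms malt_smul malt_add pure_forms pure_type_smul pure_type_add
  d0_linear bid_linear d0_\<sigma> bid_d0_forms[unfolded numeral_2_eq_2 numeral_3_eq_3 One_nat_def] mult.commute

lemma del_zero: "del torus 0 = 0" "delbar torus 0 = 0"
  using del_torus[OF malt_zero pure_type_zero, of 0 0] by (simp_all add: inv_form_simps d0_def)

text \<open>The free scalar lets the tables be chained by rewriting when operators are
  composed.\<close>

lemma del_\<alpha>:
  "del torus (inv_form (smul c \<alpha>1)) = inv_form (smul (2 * c) \<beta>1)"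
  "delbar torus (inv_form (smul c \<alpha>1)) = 0"
  "del torus (inv_form (smul c \<alpha>2)) = 0"
  "delbar torus (inv_form (smul c \<alpha>2)) = inv_form (smul (2 * c) \<beta>2)"
  unfolding inv_form_simps(3)[symmetric]
  by (rule del_torusI[where p = "Suc 0" and q = "Suc 0"]; simp add: del_calc)+

lemma del_\<sigma>:
  "del torus (inv_form (smul c \<sigma>1)) = 0" "delbar torus (inv_form (smul c \<sigma>1)) = 0"
  "del torus (inv_form (smul c \<sigma>2)) = 0" "delbar torus (inv_form (smul c \<sigma>2)) = 0"
  unfolding inv_form_simps(3)[symmetric]
  by (rule del_torusI[where p = "Suc (Suc 0)" and q = "Suc (Suc 0)"]; simp add: del_calc)+

lemma del_\<beta>1:
  "del torus (inv_form (smul c \<beta>1)) = inv_form (smul (5 * c) \<rho>1)"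
  "delbar torus (inv_form (smul c \<beta>1 + smul e \<gamma>1)) = inv_form (smul (2 * c) \<sigma>1)"
  by (rule del_torusI[where p = "Suc (Suc 0)" and q = "Suc 0"]; simp add: del_calc)+

lemma del_\<beta>2:
  "delbar torus (inv_form (smul c \<beta>2)) = inv_form (smul (- 5 * c) \<rho>2)"
  "del torus (inv_form (smul c \<beta>2 + smul e \<gamma>2)) = inv_form (smul (- 2 * c) \<sigma>2)"
  by (rule del_torusI[where p = "Suc 0" and q = "Suc (Suc 0)"]; simp add: del_calc)+

lemma del_\<tau>:
  "delbar torus (inv_form (smul c \<tau>1)) = inv_form (smul (- 5 * c) \<beta>1 + smul (2 * c) \<gamma>1)"
  "del torus (inv_form (smul c \<tau>2)) = inv_form (smul (- 5 * c) \<beta>2 + smul (2 * c) \<gamma>2)"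
  by (rule del_torusI[where p = "Suc (Suc 0)" and q = 0]; simp add: del_calc smul_distrib)
     (rule del_torusI[where p = 0 and q = "Suc (Suc 0)"]; simp add: del_calc smul_distrib)

lemma hodge_zero: "hodge torus 0 = 0"
proof -
  have "star_rel 0 0" using star_rel_smul[OF star_\<alpha>(1), of 0] by simp
  then show ?thesis using hodge_torus[OF _ malt_zero malt_zero] by (simp add: inv_form_simps)
qed

lemma hodge_smul:
  assumes "star_rel b (smul k c)" "malt b" "malt c"
  shows "hodge torus (inv_form (smul e b)) = inv_form (smul (e * k) c)"
  using hodge_torus[OF star_rel_smul[OF assms(1), of e]] assms(2,3) by (simp add: malt_smul)

lemma hodge_forms:
  "hodge torus (inv_form (smul e \<alpha>1)) = inv_form (smul (- \<i> / 2 * e) \<sigma>1)"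
  "hodge torus (inv_form (smul e \<alpha>2)) = inv_form (smul (- \<i> / 2 * e) \<sigma>2)"
  "hodge torus (inv_form (smul e \<sigma>1)) = inv_form (smul (2 * \<i> * e) \<alpha>1)"
  "hodge torus (inv_form (smul e \<sigma>2)) = inv_form (smul (2 * \<i> * e) \<alpha>2)"
  "hodge torus (inv_form (smul e \<rho>1)) = inv_form (smul (- 2 * \<i> * e) \<tau>1)"
  "hodge torus (inv_form (smul e \<rho>2)) = inv_form (smul (- 2 * \<i> * e) \<tau>2)"
  using star_\<alpha> star_\<sigma> star_\<rho> hodge_smul malt_forms by (simp_all add: mult.commute)

lemma hodge_\<beta>:
  "hodge torus (inv_form (smul c \<beta>1 + smul e \<gamma>1)) = inv_form (smul (\<i> * c) \<beta>1 + smul (\<i> * e) \<gamma>1)"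
  "hodge torus (inv_form (smul c \<beta>2 + smul e \<gamma>2)) = inv_form (smul (- \<i> * c) \<beta>2 + smul (- \<i> * e) \<gamma>2)"
  using hodge_torus[OF star_rel_add[OF star_rel_smul[OF star_\<beta>(1), of c] star_rel_smul[OF star_\<gamma>(1), of e]]]
    hodge_torus[OF star_rel_add[OF star_rel_smul[OF star_\<beta>(2), of c] star_rel_smul[OF star_\<gamma>(2), of e]]]
  by (simp_all add: malt_forms malt_smul malt_add mult.commute)

lemma adj_\<alpha>:
  "del_adj torus (inv_form (smul c \<alpha>1)) = 0" "delbar_adj torus (inv_form (smul c \<alpha>1)) = 0"
  "del_adj torus (inv_form (smul c \<alpha>2)) = 0" "delbar_adj torus (inv_form (smul c \<alpha>2)) = 0"
  by (simp_all add: del_adj_def delbar_adj_def hodge_forms del_\<sigma> hodge_zero)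

lemma uminus_inv_form: "- inv_form (smul c a) = inv_form (smul (- c) a)"
  by (simp add: smul_distrib(5) flip: inv_form_simps)

text \<open>The \<open>\<gamma>\<close> summand comes from \<open>del_\<tau>\<close>; the star keeps
  it a multiple of \<open>\<gamma>\<close>, whose differential has no (2,2) part.\<close>

lemma adj_\<beta>:
  "del_adj torus (inv_form (smul c \<beta>1 + smul e \<gamma>1)) = inv_form (smul (4 * c) \<alpha>1)"
  "delbar_adj torus (inv_form (smul c \<beta>2 + smul e \<gamma>2)) = inv_form (smul (4 * c) \<alpha>2)"
  by (simp_all add: del_adj_def delbar_adj_def hodge_forms hodge_\<beta> del_\<beta>1 del_\<beta>2 uminus_inv_form
      algebra_simps)

lemma hodge_\<beta>_smul:
  "hodge torus (inv_form (smul c \<beta>1)) = inv_form (smul (\<i> * c) \<beta>1)"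
  "hodge torus (inv_form (smul c \<beta>2)) = inv_form (smul (- \<i> * c) \<beta>2)"
  using hodge_\<beta>[of c 0] by simp_all

lemma adj_\<beta>_smul:
  "del_adj torus (inv_form (smul c \<beta>1)) = inv_form (smul (4 * c) \<alpha>1)"
  "delbar_adj torus (inv_form (smul c \<beta>2)) = inv_form (smul (4 * c) \<alpha>2)"
  "delbar_adj torus (inv_form (smul c \<beta>1)) = inv_form (smul (- 10 * c) \<tau>1)"
  "del_adj torus (inv_form (smul c \<beta>2)) = inv_form (smul (- 10 * c) \<tau>2)"
  using adj_\<beta>[of c 0]
  by (simp_all add: del_adj_def delbar_adj_def hodge_forms hodge_\<beta>_smul del_\<beta>1 del_\<beta>2 uminus_inv_form
      algebra_simps)

lemma adj_\<sigma>2: "del_adj torus (inv_form (smul c \<sigma>2)) = inv_form (smul (- 4 * c) \<beta>2)"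
  by (simp add: del_adj_def hodge_forms hodge_\<beta>_smul del_\<alpha> uminus_inv_form algebra_simps)

lemma adj_zero: "del_adj torus 0 = 0" "delbar_adj torus 0 = 0"
  by (simp_all add: del_adj_def delbar_adj_def del_zero hodge_zero)

lemma del_\<beta>2_smul: "del torus (inv_form (smul c \<beta>2)) = inv_form (smul (- 2 * c) \<sigma>2)"
  using del_\<beta>2(2)[of c 0] by simp

lemmas laplace_calc = laplace_del_def laplace_delbar_def laplace_BC_def laplace_A_def
  del_\<alpha> del_\<beta>1(1) del_\<beta>2(1) del_\<beta>2_smul del_\<tau> adj_\<alpha> adj_\<beta> adj_\<beta>_smul adj_\<sigma>2 adj_zero del_zero

text \<open>The eigenvalue 8 is \<open>2 * 4\<close> from del and its adjoint. The Bott--Chern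
  Laplacian adds the round trip through \<open>\<beta>1\<close>, \<open>\<tau>1\<close> and back,
  \<open>2 * (-10) * (-5) * 4 = 400\<close>.\<close>

lemma laplace_\<alpha>1:
  "laplace_delbar torus (inv_form (smul c \<alpha>1)) = 0"
  "laplace_A torus (inv_form (smul c \<alpha>1)) = 0"
  "laplace_del torus (inv_form (smul c \<alpha>1)) = inv_form (smul (8 * c) \<alpha>1)"
  "laplace_BC torus (inv_form (smul c \<alpha>1)) = inv_form (smul (408 * c) \<alpha>1)"
  by (simp_all add: laplace_calc inv_form_simps(3) flip: inv_form_simps(1) smul_distrib(3))

text \<open>The path through \<open>\<beta>2\<close>, \<open>\<sigma>2\<close> and back contributes
  \<open>2 * (-2) * (-4) * 4 = 64\<close> to both fourth-order Laplacians; the Bott--Chern one adds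
  400 and 8 as in the conjugate case.\<close>

lemma laplace_\<alpha>2:
  "laplace_del torus (inv_form (smul c \<alpha>2)) = 0"
  "laplace_delbar torus (inv_form (smul c \<alpha>2)) = inv_form (smul (8 * c) \<alpha>2)"
  "laplace_BC torus (inv_form (smul c \<alpha>2)) = inv_form (smul (472 * c) \<alpha>2)"
  "laplace_A torus (inv_form (smul c \<alpha>2)) = inv_form (smul (64 * c) \<alpha>2)"
  by (simp_all add: laplace_calc inv_form_simps(3) flip: inv_form_simps(1) smul_distrib(3))

section \<open>Bidegree, primitivity and nonvanishing of the two forms\<close>

lemma complex_ext_wrong_type:
  assumes "type10 J f" "type01 J g" "length us + length ws = 2" "length us \<noteq> 1"
  shows "complex_ext (wedge (one_form f) (wedge (one_form g) unit_form))
      (map (part10 J) us @ map (part01 J) ws) = 0"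
    and "complex_ext (wedge (one_form g) (wedge (one_form f) unit_form))
      (map (part10 J) us @ map (part01 J) ws) = 0"
proof -
  have unit: "cins z unit_form = 0" for z by (simp add: cins_def)
  have "length us = 2 \<and> ws = [] \<or> us = [] \<and> length ws = 2"
    using assms(3,4) by (cases us; cases ws) auto
  then consider u v where "us = [u, v]" "ws = []" | u v where "us = []" "ws = [u, v]"
    by (auto simp: length_Suc_conv numeral_2_eq_2)
  then show "complex_ext (wedge (one_form f) (wedge (one_form g) unit_form))
      (map (part10 J) us @ map (part01 J) ws) = 0"
    "complex_ext (wedge (one_form g) (wedge (one_form f) unit_form))
      (map (part10 J) us @ map (part01 J) ws) = 0"
    by (cases; simp add: complex_ext_Cons cins_type10[OF assms(1)] cins_type01[OF assms(2)]
        cins_linear wedge_linear unit form_Nil)+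
qed

lemma alt_forms: "alt_form 2 \<alpha>1" "alt_form 2 \<alpha>2"
proof -
  have "wedge (one_form f) (wedge (one_form g) unit_form) vs = 0" if "length vs \<noteq> 2" for f g and vs :: "(real ^ 6) list"
    using that by (intro wedge_one_length[of 1] wedge_one_length[of 0]) (auto simp: unit_form_def)
  then show "alt_form 2 \<alpha>1" "alt_form 2 \<alpha>2"
    using malt_forms by (simp_all add: alt_form_iff_malt zw_def)
qed

lemma pull_one_form: "pull E (one_form f) = one_form (f \<circ> E)"
  by (auto simp: fun_eq_iff pull_def one_form_def split: list.splits)

lemma alpha_in_forms: "inv_form \<alpha>1 \<in> forms torus 1 1" "inv_form \<alpha>2 \<in> forms torus 1 1"
proof -
  \<comment> \<open>The coframe intertwines the almost complex structure with \<open>J0\<close>, so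
    the types of covectors pull back.\<close>
  have type: "type10 (acs torus P) (f \<circ> coframe (rep P))" "type01 (acs torus P) (g \<circ> coframe (rep P))"
    if "type10 J0 f" "type01 J0 g" for f g P
    using that linear_compose[OF linear_coframe] by (auto simp: type10_def type01_def)
  have "inv_form \<alpha>1 \<in> smooth_forms torus (1 + 1)" "inv_form \<alpha>2 \<in> smooth_forms torus (1 + 1)"
    using inv_form_smooth[OF alt_forms(1)] inv_form_smooth[OF alt_forms(2)]
    by (simp_all only: one_add_one)
  then show "inv_form \<alpha>1 \<in> forms torus 1 1" "inv_form \<alpha>2 \<in> forms torus 1 1"
    using complex_ext_wrong_type[OF type[OF type10_cz(3) type01_cw(2)]]
      complex_ext_wrong_type[OF type[OF type10_cz(2) type01_cw(3)]]
    by (simp_all add: forms_def topspace_torus inv_form_def zw_def pull_wedge pull_one_form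
        numeral_2_eq_2 del: torus_simps(3))
qed

lemma alpha_primitive: "inv_form \<alpha>1 \<in> primitive torus 1 1" "inv_form \<alpha>2 \<in> primitive torus 1 1"
proof -
  have "lefschetz_dual torus (inv_form (smul c \<alpha>1)) = 0" "lefschetz_dual torus (inv_form (smul c \<alpha>2)) = 0" for c
    by (simp_all only: lefschetz_dual_def hodge_forms lefschetz_torus wedge_smul_right \<omega>0_wedge_\<sigma>
        smul_simps inv_form_simps(3) hodge_zero neg_equal_0_iff_equal minus_zero)
  from this[of 1] show "inv_form \<alpha>1 \<in> primitive torus 1 1" "inv_form \<alpha>2 \<in> primitive torus 1 1"
    using alpha_in_forms by (simp_all add: primitive_def)
qed

lemma alpha_smul_nonzero:
  assumes "c \<noteq> 0"
  shows "inv_form (smul c \<alpha>1) \<noteq> 0" "inv_form (smul c \<alpha>2) \<noteq> 0"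
proof -
  have "\<alpha>1 [axis 3 1, axis 5 1] = 1" "\<alpha>2 [axis 3 1, axis 5 1] = 1"
    by (simp_all add: zw_wedge_Cons ins_zw_wedge cz_cw_bs wedge_linear zw_Nil form_Nil)
  then have "smul c \<alpha>1 [axis 3 1, axis 5 1] \<noteq> 0" "smul c \<alpha>2 [axis 3 1, axis 5 1] \<noteq> 0"
    using assms by (simp_all add: smul_def)
  then have "smul c \<alpha>1 \<noteq> 0" "smul c \<alpha>2 \<noteq> 0"
    by (metis zero_fun_apply)+
  then show "inv_form (smul c \<alpha>1) \<noteq> 0" "inv_form (smul c \<alpha>2) \<noteq> 0"
    unfolding inv_form_eq_0_iff .
qed

lemma almost_kaehler_torus: "almost_kaehler torus"
  using almost_hermitian_torus ext_d_torus[OF malt_\<omega>0]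
  by (simp add: almost_kaehler_def fund_form_torus d0_def deriv_\<omega>0 inv_form_simps)

theorem proposition4p4:
  shows "\<exists>M :: ((real ^ 6) set, 6) hermitian_data.
    almost_kaehler M \<and> compact_space (pts M) \<and> connected_space (pts M) \<and>
    \<not> harm_delbar M 1 1 \<inter> primitive M 1 1 \<subseteq> harm_BC M 1 1 \<inter> primitive M 1 1 \<and>
    \<not> harm_delbar M 1 1 \<inter> primitive M 1 1 \<subseteq> harm_del M 1 1 \<inter> primitive M 1 1 \<and>
    \<not> harm_A M 1 1 \<inter> primitive M 1 1 \<subseteq> harm_BC M 1 1 \<inter> primitive M 1 1 \<and>
    \<not> harm_A M 1 1 \<inter> primitive M 1 1 \<subseteq> harm_del M 1 1 \<inter> primitive M 1 1 \<and>
    \<not> harm_del M 1 1 \<inter> primitive M 1 1 \<subseteq> harm_delbar M 1 1 \<inter> primitive M 1 1 \<and>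
    \<not> harm_del M 1 1 \<inter> primitive M 1 1 \<subseteq> harm_BC M 1 1 \<inter> primitive M 1 1 \<and>
    \<not> harm_del M 1 1 \<inter> primitive M 1 1 \<subseteq> harm_A M 1 1 \<inter> primitive M 1 1"
proof -
  have \<alpha>1: "inv_form \<alpha>1 \<in> harm_delbar torus 1 1" "inv_form \<alpha>1 \<in> harm_A torus 1 1"
    "inv_form \<alpha>1 \<notin> harm_del torus 1 1" "inv_form \<alpha>1 \<notin> harm_BC torus 1 1"
    using laplace_\<alpha>1[of 1] alpha_in_forms(1) alpha_smul_nonzero(1)
    by (simp_all add: harm_del_def harm_delbar_def harm_BC_def harm_A_def)
  have \<alpha>2: "inv_form \<alpha>2 \<in> harm_del torus 1 1" "inv_form \<alpha>2 \<notin> harm_delbar torus 1 1"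
    "inv_form \<alpha>2 \<notin> harm_BC torus 1 1" "inv_form \<alpha>2 \<notin> harm_A torus 1 1"
    using laplace_\<alpha>2[of 1] alpha_in_forms(2) alpha_smul_nonzero(2)
    by (simp_all add: harm_del_def harm_delbar_def harm_BC_def harm_A_def)
  show ?thesis
    using almost_kaehler_torus compact_torus connected_torus alpha_primitive \<alpha>1 \<alpha>2
    by (intro exI[of _ torus]) auto
qed

end
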